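(* Let $M$ be a matroid on a finite ground set $E$. The map $\mathcal{M}\mapsto \mathcal{E}_{\mathcal{M}}$, sending an orientation $\mathcal{M}$ of $M$ to the real phase structure $\mathcal{E}_{\mathcal{M}}$ on the matroid fan $\Sigma_M$ defined below, is a bijection between the set of orientations of $M$ and the set of real phase structures on $\Sigma_M$. (In other words, oriented matroids and real phase structures on matroid fans are cryptomorphic.)
   Context: Write $\mathbb{Z}_2=\mathbb{Z}/2\mathbb{Z}$. For a rational polyhedral cone $\sigma\subset\mathbb{R}^n$, $T_{\mathbb{Z}_2}(\sigma)\subseteq\mathbb{Z}_2^n$ is the reduction mod 2 of the integer points of the real linear span of $\sigma$. A collection of subsets of a set is an even covering if every element of their union lies in an even number of them. For a rational polyhedral fan $\Sigma\subset\mathbb{R}^n$ of pure dimension $d$, a real phase structure is a map $\mathcal{E}$ from the set of facets (maximal cones) of $\Sigma$ to the set of $d$-dimensional affine subspaces of $\mathbb{Z}_2^n$ such that (1) for every facet $\sigma$, the tangent (direction) space of $\mathcal{E}(\sigma)$ equals $T_{\mathbb{Z}_2}(\sigma)$; (2) for every codimension one face $\tau$ with adjacent facets $\sigma_1,\dots,\sigma_k$, the sets $\mathcal{E}(\sigma_1),\dots,\mathcal{E}(\sigma_k)$ form an even covering. Matroid fan: for a loopfree matroid $M$ on $E$, let $v_i=-e_i\in\mathbb{R}^E$ and $v_I=\sum_{i\in I}v_i$. For each chain of flats $\mathcal{F}=\{\emptyset\subsetneq F_1\subsetneq\dots\subsetneq F_k\subsetneq E\}$ let $\sigma_{\mathcal{F}}$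 be the cone generated by $v_{F_1},\dots,v_{F_k},v_E,-v_E$; $\Sigma_M$ is the fan of all these cones (its facets correspond to maximal chains of flats). If $M$ has loops $L=\mathrm{cl}(\emptyset)$, set $\Sigma_M:=\Sigma_{M/L}\subset\mathbb{R}^{E\setminus L}$. Oriented matroids (covector axioms): a set $\mathcal{C}\subseteq\{0,+1,-1\}^E$ with $0\in\mathcal{C}$; $X\in\mathcal{C}\iff -X\in\mathcal{C}$; $X,Y\in\mathcal{C}\Rightarrow X\circ Y\in\mathcal{C}$, where $(X\circ Y)_i=X_i$ if $X_i\neq0$ and $Y_i$ otherwise; and if $X,Y\in\mathcal{C}$ and $i\in S(X,Y)=\{j: X_j=-Y_j\neq 0\}$ then there is $Z\in\mathcal{C}$ with $Z_i=0$ and $Z_j=(X\circ Y)_j$ for all $j\notin S(X,Y)$. The underlying matroid $\underline{\mathcal{M}}$ has as flats exactly the sets $E\setminus\mathrm{Supp}(X)$, $X\in\mathcal{C}$. An orientation of $M$ is an oriented matroid $\mathcal{M}$ with $\underline{\mathcal{M}}=M$. Topes are the covectors maximal for the coordinatewise order $0<+1,-1$. For a tope $T$ and $F\subseteq E$, $T\setminus F$ is $T$ with coordinates in $F$ set to $0$. For a chain of flats $\mathcal{F}=\{F_0\subsetneq\dots\subsetneq F_k\}$, $\mathcal{T}(\mathcal{F})$ is the set of topes $T$ with $T\setminus F_i\in\mathcal{C}$ for all $i$. For $\varepsilon\in\mathbb{Z}_2^E$ write $(-1)^\varepsilon=((-1)^{\varepsilon_e})_{e\in E}$. For loopfree $\mathcal{M}$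 define $\mathcal{E}_{\mathcal{M}}(\sigma_{\mathcal{F}})=\{\varepsilon\in\mathbb{Z}_2^E : (-1)^\varepsilon\in\mathcal{T}(\mathcal{F})\}$ for each facet $\sigma_{\mathcal{F}}$ of $\Sigma_M$; if $\mathcal{M}$ has loops $L$, $\mathcal{E}_{\mathcal{M}}:=\mathcal{E}_{\mathcal{M}\setminus L}$ with values in $\mathbb{Z}_2^{E\setminus L}$. (It is a fact that $\mathcal{E}_{\mathcal{M}}$ is a real phase structure on $\Sigma_M$.) *)

theory Defs
  imports "HOL-Analysis.Analysis" "HOL-Library.Z2" "HOL-Library.FuncSet"
begin

(* For G a subset of a finite type 'e, the spaces R^G, Z^G, (Z/2)^G and the sign vectors on G
   are the vectors of real ^ 'e, int ^ 'e, bit ^ 'e and int ^ 'e (entries in {-1, 0, 1}) that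
   vanish outside G. *)

definition coord_space :: "'e set \<Rightarrow> ('a::zero ^ 'e) set" where
  "coord_space G = {x. \<forall>i. i \<notin> G \<longrightarrow> x $ i = 0}"


subsection \<open>Matroids\<close>

locale matroid =
  fixes E :: "'e set" and Ind :: "'e set set"
  assumes finite_ground: "finite E"
    and indep_subset: "I \<in> Ind \<Longrightarrow> I \<subseteq> E"
    and indep_empty: "{} \<in> Ind"
    and indep_down: "I \<in> Ind \<Longrightarrow> J \<subseteq> I \<Longrightarrow> J \<in> Ind"
    and indep_augment: "I \<in> Ind \<Longrightarrow> J \<in> Ind \<Longrightarrow> card I < card J \<Longrightarrow> \<exists>x\<in>J - I. insert x I \<in> Ind"

definition mat_rank :: "'e set set \<Rightarrow> 'e set \<Rightarrow> nat" where
  "mat_rank Ind A = Max (card ` {I \<in> Ind. I \<subseteq> A})"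

definition mat_closure :: "'e set \<Rightarrow> 'e set set \<Rightarrow> 'e set \<Rightarrow> 'e set" where
  "mat_closure E Ind A = {e \<in> E. mat_rank Ind (insert e A) = mat_rank Ind A}"

definition flats :: "'e set \<Rightarrow> 'e set set \<Rightarrow> 'e set set" where
  "flats E Ind = {F. F \<subseteq> E \<and> mat_closure E Ind F = F}"

definition loops :: "'e set \<Rightarrow> 'e set set \<Rightarrow> 'e set" where
  "loops E Ind = mat_closure E Ind {}"

definition basis_of :: "'e set set \<Rightarrow> 'e set \<Rightarrow> 'e set \<Rightarrow> bool" where
  "basis_of Ind A B \<longleftrightarrow> B \<in> Ind \<and> B \<subseteq> A \<and> (\<forall>I\<in>Ind. B \<subseteq> I \<and> I \<subseteq> A \<longrightarrow> I = B)"

(* Independent sets of the contraction M / A, whose ground set is E - A. *)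
definition contract :: "'e set set \<Rightarrow> 'e set \<Rightarrow> 'e set set" where
  "contract Ind A = {I. I \<inter> A = {} \<and> (\<exists>B. basis_of Ind A B \<and> I \<union> B \<in> Ind)}"


subsection \<open>Fans and real phase structures\<close>

definition facets :: "'a set set \<Rightarrow> 'a set set" where
  "facets \<Sigma> = {\<sigma> \<in> \<Sigma>. \<forall>\<sigma>'\<in>\<Sigma>. \<sigma> \<subseteq> \<sigma>' \<longrightarrow> \<sigma>' = \<sigma>}"

(* For a fan of pure dimension d this is d. *)
definition fan_dim :: "'a::euclidean_space set set \<Rightarrow> nat" where
  "fan_dim \<Sigma> = Max (dim ` \<Sigma>)"

definition codim1_faces :: "'a::euclidean_space set set \<Rightarrow> 'a set set" where
  "codim1_faces \<Sigma> = {\<tau> \<in> \<Sigma>. dim \<tau> + 1 = fan_dim \<Sigma>}"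

(* Two cones of a fan meet in a common face, so containing \<tau> and having \<tau> as a face are
   the same for cones of a fan. *)
definition adjacent_facets :: "'a set set \<Rightarrow> 'a set \<Rightarrow> 'a set set" where
  "adjacent_facets \<Sigma> \<tau> = {\<sigma> \<in> facets \<Sigma>. \<tau> \<subseteq> \<sigma>}"

definition T_Z2 :: "(real ^ 'e::finite) set \<Rightarrow> (bit ^ 'e) set" where
  "T_Z2 \<sigma> = {(\<chi> i. of_int (z $ i)) | z :: int ^ 'e. (\<chi> i. of_int (z $ i)) \<in> span \<sigma>}"

definition affine_subspaces_Z2 :: "'e set \<Rightarrow> nat \<Rightarrow> (bit ^ 'e::finite) set set" where
  "affine_subspaces_Z2 G d =
     {(+) a ` V | a V. a \<in> coord_space G \<and> V \<subseteq> coord_space G \<and> vec.subspace V \<and> vec.dim V = d}"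

definition direction :: "'a::ab_group_add set \<Rightarrow> 'a set" where
  "direction A = {x - y | x y. x \<in> A \<and> y \<in> A}"

definition even_covering :: "'i set \<Rightarrow> ('i \<Rightarrow> 'b set) \<Rightarrow> bool" where
  "even_covering S A \<longleftrightarrow> (\<forall>x \<in> (\<Union>i\<in>S. A i). even (card {i \<in> S. x \<in> A i}))"

(* Intended for \<Sigma> a pure-dimensional rational polyhedral fan in R^G. Membership in
   extensional makes \<E> a map with domain the set of facets. *)
definition real_phase_structure ::
    "'e set \<Rightarrow> (real ^ 'e::finite) set set \<Rightarrow> ((real ^ 'e) set \<Rightarrow> (bit ^ 'e) set) \<Rightarrow> bool" where
  "real_phase_structure G \<Sigma> \<E> \<longleftrightarrow>
     \<E> \<in> extensional (facets \<Sigma>) \<and>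
     (\<forall>\<sigma>\<in>facets \<Sigma>. \<E> \<sigma> \<in> affine_subspaces_Z2 G (fan_dim \<Sigma>)) \<and>
     (\<forall>\<sigma>\<in>facets \<Sigma>. direction (\<E> \<sigma>) = T_Z2 \<sigma>) \<and>
     (\<forall>\<tau>\<in>codim1_faces \<Sigma>. even_covering (adjacent_facets \<Sigma> \<tau>) \<E>)"


subsection \<open>Matroid fans\<close>

definition fan_vec :: "'e::finite set \<Rightarrow> real ^ 'e" where
  "fan_vec I = (\<Sum>i\<in>I. - axis i 1)"

(* A chain {} < F_1 < ... < F_k < E is given by the set {F_1, ..., F_k}; the empty set stands
   for the chain with k = 0, also when E = {}. *)
definition flat_chains :: "'e set \<Rightarrow> 'e set set \<Rightarrow> 'e set set set" where
  "flat_chains E Ind = {\<F>. subset.chain {F \<in> flats E Ind. F \<noteq> {} \<and> F \<noteq> E} \<F>}"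

definition flag_cone :: "'e set \<Rightarrow> 'e::finite set set \<Rightarrow> (real ^ 'e) set" where
  "flag_cone E \<F> = convex_cone hull (fan_vec ` \<F> \<union> {fan_vec E, - fan_vec E})"

definition loopfree_matroid_fan :: "'e set \<Rightarrow> 'e::finite set set \<Rightarrow> (real ^ 'e) set set" where
  "loopfree_matroid_fan E Ind = flag_cone E ` flat_chains E Ind"

definition matroid_fan :: "'e set \<Rightarrow> 'e::finite set set \<Rightarrow> (real ^ 'e) set set" where
  "matroid_fan E Ind =
     loopfree_matroid_fan (E - loops E Ind) (contract Ind (loops E Ind))"


subsection \<open>Oriented matroids\<close>

definition sign_vectors :: "'e set \<Rightarrow> (int ^ 'e::finite) set" where
  "sign_vectors E = {X \<in> coord_space E. \<forall>i. X $ i \<in> {-1, 0, 1}}"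

definition compose :: "int ^ 'e \<Rightarrow> int ^ 'e \<Rightarrow> int ^ 'e::finite" where
  "compose X Y = (\<chi> i. if X $ i \<noteq> 0 then X $ i else Y $ i)"

definition separation :: "int ^ 'e \<Rightarrow> int ^ 'e::finite \<Rightarrow> 'e set" where
  "separation X Y = {j. X $ j = - (Y $ j) \<and> X $ j \<noteq> 0}"

definition supp :: "int ^ 'e::finite \<Rightarrow> 'e set" where
  "supp X = {i. X $ i \<noteq> 0}"

locale oriented_matroid =
  fixes E :: "'e::finite set" and \<C> :: "(int ^ 'e) set"
  assumes covectors_sign: "\<C> \<subseteq> sign_vectors E"
    and covector_zero: "0 \<in> \<C>"
    and covector_neg: "X \<in> \<C> \<longleftrightarrow> - X \<in> \<C>"
    and covector_compose: "X \<in> \<C> \<Longrightarrow> Y \<in> \<C> \<Longrightarrow> compose X Y \<in> \<C>"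
    and covector_elim: "X \<in> \<C> \<Longrightarrow> Y \<in> \<C> \<Longrightarrow> i \<in> separation X Y \<Longrightarrow>
      \<exists>Z\<in>\<C>. Z $ i = 0 \<and> (\<forall>j. j \<notin> separation X Y \<longrightarrow> Z $ j = compose X Y $ j)"

definition orientations :: "'e set \<Rightarrow> 'e set set \<Rightarrow> (int ^ 'e::finite) set set" where
  "orientations E Ind =
     {\<C>. oriented_matroid E \<C> \<and> {E - supp X | X. X \<in> \<C>} = flats E Ind}"

definition sign_le :: "int ^ 'e \<Rightarrow> int ^ 'e::finite \<Rightarrow> bool" where
  "sign_le X Y \<longleftrightarrow> (\<forall>i. X $ i = 0 \<or> X $ i = Y $ i)"

definition topes :: "(int ^ 'e::finite) set \<Rightarrow> (int ^ 'e) set" where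
  "topes \<C> = {T \<in> \<C>. \<forall>X\<in>\<C>. sign_le T X \<longrightarrow> X = T}"

(* The vector written T \ F. *)
definition zero_on :: "'e set \<Rightarrow> int ^ 'e \<Rightarrow> int ^ 'e::finite" where
  "zero_on F T = (\<chi> i. if i \<in> F then 0 else T $ i)"

(* Covectors of the deletion of L: restrictions to the complement of L. *)
definition delete :: "(int ^ 'e::finite) set \<Rightarrow> 'e set \<Rightarrow> (int ^ 'e) set" where
  "delete \<C> L = zero_on L ` \<C>"

definition flag_topes :: "(int ^ 'e::finite) set \<Rightarrow> 'e set set \<Rightarrow> (int ^ 'e) set" where
  "flag_topes \<C> \<F> = {T \<in> topes \<C>. \<forall>F\<in>\<F>. zero_on F T \<in> \<C>}"

definition sign_power :: "'e set \<Rightarrow> bit ^ 'e \<Rightarrow> int ^ 'e::finite" where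
  "sign_power E \<epsilon> = (\<chi> i. if i \<in> E then (if \<epsilon> $ i = 0 then 1 else -1) else 0)"


subsection \<open>The real phase structure of an oriented matroid\<close>

(* The flag of flats \<F> is recovered from the cone \<sigma> = flag_cone E \<F>. *)
definition loopfree_phase_structure ::
    "'e set \<Rightarrow> 'e set set \<Rightarrow> (int ^ 'e) set \<Rightarrow> (real ^ 'e::finite) set \<Rightarrow> (bit ^ 'e) set" where
  "loopfree_phase_structure E Ind \<C> =
     (\<lambda>\<sigma> \<in> facets (loopfree_matroid_fan E Ind).
        {\<epsilon> \<in> coord_space E.
           sign_power E \<epsilon> \<in> flag_topes \<C> (the_inv_into (flat_chains E Ind) (flag_cone E) \<sigma>)})"

(* Ind is the family of independent sets of the underlying matroid of \<C>. *)
definition phase_structure ::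
    "'e set \<Rightarrow> 'e set set \<Rightarrow> (int ^ 'e) set \<Rightarrow> (real ^ 'e::finite) set \<Rightarrow> (bit ^ 'e) set" where
  "phase_structure E Ind \<C> =
     loopfree_phase_structure (E - loops E Ind) (contract Ind (loops E Ind))
       (delete \<C> (loops E Ind))"

end

theory Submission
  imports Defs
begin

text \<open>
  Facets of the fan correspond to flags of flats, and the affine space attached to a facet is a
  coset of the vectors that are constant on the blocks $F_{i+1} - F_i$ of its flag. For an
  orientation, elimination shows that two topes adapted to the same flag differ by block flips,
  and that a tope has either no or exactly two facets in an interval of rank two. Every covector
  is obtained from a tope adapted to some flag, so the phase structure determines the orientation.

  Conversely, the parity condition turns each interval of rank two into a necklace: alternately
  exchanging the atom and flipping it passes through all atoms. Hence any two pairs (flag, sign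
  vector) are linked by two moves, exchanging one flat and flipping the lowest block. For a circuit
  $D$ and $b, c \in D$ these moves, performed above the closure of $D - \{b, c\}$, preserve the
  relative sign of $b$ and $c$; a parity count in a necklace makes the relative signs of three
  elements consistent, which yields a sign pattern on $D$. No sign vector of the phase shows this
  pattern: the pattern could only be destroyed by a move whose lowest flat meets $D$, and in that
  case induction applies in the contraction; but some flag does start with a point of $D$.
  The covectors are the sign vectors orthogonal to all signed circuits, and elimination for them
  follows from a Farkas-type painting lemma, which needs nothing but orthogonality.
\<close>

subsection \<open>Matroids and flags of flats\<close>

text \<open>The locale \<open>phase\<close> isolates what both directions share. A real phase
  structure yields an instance by \<open>phase_of_real_phase_structure\<close>, an orientation
  yields one through \<open>PSC\<close>, and \<open>PS_coset\<close> describes both as cosets of the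
  same spaces \<open>blocks F\<close>. This closes surjectivity: on each facet the given phase is
  only shown to be contained in that of the constructed orientation, but two cosets of one space
  with a common point are equal. The obstacle in the converse direction is that a phase relates only
  flags differing in one flat, whereas the relative sign of two circuit elements must be compared
  over distant flags. Walks fix both ends of a flag instead of passing to minors, so contraction of
  a flat is simply the restriction to flags through it, and no phase on a minor has to be built. The
  covectors that certify the flats as zero sets come directly from the phase: a member of a facet
  whose flag passes through the flat, set to zero on that flat.\<close>

context matroid
begin

abbreviation rk where "rk \<equiv> mat_rank Ind"
abbreviation cl where "cl \<equiv> mat_closure E Ind"
abbreviation flat where "flat F \<equiv> F \<in> flats E Ind"

section \<open>Rank, closure and the lattice of flats\<close>

lemma finite_Ind_below: "finite {I \<in> Ind. I \<subseteq> A}"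
  by (rule finite_subset[of _ "Pow E"]) (use indep_subset finite_ground in auto)

lemma finite_indep: "I \<in> Ind \<Longrightarrow> finite I"
  using indep_subset finite_ground finite_subset by blast

lemma card_le_rk: "I \<in> Ind \<Longrightarrow> I \<subseteq> A \<Longrightarrow> card I \<le> rk A"
  unfolding mat_rank_def using finite_Ind_below by (intro Max_ge) auto

lemma obtain_basis:
  obtains J where "J \<in> Ind" "J \<subseteq> A" "card J = rk A"
proof -
  have "rk A \<in> card ` {I \<in> Ind. I \<subseteq> A}"
    unfolding mat_rank_def
    by (rule Max_in) (use finite_Ind_below indep_empty in auto)
  then show ?thesis using that by auto
qed

lemma rk_empty: "rk {} = 0"
  using obtain_basis[of "{}"] by (metis card.empty subset_empty)

lemma extend_basis:
  assumes "I \<in> Ind" "I \<subseteq> A"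
  obtains J where "J \<in> Ind" "I \<subseteq> J" "J \<subseteq> A" "card J = rk A"
proof -
  let ?S = "{J \<in> Ind. I \<subseteq> J \<and> J \<subseteq> A}"
  have fin: "finite ?S" by (rule finite_subset[OF _ finite_Ind_below[of A]]) auto
  have "?S \<noteq> {}" using assms by auto
  then have "Max (card ` ?S) \<in> card ` ?S" using fin by (intro Max_in) auto
  then obtain J where J: "J \<in> ?S" "card J = Max (card ` ?S)" by (metis (lifting) imageE)
  have J: "J \<in> ?S" "\<And>K. K \<in> ?S \<Longrightarrow> card K \<le> card J"
    using J fin by (auto intro!: Max_ge simp del: mem_Collect_eq)
  have "card J = rk A"
  proof (rule ccontr)
    assume "card J \<noteq> rk A"
    then have lt: "card J < rk A" using card_le_rk[of J A] J(1) by simp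
    obtain K where K: "K \<in> Ind" "K \<subseteq> A" "card K = rk A" by (rule obtain_basis)
    then obtain x where x: "x \<in> K - J" "insert x J \<in> Ind"
      using indep_augment[of J K] lt J(1) by auto
    then have "insert x J \<in> ?S" using K(2) J(1) by auto
    then have "card (insert x J) \<le> card J" by (rule J(2))
    then show False using x finite_indep[of J] J(1) by simp
  qed
  then show ?thesis using that J(1) by auto
qed

lemma rk_mono: "A \<subseteq> B \<Longrightarrow> rk A \<le> rk B"
  by (metis obtain_basis card_le_rk subset_trans)

lemma rk_indep: "I \<in> Ind \<Longrightarrow> rk I = card I"
  using obtain_basis[of I] card_le_rk[of I I] card_mono[of I] finite_indep[of I]
  by (metis order_antisym order_refl)

text \<open>Closure is defined by ranks, but any one basis \<open>J\<close> of \<open>A\<close>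
  decides it: augmenting \<open>J\<close> from a larger basis of \<open>insert x A\<close> can only
  add \<open>x\<close>. Monotonicity and idempotence of \<open>cl\<close> then follow by extending
  or reusing \<open>J\<close>.\<close>

lemma mem_cl_iff:
  assumes "J \<in> Ind" "J \<subseteq> A" "card J = rk A"
  shows "x \<in> cl A \<longleftrightarrow> x \<in> E \<and> (x \<in> J \<or> insert x J \<notin> Ind)"
proof
  assume x: "x \<in> cl A"
  then have "rk (insert x A) = rk A" "x \<in> E" by (auto simp: mat_closure_def)
  moreover have "card (insert x J) \<le> rk (insert x A)" if "insert x J \<in> Ind"
    by (rule card_le_rk[OF that]) (use assms in auto)
  ultimately show "x \<in> E \<and> (x \<in> J \<or> insert x J \<notin> Ind)"
    using assms finite_indep[of J] by (cases "x \<in> J") auto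
next
  assume r: "x \<in> E \<and> (x \<in> J \<or> insert x J \<notin> Ind)"
  have "rk (insert x A) = rk A"
  proof (rule ccontr)
    assume "rk (insert x A) \<noteq> rk A"
    then have lt: "rk A < rk (insert x A)" using rk_mono[OF subset_insertI, of A x] by linarith
    obtain K where K: "K \<in> Ind" "K \<subseteq> insert x A" "card K = rk (insert x A)" by (rule obtain_basis)
    then obtain y where y: "y \<in> K - J" "insert y J \<in> Ind"
      using indep_augment[of J K] lt assms by auto
    have "y \<in> A"
      using y K r by auto
    then have "card (insert y J) \<le> rk A" using y assms by (intro card_le_rk) auto
    then show False using y assms finite_indep[of J] by simp
  qed
  then show "x \<in> cl A" using r by (simp add: mat_closure_def)
qed

lemma cl_subset_ground: "cl A \<subseteq> E"
  by (auto simp: mat_closure_def)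

lemma subset_cl: "A \<subseteq> E \<Longrightarrow> A \<subseteq> cl A"
  by (auto simp: mat_closure_def insert_absorb)

lemma cl_mono: assumes "A \<subseteq> B" shows "cl A \<subseteq> cl B"
proof
  fix x assume x: "x \<in> cl A"
  obtain J where J: "J \<in> Ind" "J \<subseteq> A" "card J = rk A" by (rule obtain_basis)
  obtain K where K: "K \<in> Ind" "J \<subseteq> K" "K \<subseteq> B" "card K = rk B"
    using extend_basis[of J B] J assms by blast
  have "insert x K \<in> Ind \<Longrightarrow> insert x J \<in> Ind" by (rule indep_down[of "insert x K"]) (use K in auto)
  then show "x \<in> cl B"
    using x unfolding mem_cl_iff[OF J] mem_cl_iff[OF K(1,3,4)] using K(2) by auto
qed

lemma rk_cl: assumes "A \<subseteq> E" shows "rk (cl A) = rk A"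
proof -
  obtain J where J: "J \<in> Ind" "J \<subseteq> A" "card J = rk A" by (rule obtain_basis)
  obtain K where K: "K \<in> Ind" "J \<subseteq> K" "K \<subseteq> cl A" "card K = rk (cl A)"
    using extend_basis[of J "cl A"] J subset_cl[OF assms] by blast
  have "K \<subseteq> J"
  proof
    fix x assume "x \<in> K"
    then have "insert x J \<in> Ind" using indep_down[OF K(1), of "insert x J"] K by auto
    then show "x \<in> J" using \<open>x \<in> K\<close> K(3) mem_cl_iff[OF J, of x] by auto
  qed
  then show ?thesis using K J by auto
qed

lemma cl_idem: assumes "A \<subseteq> E" shows "cl (cl A) = cl A"
proof -
  obtain J where J: "J \<in> Ind" "J \<subseteq> A" "card J = rk A" by (rule obtain_basis)
  have J': "J \<subseteq> cl A" "card J = rk (cl A)" using J subset_cl[OF assms] rk_cl[OF assms] by auto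
  show ?thesis using mem_cl_iff[OF J] mem_cl_iff[OF J(1) J'] by auto
qed

lemma flat_cl: "A \<subseteq> E \<Longrightarrow> flat (cl A)"
  by (simp add: flats_def cl_idem cl_subset_ground)

lemma flat_subset: "flat F \<Longrightarrow> F \<subseteq> E"
  by (simp add: flats_def)

lemma cl_flat: "flat F \<Longrightarrow> cl F = F"
  by (simp add: flats_def)

lemma cl_least: "A \<subseteq> F \<Longrightarrow> flat F \<Longrightarrow> cl A \<subseteq> F"
  using cl_mono[of A F] by (simp add: cl_flat)

lemma flat_ground: "flat E"
  using cl_subset_ground subset_cl by (simp add: flats_def set_eq_subset)

lemma flat_Int: assumes "flat F" "flat G" shows "flat (F \<inter> G)"
proof -
  have "cl (F \<inter> G) \<subseteq> F \<inter> G" using cl_least assms by (meson Int_lower1 Int_lower2 le_inf_iff)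
  moreover have "F \<inter> G \<subseteq> E" using assms flat_subset by blast
  ultimately show ?thesis using subset_cl by (simp add: flats_def set_eq_subset)
qed

lemma rk_flat_less: assumes "flat F" "F \<subset> G" "G \<subseteq> E" shows "rk F < rk G"
proof -
  obtain x where x: "x \<in> G" "x \<notin> F" using assms by auto
  have "rk (insert x F) \<noteq> rk F"
    using x assms cl_flat[OF assms(1)] unfolding mat_closure_def by auto
  moreover have "rk (insert x F) \<le> rk G" using x assms by (intro rk_mono) auto
  ultimately show ?thesis using rk_mono[OF subset_insertI, of F x] by linarith
qed

lemma flat_eqI: "flat F \<Longrightarrow> F \<subseteq> G \<Longrightarrow> G \<subseteq> E \<Longrightarrow> rk G \<le> rk F \<Longrightarrow> F = G"
  using rk_flat_less[of F G] by auto

lemma rk_insert_le: "rk (insert x A) \<le> Suc (rk A)"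
proof -
  obtain K where K: "K \<in> Ind" "K \<subseteq> insert x A" "card K = rk (insert x A)" by (rule obtain_basis)
  have "card (K - {x}) \<le> rk A" using K by (intro card_le_rk) (auto intro: indep_down[of K])
  moreover have "card K \<le> Suc (card (K - {x}))"
    using finite_indep[OF K(1)] by (cases "x \<in> K") (auto simp: card_Diff_singleton)
  ultimately show ?thesis using K by linarith
qed

lemma rk_cl_insert:
  assumes "flat F" "x \<in> E" "x \<notin> F" shows "rk (cl (insert x F)) = Suc (rk F)"
proof -
  have s: "insert x F \<subseteq> E" using assms flat_subset by auto
  have "rk F < rk (insert x F)" using rk_flat_less[OF assms(1) _ s] assms by auto
  then show ?thesis using rk_insert_le[of x F] rk_cl[OF s] by simp
qed

lemma cl_insert_eq:
  assumes "flat F" "flat G" "F \<subseteq> G" "x \<in> G" "x \<notin> F" "rk G = Suc (rk F)"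
  shows "cl (insert x F) = G"
proof (rule flat_eqI)
  have s: "insert x F \<subseteq> E" using assms flat_subset by blast
  show "flat (cl (insert x F))" by (rule flat_cl[OF s])
  show "cl (insert x F) \<subseteq> G" by (rule cl_least) (use assms in auto)
  show "G \<subseteq> E" using assms flat_subset by blast
  show "rk G \<le> rk (cl (insert x F))" using rk_cl_insert[of F x] s assms by simp
qed

lemma cl_insert_cl: assumes "A \<subseteq> E" "x \<in> E" shows "cl (insert x (cl A)) = cl (insert x A)"
proof
  have 1: "insert x A \<subseteq> E" using assms by auto
  show "cl (insert x (cl A)) \<subseteq> cl (insert x A)"
    by (intro cl_least flat_cl[OF 1]) (use subset_cl[OF 1] cl_mono[of A "insert x A"] in auto)
  show "cl (insert x A) \<subseteq> cl (insert x (cl A))"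
    by (rule cl_mono) (use subset_cl[OF assms(1)] in auto)
qed

lemma exists_flat_between:
  assumes "flat F" "flat G" "F \<subseteq> G" "rk F \<le> i" "i \<le> rk G"
  shows "\<exists>H. flat H \<and> F \<subseteq> H \<and> H \<subseteq> G \<and> rk H = i"
  using assms(4,5)
proof (induction i rule: dec_induct)
  case base
  then show ?case using assms by auto
next
  case (step i)
  then obtain H where H: "flat H" "F \<subseteq> H" "H \<subseteq> G" "rk H = i" by auto
  have "H \<noteq> G" using H step by auto
  then obtain x where x: "x \<in> G" "x \<notin> H" using H by auto
  have xE: "x \<in> E" using x assms(2) flat_subset by auto
  have s: "insert x H \<subseteq> E" using xE H(1) flat_subset by auto
  have "cl (insert x H) \<subseteq> G" by (rule cl_least) (use H x assms in auto)
  then show ?case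
    using flat_cl[OF s] rk_cl_insert[OF H(1) xE x(2)] H subset_cl[OF s] by (intro exI[of _ "cl (insert x H)"]) auto
qed

section \<open>Complete flags of flats\<close>

abbreviation (input) r where "r \<equiv> rk E"

text \<open>Above the rank a flag is padded with the ground set, so that it is determined by its flats.\<close>

definition flag :: "(nat \<Rightarrow> 'e set) \<Rightarrow> bool" where
  "flag F \<longleftrightarrow> (\<forall>i. flat (F i)) \<and> (\<forall>i\<le>rk E. rk (F i) = i) \<and> (\<forall>i\<ge>rk E. F i = E) \<and>
     (\<forall>i. F i \<subseteq> F (Suc i))"

lemma flag_flat: "flag F \<Longrightarrow> flat (F i)"
  and flag_rk: "flag F \<Longrightarrow> i \<le> r \<Longrightarrow> rk (F i) = i"
  and flag_top: "flag F \<Longrightarrow> r \<le> i \<Longrightarrow> F i = E"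
  by (auto simp: flag_def)

lemma flag_mono: "flag F \<Longrightarrow> i \<le> j \<Longrightarrow> F i \<subseteq> F j"
  by (rule lift_Suc_mono_le[of F]) (auto simp: flag_def)

lemma flag_strict: assumes "flag F" "i < j" "i < r" shows "F i \<subset> F j"
proof (cases "j \<le> r")
  case True
  then show ?thesis using flag_mono[of F i j] flag_rk[of F i] flag_rk[of F j] assms by auto
next
  case False
  then show ?thesis using flag_mono[of F i j] flag_rk[of F i] flag_top[of F j] assms by auto
qed

lemma flag_sub: "flag F \<Longrightarrow> F i \<subseteq> E"
  by (simp add: flag_def flat_subset)

text \<open>Any flat of rank \<open>i\<close> between the union of the members of smaller rank and
  the intersection of those of larger rank is comparable to the whole chain.\<close>

lemma insert_chain:
  assumes ch: "\<forall>A\<in>\<G>. \<forall>B\<in>\<G>. A \<subseteq> B \<or> B \<subseteq> A" and fl: "\<forall>A\<in>\<G>. flat A"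
    and i: "i \<le> r" and miss: "\<forall>A\<in>\<G>. rk A \<noteq> i"
  shows "\<exists>H. flat H \<and> rk H = i \<and> (\<forall>A\<in>\<G>. A \<subseteq> H \<or> H \<subseteq> A)"
proof -
  \<comment> \<open>\<open>cl {}\<close> and \<open>E\<close> stand in for the union or intersection
    of an empty family, so that both bounds are flats.\<close>
  let ?lo = "cl {} \<union> \<Union>{A\<in>\<G>. rk A < i}" and ?hi = "E \<inter> \<Inter>{A\<in>\<G>. i < rk A}"
  have fin: "finite {A\<in>\<G>. rk A < i}" "finite {A\<in>\<G>. i < rk A}"
    by (rule finite_subset[of _ "Pow E"]; use fl flat_subset finite_ground in auto)+
  have lo: "flat ?lo \<and> rk ?lo \<le> i"
  proof (cases "{A\<in>\<G>. rk A < i} = {}")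
    case True
    show ?thesis unfolding True using flat_cl[of "{}"] rk_cl[of "{}"] rk_empty by simp
  next
    case False
    have "\<Union>{A\<in>\<G>. rk A < i} \<in> {A\<in>\<G>. rk A < i}"
      by (rule Union_in_chain[OF fin(1) False]) (use ch in \<open>auto simp: subset_chain_def\<close>)
    moreover have "cl {} \<subseteq> \<Union>{A\<in>\<G>. rk A < i}"
      using False fl cl_least[of "{}"] by (metis (lifting) empty_subsetI all_not_in_conv mem_Collect_eq Union_upper subset_trans)
    ultimately show ?thesis using fl by (simp add: Un_absorb1)
  qed
  have hi: "flat ?hi \<and> i \<le> rk ?hi"
  proof (cases "{A\<in>\<G>. i < rk A} = {}")
    case True
    show ?thesis unfolding True using flat_ground i by simp
  next
    case False
    have "\<Inter>{A\<in>\<G>. i < rk A} \<in> {A\<in>\<G>. i < rk A}"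
      by (rule Inter_in_chain[OF fin(2) False]) (use ch in \<open>auto simp: subset_chain_def\<close>)
    moreover from this have "\<Inter>{A\<in>\<G>. i < rk A} \<subseteq> E"
      using fl flat_subset by blast
    ultimately show ?thesis using fl by (simp add: Int_absorb1)
  qed
  have "A \<subseteq> B" if "A \<in> \<G>" "rk A < i" "B \<in> \<G>" "i < rk B" for A B
    using that ch rk_mono[of B A] by (meson not_le order.strict_trans2 less_imp_le le_less_trans less_asym)
  moreover have "cl {} \<subseteq> B" if "B \<in> \<G>" for B using that fl cl_least[of "{}" B] by simp
  moreover have "A \<subseteq> E" if "A \<in> \<G>" for A using that fl flat_subset by blast
  ultimately have "?lo \<subseteq> ?hi" using cl_subset_ground[of "{}"]
    by (intro Un_least Int_greatest Union_least Inter_greatest) auto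
  then obtain H where H: "flat H" "?lo \<subseteq> H" "H \<subseteq> ?hi" "rk H = i"
    using exists_flat_between[of ?lo ?hi i] lo hi by auto
  have "A \<subseteq> H \<or> H \<subseteq> A" if "A \<in> \<G>" for A
  proof -
    have "rk A < i \<or> i < rk A" using miss that by (metis linorder_neqE_nat)
    then show ?thesis using H that by blast
  qed
  then show ?thesis using H by blast
qed

lemma chain_rank_inj:
  assumes "A \<subseteq> B \<or> B \<subseteq> A" "flat A" "flat B" "rk A = rk B" shows "A = B"
  using assms flat_eqI[of A B] flat_eqI[of B A] flat_subset by auto

lemma chain_extend_upto:
  assumes ch: "\<forall>A\<in>\<G>. \<forall>B\<in>\<G>. A \<subseteq> B \<or> B \<subseteq> A" and fl: "\<forall>A\<in>\<G>. flat A"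
    and n: "n \<le> Suc r"
  shows "\<exists>\<H>. \<G> \<subseteq> \<H> \<and> (\<forall>A\<in>\<H>. \<forall>B\<in>\<H>. A \<subseteq> B \<or> B \<subseteq> A) \<and> (\<forall>A\<in>\<H>. flat A) \<and> (\<forall>i<n. \<exists>A\<in>\<H>. rk A = i)"
  using n
proof (induction n)
  case 0
  then show ?case using assms by auto
next
  case (Suc n)
  then obtain \<H> where \<H>: "\<G> \<subseteq> \<H>" "\<forall>A\<in>\<H>. \<forall>B\<in>\<H>. A \<subseteq> B \<or> B \<subseteq> A" "\<forall>A\<in>\<H>. flat A" "\<forall>i<n. \<exists>A\<in>\<H>. rk A = i"
    by auto
  show ?case
  proof (cases "\<exists>A\<in>\<H>. rk A = n")
    case True
    then show ?thesis using \<H> by (intro exI[of _ \<H>]) (auto simp: less_Suc_eq)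
  next
    case False
    then obtain H where H: "flat H" "rk H = n" "\<forall>A\<in>\<H>. A \<subseteq> H \<or> H \<subseteq> A"
      using insert_chain[of \<H> n] \<H> Suc.prems by auto
    show ?thesis
      using H \<H> by (intro exI[of _ "insert H \<H>"]) (auto simp: less_Suc_eq)
  qed
qed

lemma flag_extend:
  assumes ch: "\<forall>A\<in>\<G>. \<forall>B\<in>\<G>. A \<subseteq> B \<or> B \<subseteq> A" and fl: "\<forall>A\<in>\<G>. flat A"
  obtains F where "flag F" "\<And>A. A \<in> \<G> \<Longrightarrow> F (rk A) = A"
proof -
  obtain \<H> where \<H>: "\<G> \<subseteq> \<H>" "\<forall>A\<in>\<H>. \<forall>B\<in>\<H>. A \<subseteq> B \<or> B \<subseteq> A" "\<forall>A\<in>\<H>. flat A" "\<forall>i<Suc r. \<exists>A\<in>\<H>. rk A = i"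
    using chain_extend_upto[OF assms, of "Suc r"] by auto
  then obtain f where f: "\<And>i. i < Suc r \<Longrightarrow> f i \<in> \<H> \<and> rk (f i) = i" by metis
  define F where "F i = (if i < Suc r then f i else E)" for i
  have fr: "f r = E" using f[of r] flat_eqI[of "f r" E] \<H>(3) flat_subset[of "f r"] by simp
  have "flag F"
    unfolding flag_def
  proof (intro conjI allI impI)
    fix i
    show "flat (F i)" using f \<H>(3) flat_ground by (auto simp: F_def)
    show "i \<le> r \<Longrightarrow> rk (F i) = i" using f by (auto simp: F_def)
    show "r \<le> i \<Longrightarrow> F i = E" using fr by (auto simp: F_def less_Suc_eq)
    show "F i \<subseteq> F (Suc i)"
    proof (cases "Suc i < Suc r")
      case True
      then have "f i \<in> \<H>" "f (Suc i) \<in> \<H>" "rk (f i) = i" "rk (f (Suc i)) = Suc i" using f[of i] f[of "Suc i"] by auto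
      then have "f i \<subseteq> f (Suc i)" using \<H>(2) rk_mono[of "f (Suc i)" "f i"]
        by (metis not_less_eq_eq order_refl)
      then show ?thesis using True by (simp add: F_def)
    next
      case False
      then show ?thesis using f[of i] \<H>(3) flat_subset[of "f i"] by (simp add: F_def)
    qed
  qed
  moreover have "F (rk A) = A" if "A \<in> \<G>" for A
  proof -
    have "rk A \<le> r" using that fl flat_subset by (intro rk_mono) simp
    then have "f (rk A) \<in> \<H>" "rk (f (rk A)) = rk A" using f[of "rk A"] by auto
    moreover have "A \<in> \<H>" using \<H>(1) that by auto
    ultimately have "f (rk A) = A" using chain_rank_inj[of "f (rk A)" A] \<H>(2,3) by simp
    then show ?thesis using \<open>rk A \<le> r\<close> by (simp add: F_def)
  qed
  ultimately show ?thesis using that by blast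
qed

lemma flag_eqI: "flag F \<Longrightarrow> flag F' \<Longrightarrow> (\<And>i. i < r \<Longrightarrow> F i = F' i) \<Longrightarrow> F = F'"
  by (rule ext) (metis flag_top not_less)

text \<open>Two different covers of \<open>A\<close> meet in \<open>A\<close>. If \<open>A\<close>
  is not yet a hyperplane of \<open>B\<close>, some \<open>y\<close> in \<open>B\<close> lies
  outside \<open>cl (insert x A)\<close>, and the cover through \<open>y\<close> misses
  \<open>x\<close>; the induction continues with that cover.\<close>

lemma exists_hyperplane_avoiding:
  assumes "flat A" "flat B" "A \<subseteq> B" "x \<in> B" "x \<notin> A"
  shows "\<exists>H. flat H \<and> A \<subseteq> H \<and> H \<subseteq> B \<and> x \<notin> H \<and> Suc (rk H) = rk B"
  using assms
proof (induction "rk B - rk A" arbitrary: A rule: less_induct)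
  case less
  have BE: "B \<subseteq> E" using less.prems flat_subset by auto
  have xE: "x \<in> E" and AE: "insert x A \<subseteq> E" using less.prems BE by auto
  have lt: "rk A < rk B" using rk_flat_less[of A B] less.prems BE by auto
  show ?case
  proof (cases "Suc (rk A) = rk B")
    case True
    then show ?thesis using less.prems by auto
  next
    case False
    let ?X = "cl (insert x A)"
    have rX: "rk ?X = Suc (rk A)" "flat ?X" using rk_cl_insert[of A x] less.prems xE flat_cl[OF AE] by auto
    have "?X \<subseteq> B" by (rule cl_least) (use less.prems in auto)
    moreover have "?X \<noteq> B" using rX False by auto
    ultimately obtain y where y: "y \<in> B" "y \<notin> ?X" by blast
    have yE: "y \<in> E" and yA: "y \<notin> A" and AyE: "insert y A \<subseteq> E"
      using y BE subset_cl[OF AE] AE by auto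
    let ?Y = "cl (insert y A)"
    have Y: "flat ?Y" "rk ?Y = Suc (rk A)" "?Y \<subseteq> B" "A \<subseteq> ?Y" "y \<in> ?Y"
      using flat_cl[OF AyE] rk_cl_insert[of A y] less.prems yE yA cl_least[of "insert y A" B] y subset_cl[OF AyE] by auto
    have "x \<notin> ?Y"
    proof
      assume "x \<in> ?Y"
      then have "?X = ?Y" using cl_insert_eq[of A ?Y x] less.prems Y by simp
      then show False using y Y by simp
    qed
    moreover have "rk B - rk ?Y < rk B - rk A" using Y(2) lt by simp
    ultimately obtain H where "flat H" "?Y \<subseteq> H" "H \<subseteq> B" "x \<notin> H" "Suc (rk H) = rk B"
      using less.hyps[of ?Y] Y(1,3) less.prems by blast
    then show ?thesis using Y by blast
  qed
qed

end

subsection \<open>Phases and necklaces\<close>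

text \<open>Sign vectors are encoded by their negative parts, so changing all signs on
  \<open>A\<close> is symmetric difference; in \<open>bit\<close> coordinates it is addition of
  \<open>ind A\<close> (\<open>ind_flip\<close>).\<close>

definition flip :: "'a set \<Rightarrow> 'a set \<Rightarrow> 'a set" where
  "flip A S = (S - A) \<union> (A - S)"

lemma mem_flip [simp]: "x \<in> flip A S \<longleftrightarrow> (x \<in> S) \<noteq> (x \<in> A)"
  by (auto simp: flip_def)

lemma flip_flip [simp]: "flip A (flip A S) = S"
  by auto

text \<open>\<open>flip A\<close> pairs the members that contain \<open>a\<close> with those that do
  not.\<close>

lemma even_card_flip:
  fixes X :: "'a::finite set set"
  assumes "a \<in> A" and "\<And>S. S \<in> X \<Longrightarrow> flip A S \<in> X"
  shows "even (card X)"
proof -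
  have "bij_betw (flip A) {S \<in> X. a \<in> S} {S \<in> X. a \<notin> S}"
    by (rule bij_betw_byWitness[where f' = "flip A"]) (use assms in auto)
  then have "card {S \<in> X. a \<in> S} = card {S \<in> X. a \<notin> S}" by (rule bij_betw_same_card)
  moreover have "card X = card {S \<in> X. a \<in> S} + card {S \<in> X. a \<notin> S}"
    by (subst card_Un_disjoint[symmetric]) (auto intro: arg_cong[where f = card])
  ultimately show ?thesis by simp
qed

locale loopfree_matroid = matroid E Ind for E :: "'e::finite set" and Ind +
  assumes loopfree: "loops E Ind = {}"
begin

lemma cl_empty: "cl {} = {}"
  using loopfree by (simp add: loops_def)

lemma flag_0: "flag F \<Longrightarrow> F 0 = {}"
  using flag_rk[of F 0] flat_eqI[of "{}" "F 0"] flag_sub[of F 0] rk_empty cl_empty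
  by (auto simp: flats_def)

lemma flag_block_index:
  assumes "flag F" "j \<in> E" obtains i where "i < r" "j \<in> F (Suc i) - F i"
proof -
  have top: "j \<in> F r" using flag_top[OF assms(1)] assms(2) by simp
  define n where "n = (LEAST n. j \<in> F n)"
  have n: "j \<in> F n" unfolding n_def using top by (rule LeastI)
  have le: "n \<le> r" unfolding n_def using top by (rule Least_le)
  have "n \<noteq> 0" using n flag_0[OF assms(1)] by (intro notI) simp
  then obtain i where i: "n = Suc i" by (cases n) auto
  have "j \<notin> F i" using not_less_Least[of i "\<lambda>n. j \<in> F n"] i unfolding n_def by simp
  then show ?thesis using that[of i] n le i by simp
qed

lemma flag_updI:
  assumes "flag F" "Suc i < r" "flat G" "rk G = Suc i" "F i \<subseteq> G" "G \<subseteq> F (Suc (Suc i))"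
  shows "flag (F(Suc i := G))"
  using assms unfolding flag_def by (auto simp: less_Suc_eq)

lemma flag_updD:
  assumes "flag (F(Suc i := G))" "Suc i < r"
  shows "flat G" "rk G = Suc i" "F i \<subseteq> G" "G \<subseteq> F (Suc (Suc i))"
  using flag_flat[OF assms(1), of "Suc i"] flag_rk[OF assms(1), of "Suc i"] assms(2)
    flag_mono[OF assms(1), of i "Suc i"] flag_mono[OF assms(1), of "Suc i" "Suc (Suc i)"] by auto

text \<open>The intersection is a flat strictly below \<open>G\<close>, hence of rank at most
  \<open>i\<close>, and it contains \<open>F i\<close>. So a flip along one atom of a rank-two
  interval leaves the signs in the other atoms alone.\<close>

lemma flag_upd_Int:
  assumes "flag (F(Suc i := G))" "flag (F(Suc i := G'))" "Suc i < r" "G \<noteq> G'"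
  shows "G \<inter> G' = F i"
proof -
  note G = flag_updD[OF assms(1,3)] and G' = flag_updD[OF assms(2,3)]
  have Fi: "flat (F i)" "rk (F i) = i"
    using flag_flat[OF assms(1), of i] flag_rk[OF assms(1), of i] assms(3) by auto
  have fl: "flat (G \<inter> G')" using G G' flat_Int by blast
  have "\<not> G \<subseteq> G'"
    using flat_eqI[OF G(1) _ flat_subset[OF G'(1)]] G(2) G'(2) assms(4) by auto
  then have "G \<inter> G' \<noteq> G" by blast
  then have "rk (G \<inter> G') < Suc i" using rk_flat_less[OF fl, of G] flat_subset[of G] G by auto
  then show ?thesis
    using flat_eqI[of "F i" "G \<inter> G'"] Fi G G' flat_subset[OF fl] by auto
qed

end

text \<open>
  \<open>PS F S\<close> says that the sign vector with negative part \<open>S\<close> belongs to the facet of the flag \<open>F\<close>.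
\<close>

locale phase = loopfree_matroid E Ind for E :: "'e::finite set" and Ind +
  fixes PS :: "(nat \<Rightarrow> 'e set) \<Rightarrow> 'e set \<Rightarrow> bool"
  assumes PS_ex: "flag F \<Longrightarrow> \<exists>S. PS F S"
    and PS_sub: "flag F \<Longrightarrow> PS F S \<Longrightarrow> S \<subseteq> E"
    and PS_flip: "flag F \<Longrightarrow> PS F S \<Longrightarrow> i < r \<Longrightarrow> PS F (flip (F (Suc i) - F i) S)"
    and PS_block: "flag F \<Longrightarrow> PS F S \<Longrightarrow> PS F S' \<Longrightarrow> i < r \<Longrightarrow>
      b \<in> F (Suc i) - F i \<Longrightarrow> c \<in> F (Suc i) - F i \<Longrightarrow> (b \<in> S \<longleftrightarrow> c \<in> S) \<longleftrightarrow> (b \<in> S' \<longleftrightarrow> c \<in> S')"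
    and PS_even: "flag F \<Longrightarrow> Suc i < r \<Longrightarrow>
      even (card {G. flag (F(Suc i := G)) \<and> PS (F(Suc i := G)) S})"
begin

text \<open>Handshake count. The sign vectors in \<open>W\<close> are vertices, and a vector
  together with an atom \<open>G\<close> whose facet contains it is an edge-end labelled
  \<open>G\<close>. Degrees are even by \<open>PS_even\<close>, and edges with labels outside
  \<Lambda> stay inside \<open>W\<close>, so they contribute an even number of ends.\<close>

lemma parity:
  assumes F: "flag F" "Suc i < r"
    and closed: "\<And>S G. S \<in> W \<Longrightarrow> flag (F(Suc i := G)) \<Longrightarrow> PS (F(Suc i := G)) S \<Longrightarrow> G \<notin> \<Lambda> \<Longrightarrow>
      flip (G - F i) S \<in> W"
  shows "even (\<Sum>G | flag (F(Suc i := G)) \<and> G \<in> \<Lambda>. card {S \<in> W. PS (F(Suc i := G)) S})"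
proof -
  let ?\<G> = "{G. flag (F(Suc i := G))}"
  let ?c = "\<lambda>G. card {S \<in> W. PS (F(Suc i := G)) S}"
  have "(\<Sum>G\<in>?\<G>. ?c G) = (\<Sum>G\<in>?\<G>. \<Sum>S\<in>W. of_bool (PS (F(Suc i := G)) S))"
    by (simp add: of_bool_def sum.If_cases Int_def)
  also have "\<dots> = (\<Sum>S\<in>W. \<Sum>G\<in>?\<G>. of_bool (PS (F(Suc i := G)) S))"
    by (rule sum.swap)
  also have "\<dots> = (\<Sum>S\<in>W. card {G. flag (F(Suc i := G)) \<and> PS (F(Suc i := G)) S})"
    by (simp add: of_bool_def sum.If_cases Int_def)
  also have "even \<dots>" by (intro dvd_sum PS_even F)
  finally have "even (\<Sum>G\<in>?\<G>. ?c G)" .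
  moreover have "(\<Sum>G\<in>?\<G>. ?c G) = (\<Sum>G | flag (F(Suc i := G)) \<and> G \<in> \<Lambda>. ?c G) +
      (\<Sum>G | flag (F(Suc i := G)) \<and> G \<notin> \<Lambda>. ?c G)"
    by (subst sum.union_disjoint[symmetric]) (auto intro!: sum.cong)
  moreover have "even (\<Sum>G | flag (F(Suc i := G)) \<and> G \<notin> \<Lambda>. ?c G)"
  proof (intro dvd_sum, clarify)
    fix G assume G: "flag (F(Suc i := G))" "G \<notin> \<Lambda>"
    have "F i \<subset> G" using flag_strict[OF G(1), of i "Suc i"] F(2) by auto
    then obtain g where g: "g \<in> G - F i" by auto
    show "even (?c G)"
    proof (rule even_card_flip[OF g])
      fix S assume "S \<in> {S \<in> W. PS (F(Suc i := G)) S}"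
      then show "flip (G - F i) S \<in> {S \<in> W. PS (F(Suc i := G)) S}"
        using closed[of S G] G PS_flip[OF G(1), of S i] F(2) by simp
    qed
  qed
  ultimately show ?thesis by simp
qed

text \<open>By \<open>PS_block\<close> one sign in a block determines the others there, and the two
  blocks of the interval are the only places that \<open>off\<close> leaves open.\<close>

lemma PS_eqI:
  assumes F: "flag F" "Suc i < r" and PS: "PS F S" "PS F S'"
    and off: "\<And>x. x \<in> F i \<or> x \<notin> F (Suc (Suc i)) \<Longrightarrow> x \<in> S \<longleftrightarrow> x \<in> S'"
    and g: "g \<in> F (Suc i) - F i" "g \<in> S \<longleftrightarrow> g \<in> S'"
    and h: "h \<in> F (Suc (Suc i)) - F (Suc i)" "h \<in> S \<longleftrightarrow> h \<in> S'"
  shows "S = S'"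
proof (rule set_eqI)
  fix x
  consider "x \<in> F i \<or> x \<notin> F (Suc (Suc i))" | "x \<in> F (Suc i) - F i" | "x \<in> F (Suc (Suc i)) - F (Suc i)"
    by blast
  then show "x \<in> S \<longleftrightarrow> x \<in> S'"
  proof cases
    case 2
    then show ?thesis using PS_block[OF F(1) PS, of i g x] F(2) g by auto
  next
    case 3
    then show ?thesis using PS_block[OF F(1) PS, of "Suc i" h x] F(2) h by auto
  qed (rule off)
qed

text \<open>\<open>V\<close> is any set closed under the lower-block flips of the interval, such as
  the vectors reached by walks. The vectors of \<open>W\<close> on the facet of \<open>F\<close> are
  even in number; besides \<open>S\<close>, only the flip of \<open>S\<close> on the upper block can
  be one of them.\<close>

lemma necklace_flip:
  assumes F: "flag F" "Suc i < r" and S: "PS F S" "S \<in> V"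
    and closed: "\<And>S G. S \<in> V \<Longrightarrow> flag (F(Suc i := G)) \<Longrightarrow> PS (F(Suc i := G)) S \<Longrightarrow> flip (G - F i) S \<in> V"
  shows "flip (F (Suc (Suc i)) - F (Suc i)) S \<in> V"
proof -
  let ?G = "F (Suc i)"
  \<comment> \<open>Flips along atoms other than \<open>?G\<close> keep the sign at \<open>g\<close>, so the edges labelled \<open>?G\<close> form a cut.\<close>
  obtain g where g: "g \<in> ?G - F i" using flag_strict[OF F(1), of i "Suc i"] F(2) by auto
  \<comment> \<open>Fixing also the signs outside the interval is what leaves at most two members of
    the facet in \<open>W\<close>, by \<open>PS_eqI\<close>.\<close>
  define W where "W = {S' \<in> V. (\<forall>x. x \<in> F i \<or> x \<notin> F (Suc (Suc i)) \<longrightarrow> (x \<in> S' \<longleftrightarrow> x \<in> S)) \<and> (g \<in> S' \<longleftrightarrow> g \<in> S)}"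
  have upd: "F(Suc i := ?G) = F" by simp
  have "even (\<Sum>G | flag (F(Suc i := G)) \<and> G \<in> {?G}. card {S \<in> W. PS (F(Suc i := G)) S})"
  proof (rule parity[OF F])
    fix S' G assume a: "S' \<in> W" "flag (F(Suc i := G))" "PS (F(Suc i := G)) S'" "G \<notin> {?G}"
    have "G \<inter> ?G = F i" using flag_upd_Int[OF a(2), of ?G] a(4) F upd by auto
    then show "flip (G - F i) S' \<in> W"
      using a closed[of S' G] g flag_updD[OF a(2) F(2)] unfolding W_def by auto
  qed
  moreover have "{G. flag (F(Suc i := G)) \<and> G \<in> {?G}} = {?G}" using F upd by auto
  ultimately have ev: "even (card {S \<in> W. PS F S})" by simp
  have "S \<in> {S \<in> W. PS F S}" using S by (simp add: W_def)
  then have "{S \<in> W. PS F S} \<noteq> {S}" "S \<in> {S \<in> W. PS F S}" using ev by auto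
  then obtain S' where S': "S' \<in> W" "PS F S'" "S' \<noteq> S" by blast
  let ?H = "F (Suc (Suc i)) - ?G"
  have "S' = flip ?H S"
  proof (rule ccontr)
    assume ne: "S' \<noteq> flip ?H S"
    obtain h where h: "h \<in> ?H" using flag_strict[OF F(1), of "Suc i" "Suc (Suc i)"] F(2) by auto
    have m: "F i \<subseteq> F (Suc i)" using flag_mono[OF F(1), of i "Suc i"] by simp
    have "PS F (flip ?H S)" using PS_flip[OF F(1) S(1) F(2)] .
    then have "S' = S \<or> S' = flip ?H S"
    proof (cases "h \<in> S' \<longleftrightarrow> h \<in> S")
      case True
      show ?thesis using PS_eqI[OF F S'(2) S(1) _ g _ h] True S'(1) by (auto simp: W_def)
    next
      case False
      assume P: "PS F (flip ?H S)"
      show ?thesis using PS_eqI[OF F S'(2) P _ g _ h] False S'(1) m h g by (auto simp: W_def)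
    qed
    then show False using ne S' by auto
  qed
  then show ?thesis using S' by (simp add: W_def)
qed

text \<open>If no vector of \<open>V\<close> were on the facet through \<open>G\<close>, the sign at
  \<open>b\<close> in \<open>G - F i\<close> would never change inside \<open>V\<close>. But
  \<open>necklace_flip\<close> changes it, since \<open>b\<close> lies in the upper block of
  \<open>F\<close>.\<close>

lemma necklace_reach:
  assumes F: "flag F" "Suc i < r" and S: "PS F S" "S \<in> V"
    and closed: "\<And>S G. S \<in> V \<Longrightarrow> flag (F(Suc i := G)) \<Longrightarrow> PS (F(Suc i := G)) S \<Longrightarrow> flip (G - F i) S \<in> V"
    and G: "flag (F(Suc i := G))"
  shows "\<exists>S'\<in>V. PS (F(Suc i := G)) S'"
proof (rule ccontr)
  assume no: "\<not> ?thesis"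
  have "F i \<subset> G" using flag_strict[OF G(1), of i "Suc i"] F(2) by auto
  then obtain b where b: "b \<in> G - F i" by auto
  have "G \<noteq> F (Suc i)" using no S by auto
  then have Int: "G \<inter> F (Suc i) = F i" using flag_upd_Int[OF G, of "F (Suc i)"] F by auto
  define V0 where "V0 = {S' \<in> V. b \<in> S' \<longleftrightarrow> b \<in> S}"
  have "flip (F (Suc (Suc i)) - F (Suc i)) S \<in> V0"
  proof (rule necklace_flip[OF F S(1)])
    show "S \<in> V0" using S by (simp add: V0_def)
    fix S' G' assume a: "S' \<in> V0" "flag (F(Suc i := G'))" "PS (F(Suc i := G')) S'"
    then have "G' \<noteq> G" using no by (auto simp: V0_def)
    then have "G' \<inter> G = F i" using flag_upd_Int[OF a(2) G F(2)] by auto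
    then show "flip (G' - F i) S' \<in> V0" using a closed[of S' G'] b by (auto simp: V0_def)
  qed
  then show False using b Int flag_updD[OF G F(2)] by (auto simp: V0_def)
qed

text \<open>Each atom fixes the relative sign of the two points in its upper block. Under the wrong
  parity, a vector fitting \<open>Ga\<close> fits both or neither of \<open>Gb\<close> and
  \<open>Gc\<close>, and a flip along \<open>Ga\<close> interchanges these cases. Starting from one
  that fits neither, with the signs at \<open>a\<close>, \<open>b\<close>, \<open>c\<close> held
  fixed, the count in \<open>parity\<close> has a single edge-end.\<close>

lemma triple:
  assumes F: "Suc i < r"
    and G: "flag (F(Suc i := Ga))" "flag (F(Suc i := Gb))" "flag (F(Suc i := Gc))"
    and abc: "a \<in> Ga - F i" "b \<in> Gb - F i" "c \<in> Gc - F i"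
    and ne: "Ga \<noteq> Gb" "Ga \<noteq> Gc" "Gb \<noteq> Gc"
    and P: "PS (F(Suc i := Ga)) Sa" "PS (F(Suc i := Gb)) Sb" "PS (F(Suc i := Gc)) Sc"
  shows "(b \<in> Sa \<longleftrightarrow> c \<in> Sa) \<noteq> ((a \<in> Sb \<longleftrightarrow> c \<in> Sb) = (a \<in> Sc \<longleftrightarrow> b \<in> Sc))"
proof
  assume q: "(b \<in> Sa \<longleftrightarrow> c \<in> Sa) = ((a \<in> Sb \<longleftrightarrow> c \<in> Sb) = (a \<in> Sc \<longleftrightarrow> b \<in> Sc))"
  have I: "Ga \<inter> Gb = F i" "Ga \<inter> Gc = F i" "Gb \<inter> Gc = F i"
    using flag_upd_Int[OF G(1,2) F ne(1)] flag_upd_Int[OF G(1,3) F ne(2)] flag_upd_Int[OF G(2,3) F ne(3)] .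
  let ?B = "F (Suc (Suc i))"
  note sub = flag_updD[OF G(1) F] flag_updD[OF G(2) F] flag_updD[OF G(3) F]
  have abcB: "a \<in> ?B" "b \<in> ?B" "c \<in> ?B" using abc sub by auto
  have notin: "a \<notin> Gb" "a \<notin> Gc" "b \<notin> Gc" "c \<notin> Gb" using abc I by auto
  \<comment> \<open>At \<open>S0\<close> the signs of \<open>a\<close>, \<open>b\<close>, \<open>c\<close> admit an edge labelled \<open>Ga\<close> but none labelled \<open>Gb\<close> or \<open>Gc\<close>.\<close>
  define S0 where "S0 = (if (a \<in> Sa \<longleftrightarrow> c \<in> Sa) = (a \<in> Sb \<longleftrightarrow> c \<in> Sb) then flip (Ga - F i) Sa else Sa)"
  have P0: "PS (F(Suc i := Ga)) S0"
    using P(1) PS_flip[OF G(1) P(1), of i] F by (auto simp: S0_def)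
  have cGa: "c \<notin> Ga" "b \<notin> Ga" using abc I by auto
  have S0: "(a \<in> S0 \<longleftrightarrow> c \<in> S0) \<noteq> (a \<in> Sb \<longleftrightarrow> c \<in> Sb)" "(a \<in> S0 \<longleftrightarrow> b \<in> S0) \<noteq> (a \<in> Sc \<longleftrightarrow> b \<in> Sc)"
    using q cGa abc unfolding S0_def by (simp_all split: if_split) argo+
  define W where "W = {S'. (\<forall>x. x \<in> F i \<or> x \<notin> ?B \<longrightarrow> (x \<in> S' \<longleftrightarrow> x \<in> S0)) \<and>
    (a \<in> S' \<longleftrightarrow> a \<in> S0) \<and> (b \<in> S' \<longleftrightarrow> b \<in> S0) \<and> (c \<in> S' \<longleftrightarrow> c \<in> S0)}"
  have ev: "even (\<Sum>G | flag ((F(Suc i := Ga))(Suc i := G)) \<and> G \<in> {Ga, Gb, Gc}. card {S \<in> W. PS ((F(Suc i := Ga))(Suc i := G)) S})"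
  proof (rule parity[OF G(1) F])
    fix S' G' assume a: "S' \<in> W" "flag ((F(Suc i := Ga))(Suc i := G'))" "PS ((F(Suc i := Ga))(Suc i := G')) S'" "G' \<notin> {Ga, Gb, Gc}"
    have G': "flag (F(Suc i := G'))" using a(2) by simp
    have I': "G' \<inter> Ga = F i" "G' \<inter> Gb = F i" "G' \<inter> Gc = F i"
      using flag_upd_Int[OF G' G(1) F] flag_upd_Int[OF G' G(2) F] flag_upd_Int[OF G' G(3) F] a(4) by auto
    then have "a \<notin> G'" "b \<notin> G'" "c \<notin> G'" using abc by auto
    then show "flip (G' - (F(Suc i := Ga)) i) S' \<in> W"
      using a(1) flag_updD[OF G' F] unfolding W_def by auto
  qed
  have set: "{G. flag ((F(Suc i := Ga))(Suc i := G)) \<and> G \<in> {Ga, Gb, Gc}} = {Ga, Gb, Gc}"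
    using G by auto
  have b0: "{S \<in> W. PS (F(Suc i := Gb)) S} = {}"
  proof -
    have "(a \<in> S' \<longleftrightarrow> c \<in> S') = (a \<in> Sb \<longleftrightarrow> c \<in> Sb)" if "PS (F(Suc i := Gb)) S'" for S'
      by (rule PS_block[OF G(2) that P(2), of "Suc i"]) (use F abcB notin in simp_all)
    then have "False" if "S' \<in> W" "PS (F(Suc i := Gb)) S'" for S'
      using that S0 unfolding W_def by blast
    then show ?thesis by blast
  qed
  have c0: "{S \<in> W. PS (F(Suc i := Gc)) S} = {}"
  proof -
    have "(a \<in> S' \<longleftrightarrow> b \<in> S') = (a \<in> Sc \<longleftrightarrow> b \<in> Sc)" if "PS (F(Suc i := Gc)) S'" for S'
      by (rule PS_block[OF G(3) that P(3), of "Suc i"]) (use F abcB notin in simp_all)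
    then have "False" if "S' \<in> W" "PS (F(Suc i := Gc)) S'" for S'
      using that S0 unfolding W_def by blast
    then show ?thesis by blast
  qed
  have a1: "{S \<in> W. PS (F(Suc i := Ga)) S} = {S0}"
  proof -
    have "S' = S0" if S': "S' \<in> W" "PS (F(Suc i := Ga)) S'" for S'
    proof -
      note w = S'(1)[unfolded W_def mem_Collect_eq]
      have ab: "a \<in> Ga - F i" "b \<in> ?B - Ga" using abc abcB cGa by blast+
      show ?thesis
      proof (rule PS_eqI[OF G(1) F S'(2) P0, of a b])
        fix x assume x: "x \<in> (F(Suc i := Ga)) i \<or> x \<notin> (F(Suc i := Ga)) (Suc (Suc i))"
        have "x \<in> F i \<or> x \<notin> ?B" using x by simp
        then show "x \<in> S' \<longleftrightarrow> x \<in> S0" using w[THEN conjunct1] by blast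
      next
        show "a \<in> S' \<longleftrightarrow> a \<in> S0" by (rule w[THEN conjunct2, THEN conjunct1])
        show "b \<in> S' \<longleftrightarrow> b \<in> S0" by (rule w[THEN conjunct2, THEN conjunct2, THEN conjunct1])
      qed (use ab in simp_all)
    qed
    moreover have "S0 \<in> W" by (simp add: W_def)
    ultimately show ?thesis using P0 by blast
  qed
  have e: "card {S \<in> W. PS (F(Suc i := Ga)) S} = 1" "card {S \<in> W. PS (F(Suc i := Gb)) S} = 0"
    "card {S \<in> W. PS (F(Suc i := Gc)) S} = 0"
    unfolding a1 b0 c0 by simp_all
  show False using ev ne unfolding set by (simp add: e)
qed

subsection \<open>Galleries of flags\<close>


text \<open>The flats at levels at most \<open>a\<close> and at least \<open>b\<close> stay fixed along a walk.\<close>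

inductive walk :: "nat \<Rightarrow> nat \<Rightarrow> (nat \<Rightarrow> 'e set) \<Rightarrow> 'e set \<Rightarrow> (nat \<Rightarrow> 'e set) \<Rightarrow> 'e set \<Rightarrow> bool"
  for a b F S where
  start: "walk a b F S F S"
| swap: "walk a b F S F' S' \<Longrightarrow> a < i \<Longrightarrow> i < b \<Longrightarrow> flag (F'(i := G)) \<Longrightarrow> PS (F'(i := G)) S' \<Longrightarrow>
    walk a b F S (F'(i := G)) S'"
| turn: "walk a b F S F' S' \<Longrightarrow> walk a b F S F' (flip (F' (Suc a) - F' a) S')"

lemma walk_trans: "walk a b F' S' F'' S'' \<Longrightarrow> walk a b F S F' S' \<Longrightarrow> walk a b F S F'' S''"
  by (induction rule: walk.induct) (blast intro: walk.swap walk.turn)+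

lemma walk_mono: "walk a b F S F' S' \<Longrightarrow> b \<le> b' \<Longrightarrow> walk a b' F S F' S'"
  by (induction rule: walk.induct) (blast intro: walk.start walk.swap walk.turn less_le_trans)+

lemma walk_inv:
  assumes "walk a b F S F' S'" "flag F" "PS F S" "a < b" "b \<le> r"
  shows "flag F' \<and> PS F' S' \<and> (\<forall>i. i \<le> a \<or> b \<le> i \<longrightarrow> F' i = F i) \<and>
    (\<forall>x. x \<in> F a \<or> x \<notin> F b \<longrightarrow> (x \<in> S' \<longleftrightarrow> x \<in> S))"
  using assms
proof (induction rule: walk.induct)
  case (turn F' S')
  have "F' (Suc a) \<subseteq> F' b" using turn by (intro flag_mono) auto
  then show ?case using turn PS_flip[of F' S' a] by auto
qed auto

lemma flag_upto:
  assumes F: "flag F" and A: "flat A" "\<And>i. i \<le> a \<Longrightarrow> F i \<subseteq> A" "\<And>i. b \<le> i \<Longrightarrow> A \<subseteq> F i" "b \<le> r"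
  obtains F' where "flag F'" "\<And>i. i \<le> a \<or> b \<le> i \<Longrightarrow> F' i = F i" "F' (rk A) = A"
proof -
  define J where "J = {i. i \<le> r \<and> (i \<le> a \<or> b \<le> i)}"
  have comp: "F i \<subseteq> F j \<or> F j \<subseteq> F i" for i j using flag_mono[OF F] by (meson nle_le)
  have AF: "F i \<subseteq> A \<or> A \<subseteq> F i" if "i \<in> J" for i
    using A(2,3) that unfolding J_def by blast
  have "\<forall>X\<in>insert A (F ` J). \<forall>Y\<in>insert A (F ` J). X \<subseteq> Y \<or> Y \<subseteq> X"
    unfolding ball_simps using comp AF by blast
  moreover have "\<forall>X\<in>insert A (F ` J). flat X" using A(1) flag_flat[OF F] by simp
  ultimately obtain F' where F': "flag F'" "\<And>X. X \<in> insert A (F ` J) \<Longrightarrow> F' (rk X) = X"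
    using flag_extend[of "insert A (F ` J)"] by metis
  have "F' i = F i" if i: "i \<le> a \<or> b \<le> i" for i
  proof (cases "i \<le> r")
    case True
    then have "F i \<in> insert A (F ` J)" using i by (simp add: J_def)
    then show ?thesis using F'(2)[of "F i"] flag_rk[OF F True] by simp
  next
    case False
    then show ?thesis using flag_top[OF F] flag_top[OF F'(1)] by simp
  qed
  then show ?thesis using that[OF F'(1)] F'(2)[of A] by simp
qed

text \<open>Both claims are carried in one induction on the upper end. The necklace at level
  \<open>b\<close> needs flips at level \<open>b - 1\<close>, which are the second claim of the
  hypothesis; it then yields the flip at level \<open>b\<close> and every exchange of the flat
  there. The rule \<open>turn\<close> flips the lowest block only, so all other block flips
  originate here.\<close>

lemma walk_connected:
  assumes "Suc a \<le> b" "b \<le> r" "flag F" "PS F S"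
  shows "(\<forall>F'. flag F' \<longrightarrow> (\<forall>i. i \<le> a \<or> b \<le> i \<longrightarrow> F' i = F i) \<longrightarrow> (\<exists>S'. walk a b F S F' S')) \<and>
    (\<forall>i. a \<le> i \<and> i < b \<longrightarrow> walk a b F S F (flip (F (Suc i) - F i) S))"
  using assms
proof (induction b arbitrary: F S rule: dec_induct)
  case base
  have "F' = F" if "\<forall>i. i \<le> a \<or> Suc a \<le> i \<longrightarrow> F' i = F i" for F'
    using that by (intro ext) (meson not_less_eq_eq)
  then show ?case using walk.start[of a "Suc a" F S] walk.turn[OF walk.start, of a "Suc a" F S]
    by (metis le_antisym not_less_eq_eq not_le)
next
  case (step b)
  obtain i where b: "b = Suc i" using step.hyps by (cases b) auto
  have ir: "Suc i < r" and br: "b \<le> r" using step.prems b by auto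
  \<comment> \<open>These are the sign vectors of walks that end at \<open>F\<close> with at most
    level \<open>b\<close> changed; the necklace lemmas are applied to this set.\<close>
  define V where "V F S = {S'. \<exists>G. flag (F(b := G)) \<and> walk a (Suc b) F S (F(b := G)) S'}" for F S
  have start: "S \<in> V F S" if "flag F" for F S
    unfolding V_def using that walk.start by (auto intro!: exI[of _ "F b"])
  have swap: "walk a (Suc b) F S (F(b := G)) S'"
    if "S' \<in> V F S" "flag (F(b := G))" "PS (F(b := G)) S'" for F S S' G
  proof -
    obtain G' where G': "walk a (Suc b) F S (F(b := G')) S'" using \<open>S' \<in> V F S\<close> unfolding V_def by blast
    have "walk a (Suc b) F S ((F(b := G'))(b := G)) S'"
      by (rule walk.swap[OF G']) (use step.hyps that in auto)
    then show ?thesis by simp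
  qed
  have closed: "flip (G - F i) S' \<in> V F S"
    if S': "S' \<in> V F S" and G: "flag (F(Suc i := G))" "PS (F(Suc i := G)) S'" for F S S' G
  proof -
    note G = G[folded b]
    have "walk a b (F(b := G)) S' (F(b := G)) (flip ((F(b := G)) (Suc i) - (F(b := G)) i) S')"
      using step.IH[OF br G, THEN conjunct2, rule_format, of i] step.hyps b by simp
    then have "walk a b (F(b := G)) S' (F(b := G)) (flip (G - F i) S')" using b by simp
    then have "walk a (Suc b) F S (F(b := G)) (flip (G - F i) S')"
      using walk_trans[OF walk_mono swap[OF S' G]] by simp
    then show ?thesis unfolding V_def using G(1) by blast
  qed
  have goto: "\<exists>S'. walk a (Suc b) F S (F(b := G)) S'"
    if F: "flag F" "PS F S" and G: "flag (F(b := G))" for F S G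
    using necklace_reach[OF F(1) ir F(2) start[OF F(1)] closed G[unfolded b], folded b] swap[OF _ G] by blast
  have flips: "walk a (Suc b) F S F (flip (F (Suc j) - F j) S)" if "a \<le> j" "j < Suc b" for j
  proof (cases "j = b")
    case False
    then show ?thesis using step.IH[OF br step.prems(2,3)] that walk_mono[of a b F S _ _ "Suc b"] by auto
  next
    case True
    note F = step.prems(2,3)
    let ?S = "flip (F (Suc b) - F b) S"
    have "?S \<in> V F S" using necklace_flip[OF F(1) ir F(2) start[OF F(1)] closed] b by simp
    moreover have "PS F ?S" using PS_flip[OF F, of b] ir b by auto
    ultimately show ?thesis using swap[of ?S F S "F b"] F(1) True by simp
  qed
  \<comment> \<open>\<open>F b\<close> is moved towards \<open>F' b\<close> by enlarging their
    intersection; once they agree, the remaining differences lie below level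
    \<open>b\<close>.\<close>
  have "\<exists>S'. walk a (Suc b) F S F' S'"
    if "flag F" "PS F S" "flag F'" "\<forall>j. j \<le> a \<or> Suc b \<le> j \<longrightarrow> F' j = F j" for F S F'
    using that
  proof (induction "b - rk (F b \<inter> F' b)" arbitrary: F S rule: less_induct)
    case less
    note F = less.prems(1,2) and F' = less.prems(3,4)
    let ?K = "F b \<inter> F' b"
    have Kflat: "flat ?K" using flat_Int flag_flat F F' by blast
    show ?case
    proof (cases "F b = F' b")
      case True
      then have "\<forall>j. j \<le> a \<or> b \<le> j \<longrightarrow> F' j = F j" using F' by (metis le_antisym not_less_eq_eq)
      then obtain S' where "walk a b F S F' S'" using step.IH[OF br F] F'(1) by blast
      then have "walk a (Suc b) F S F' S'" by (rule walk_mono) simp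
      then show ?thesis by blast
    next
      case False
      have rkb: "rk (F b) = b" "rk (F' b) = b" using flag_rk F F' br by auto
      have sub: "F b \<subseteq> E" "F' b \<subseteq> E" using flag_sub F F' by auto
      have "?K \<noteq> F b" using flat_eqI[of "F b" "F' b"] flag_flat[OF F(1)] rkb sub False by auto
      then have lt: "rk ?K < b" using rk_flat_less[OF Kflat, of "F b"] sub rkb by auto
      \<comment> \<open>Routing the flag through \<open>?K\<close> below level \<open>b\<close>
        makes \<open>F1 i\<close> contain \<open>?K\<close>.\<close>
      obtain F1 where F1: "flag F1" "\<And>j. j \<le> a \<or> b \<le> j \<Longrightarrow> F1 j = F j" "F1 (rk ?K) = ?K"
      proof (rule flag_upto[OF F(1) Kflat, of a b])
        show "F j \<subseteq> ?K" if "j \<le> a" for j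
          using flag_mono[OF F(1), of j b] flag_mono[OF F'(1), of j b] F'(2) that step.hyps by auto
        show "?K \<subseteq> F j" if "b \<le> j" for j using flag_mono[OF F(1) that] by auto
      qed (use br in auto)
      obtain S1 where S1: "walk a b F S F1 S1" using step.IH[OF br F] F1 by blast
      have P1: "PS F1 S1" using walk_inv[OF S1 F] step.hyps br by auto
      have KF1: "?K \<subseteq> F1 i" using flag_mono[OF F1(1), of "rk ?K" i] F1(3) lt b by auto
      obtain x where x: "x \<in> F' b" "x \<notin> F b"
        using flat_eqI[of "F' b" "F b"] flag_flat[OF F'(1)] rkb sub False by auto
      have xE: "x \<in> E" using x sub by auto
      have F1b: "F1 b = F b" "F1 (Suc b) = F (Suc b)" using F1(2) by auto
      have x1: "x \<notin> F1 i" using flag_mono[OF F1(1), of i b] F1b x b by auto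
      \<comment> \<open>This cover of \<open>F1 i\<close> contains \<open>?K\<close> and
        \<open>x\<close>, so exchanging \<open>F b\<close> for it enlarges the intersection with
        \<open>F' b\<close>.\<close>
      let ?H = "cl (insert x (F1 i))"
      have s: "insert x (F1 i) \<subseteq> E" using xE flag_sub[OF F1(1)] by auto
      have xSb: "x \<in> F1 (Suc b)" using x F'(2) flag_mono[OF F'(1), of b "Suc b"] F1b by auto
      have H: "flag (F1(b := ?H))"
        unfolding b
      proof (rule flag_updI[OF F1(1) ir])
        show "flat ?H" by (rule flat_cl[OF s])
        show "rk ?H = Suc i" using rk_cl_insert[OF flag_flat[OF F1(1)] xE x1] flag_rk[OF F1(1), of i] ir by auto
        show "F1 i \<subseteq> ?H" using subset_cl[OF s] by auto
        show "?H \<subseteq> F1 (Suc (Suc i))"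
          using cl_least[of "insert x (F1 i)" "F1 (Suc b)"] flag_flat[OF F1(1)] xSb flag_mono[OF F1(1), of i "Suc b"] b
          by auto
      qed
      obtain S2 where S2: "walk a (Suc b) F1 S1 (F1(b := ?H)) S2" using goto[OF F1(1) P1 H] by auto
      have P2: "PS (F1(b := ?H)) S2" using walk_inv[OF S2 F1(1) P1] step.hyps step.prems by auto
      have "?K \<subset> ?H \<inter> F' b" using KF1 subset_cl[OF s] x by auto
      then have "rk ?K < rk (?H \<inter> F' b)" using rk_flat_less[OF Kflat] sub by auto
      then have "b - rk (?H \<inter> F' b) < b - rk ?K" using lt by auto
      then have "\<exists>S'. walk a (Suc b) (F1(b := ?H)) S2 F' S'"
        using less.hyps[of "F1(b := ?H)" S2] H P2 F' F1 step.hyps by auto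
      then show ?thesis using walk_trans S2 walk_mono[OF S1, of "Suc b"] by (meson le_SucI order_refl)
    qed
  qed
  then show ?case using step.prems flips by auto
qed

lemma walk_to:
  assumes "a < b" "b \<le> r" "flag F" "PS F S" "flag F'" "\<forall>i. i \<le> a \<or> b \<le> i \<longrightarrow> F' i = F i"
  obtains S' where "walk a b F S F' S'"
  using walk_connected[OF Suc_leI[OF assms(1)] assms(2-4), THEN conjunct1, THEN spec, THEN mp, OF assms(5), THEN mp, OF assms(6)]
  by blast

end

subsection \<open>Circuits\<close>

context matroid
begin

definition circuit :: "'e set \<Rightarrow> bool" where
  "circuit D \<longleftrightarrow> D \<subseteq> E \<and> D \<notin> Ind \<and> (\<forall>d\<in>D. D - {d} \<in> Ind)"

lemma circuit_subset: "circuit D \<Longrightarrow> D \<subseteq> E"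
  by (simp add: circuit_def)

lemma circuit_indep: "circuit D \<Longrightarrow> I \<subset> D \<Longrightarrow> I \<in> Ind"
  unfolding circuit_def by (metis Diff_empty Diff_insert0 indep_down psubset_imp_ex_mem subset_Diff_insert DiffE psubsetE)

lemma mem_cl_indep: "I \<in> Ind \<Longrightarrow> x \<in> cl I \<longleftrightarrow> x \<in> E \<and> (x \<in> I \<or> insert x I \<notin> Ind)"
  by (rule mem_cl_iff) (simp_all add: rk_indep)

lemma rk_cl_indep: "I \<in> Ind \<Longrightarrow> rk (cl I) = card I"
  by (simp add: rk_cl rk_indep indep_subset)

lemma flat_cl_indep: "I \<in> Ind \<Longrightarrow> flat (cl I)"
  by (simp add: flat_cl indep_subset)

lemma circuit_cl_Diff: assumes "circuit D" "d \<in> D" shows "cl (D - {d}) = cl D"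
proof
  show "cl (D - {d}) \<subseteq> cl D" by (rule cl_mono) auto
  have I: "D - {d} \<in> Ind" using assms by (simp add: circuit_def)
  have "insert d (D - {d}) = D" using assms by auto
  then have "d \<in> cl (D - {d})" using mem_cl_indep[OF I] assms circuit_subset by (auto simp: circuit_def)
  then have "D \<subseteq> cl (D - {d})" using subset_cl[of "D - {d}"] assms circuit_subset by blast
  then show "cl D \<subseteq> cl (D - {d})" by (rule cl_least) (rule flat_cl_indep[OF I])
qed

lemma circuit_not_mem_cl:
  assumes "circuit D" "insert d I \<subset> D" "d \<notin> I" shows "d \<notin> cl I"
  using mem_cl_indep[of I d] circuit_indep[OF assms(1)] assms by auto

lemma exists_circuit:
  assumes "A \<in> Ind" "e \<in> cl A" "e \<notin> A"
  shows "\<exists>D. circuit D \<and> e \<in> D \<and> D \<subseteq> insert e A"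
proof -
  have eA: "insert e A \<notin> Ind" "e \<in> E" using assms mem_cl_indep[OF assms(1)] by auto
  let ?P = "{B. B \<subseteq> insert e A \<and> B \<notin> Ind}"
  have fin: "finite ?P" using finite_indep[OF assms(1)] by auto
  obtain D where D: "D \<in> ?P" "\<And>B. B \<in> ?P \<Longrightarrow> B \<subseteq> D \<Longrightarrow> B = D"
    using finite_has_minimal[OF fin] eA by (metis (no_types, lifting) empty_iff mem_Collect_eq order_refl)
  have "circuit D"
    unfolding circuit_def
  proof (intro conjI ballI)
    show "D \<subseteq> E" using D(1) eA indep_subset[OF assms(1)] by auto
    show "D \<notin> Ind" using D(1) by simp
    fix d assume "d \<in> D"
    then show "D - {d} \<in> Ind" using D(1) D(2)[of "D - {d}"] by auto
  qed
  moreover have "e \<in> D"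
  proof (rule ccontr)
    assume "e \<notin> D"
    then have "D \<subseteq> A" using D(1) by auto
    then show False using D(1) indep_down[OF assms(1)] by auto
  qed
  ultimately show ?thesis using D(1) by auto
qed

end

section \<open>Relative signs along walks and the signing of circuits\<close>

context phase
begin

text \<open>Signs on an independent set are free. \<open>I - {x}\<close> fits into a hyperplane
  \<open>H\<close> of the top flat that misses \<open>x\<close>, and its signs are arranged inside
  \<open>H\<close> by induction; the block above \<open>H\<close> contains \<open>x\<close> but
  nothing else of \<open>I\<close>, so flipping it corrects \<open>x\<close> alone.\<close>

lemma independent_patterns:
  assumes "flag F" "PS F S" "j \<le> r" "I \<in> Ind" "I \<subseteq> F j"
  shows "\<exists>F' S'. flag F' \<and> PS F' S' \<and> (\<forall>i\<ge>j. F' i = F i) \<and> (\<forall>x. x \<notin> F j \<longrightarrow> (x \<in> S' \<longleftrightarrow> x \<in> S)) \<and>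
    (\<forall>x\<in>I. x \<in> S' \<longleftrightarrow> x \<in> t)"
  using assms
proof (induction j arbitrary: F S I)
  case 0
  then have "I = {}" using flag_0 by auto
  then show ?case using 0 by (intro exI[of _ F] exI[of _ S]) auto
next
  case (Suc j)
  show ?case
  proof (cases "I = {}")
    case True
    then show ?thesis using Suc.prems by (intro exI[of _ F] exI[of _ S]) auto
  next
    case False
    then obtain x where x: "x \<in> I" by auto
    let ?I = "I - {x}" and ?B = "F (Suc j)"
    have Ii: "?I \<in> Ind" by (rule indep_down[OF Suc.prems(4)]) auto
    have B: "flat ?B" "rk ?B = Suc j" using flag_flat flag_rk Suc.prems by auto
    have xI: "x \<notin> cl ?I" using mem_cl_indep[OF Ii, of x] Suc.prems(4) x by (simp add: insert_absorb)
    have "cl ?I \<subseteq> ?B" by (rule cl_least) (use Suc.prems B in auto)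
    then obtain H where H: "flat H" "cl ?I \<subseteq> H" "H \<subseteq> ?B" "x \<notin> H" "Suc (rk H) = rk ?B"
      using exists_hyperplane_avoiding[OF flat_cl_indep[OF Ii] B(1) _ _ xI] x Suc.prems(5) by blast
    have IH: "?I \<subseteq> H" using subset_cl[OF indep_subset[OF Ii]] H by auto
    obtain F1 where F1: "flag F1" "\<And>i. i \<le> 0 \<or> Suc j \<le> i \<Longrightarrow> F1 i = F i" "F1 (rk H) = H"
    proof (rule flag_upto[OF Suc.prems(1) H(1), of 0 "Suc j"])
      show "F i \<subseteq> H" if "i \<le> 0" for i using that flag_0[OF Suc.prems(1)] by simp
      show "H \<subseteq> F i" if "Suc j \<le> i" for i using flag_mono[OF Suc.prems(1) that] H by auto
    qed (use Suc.prems in auto)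
    have F1j: "F1 j = H" "F1 (Suc j) = ?B" using F1 H B by auto
    obtain S1 where "walk 0 (Suc j) F S F1 S1"
      by (rule walk_to[of 0 "Suc j" F S F1]) (use Suc.prems F1 in auto)
    then have S1: "PS F1 S1" "\<forall>x. x \<notin> ?B \<longrightarrow> (x \<in> S1 \<longleftrightarrow> x \<in> S)"
      using walk_inv[of 0 "Suc j" F S F1 S1] Suc.prems by auto
    obtain F2 S2 where F2: "flag F2" "PS F2 S2" "\<forall>i\<ge>j. F2 i = F1 i" "\<forall>x. x \<notin> F1 j \<longrightarrow> (x \<in> S2 \<longleftrightarrow> x \<in> S1)"
      "\<forall>x\<in>?I. x \<in> S2 \<longleftrightarrow> x \<in> t"
      using Suc.IH[OF F1(1) S1(1) _ Ii] Suc.prems(3) IH F1j by auto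
    have up: "\<forall>i\<ge>Suc j. F2 i = F i" "F2 j = H" "F2 (Suc j) = ?B" using F1 F2 F1j by auto
    have off: "\<forall>x. x \<notin> ?B \<longrightarrow> (x \<in> S2 \<longleftrightarrow> x \<in> S)" using F2(4) S1(2) F1j H(3) by auto
    show ?thesis
    proof (cases "x \<in> S2 \<longleftrightarrow> x \<in> t")
      case True
      then show ?thesis using F2 up off by (intro exI[of _ F2] exI[of _ S2]) auto
    next
      case False
      have "PS F2 (flip (?B - H) S2)" using PS_flip[OF F2(1,2), of j] Suc.prems(3) up by auto
      then show ?thesis
        using F2 up off False IH x H Suc.prems(5)
        by (intro exI[of _ F2] exI[of _ "flip (?B - H) S2"]) auto
    qed
  qed
qed

text \<open>\<open>b\<close> and \<open>c\<close> span the same cover of \<open>F j\<close>, so the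
  lowest block, which a turn flips, contains both or neither.\<close>

lemma walk_parallel:
  assumes "walk j r F S F' S'" "flag F" "PS F S" "j < r"
    and bc: "b \<notin> F j" "c \<notin> F j" "b \<in> E" "c \<in> E" "cl (insert b (F j)) = cl (insert c (F j))"
  shows "(b \<in> S' \<longleftrightarrow> c \<in> S') \<longleftrightarrow> (b \<in> S \<longleftrightarrow> c \<in> S)"
  using assms(1)
proof (induction rule: walk.induct)
  case (turn F' S')
  have F': "flag F'" "F' j = F j" using walk_inv[OF turn.hyps assms(2,3,4)] by auto
  have *: "d \<in> F' (Suc j) \<longleftrightarrow> F' (Suc j) = cl (insert d (F j))" if "d \<notin> F j" "d \<in> E" for d
  proof
    assume "d \<in> F' (Suc j)"
    then show "F' (Suc j) = cl (insert d (F j))"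
      using cl_insert_eq[of "F j" "F' (Suc j)" d] flag_flat[OF F'(1)] flag_rk[OF F'(1)] assms(4)
        flag_mono[OF F'(1), of j "Suc j"] F' that by (metis Suc_leI less_imp_le_nat le_add2 plus_1_eq_Suc)
  next
    assume e: "F' (Suc j) = cl (insert d (F j))"
    show "d \<in> F' (Suc j)" unfolding e using subset_cl[of "insert d (F j)"] that flag_sub[OF assms(2)] by auto
  qed
  have "b \<in> F' (Suc j) \<longleftrightarrow> c \<in> F' (Suc j)" using * bc by simp
  then show ?case using turn.IH F' bc by auto
qed auto

text \<open>\<open>F2\<close> splices the lower part of \<open>F'\<close> to the upper part of
  \<open>F\<close>. The walk below level \<open>j\<close> leaves the signs at \<open>b\<close> and
  \<open>c\<close> alone, as both lie outside \<open>F j\<close>; the walk above it changes them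
  together. So the relative sign depends on the flat \<open>F j\<close> only.\<close>

lemma parallel_const:
  assumes F: "flag F" "PS F S" and F': "flag F'" "PS F' S'" and j: "F j = F' j" "j < r"
    and bc: "b \<notin> F j" "c \<notin> F j" "b \<in> E" "c \<in> E" "cl (insert b (F j)) = cl (insert c (F j))"
  shows "(b \<in> S' \<longleftrightarrow> c \<in> S') \<longleftrightarrow> (b \<in> S \<longleftrightarrow> c \<in> S)"
proof -
  define F2 where "F2 i = (if i \<le> j then F' i else F i)" for i
  have F2: "flag F2"
    unfolding flag_def
  proof (intro conjI allI impI)
    fix i
    show "flat (F2 i)" using flag_flat F F' by (simp add: F2_def)
    show "i \<le> r \<Longrightarrow> rk (F2 i) = i" using flag_rk F F' by (simp add: F2_def)
    show "r \<le> i \<Longrightarrow> F2 i = E" using flag_top F F' by (simp add: F2_def)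
    have "F' i \<subseteq> F (Suc i)" if "i = j" using j flag_mono[OF F(1), of i "Suc i"] that by simp
    then show "F2 i \<subseteq> F2 (Suc i)"
      using flag_mono[OF F(1), of i "Suc i"] flag_mono[OF F'(1), of i "Suc i"]
      by (cases "i = j") (auto simp: F2_def)
  qed
  have F2j: "F2 j = F j" using j by (simp add: F2_def)
  obtain S2 where S2: "PS F2 S2" "(b \<in> S2 \<longleftrightarrow> c \<in> S2) \<longleftrightarrow> (b \<in> S \<longleftrightarrow> c \<in> S)"
  \<comment> \<open>A walk needs a nonempty window; for \<open>j = 0\<close> the spliced flag is
    \<open>F\<close> itself.\<close>
  proof (cases "j = 0")
    case True
    then have "F2 i = F i" for i using flag_0[OF F(1)] flag_0[OF F'(1)] True by (simp add: F2_def)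
    then have "F2 = F" by auto
    then show ?thesis using that F by auto
  next
    case False
    then have 1: "Suc 0 \<le> j" "j \<le> r" using j by auto
    have e: "\<forall>i. i \<le> 0 \<or> j \<le> i \<longrightarrow> F2 i = F i" using flag_0[OF F(1)] flag_0[OF F'(1)] j by (auto simp: F2_def)
    obtain S2 where w: "walk 0 j F S F2 S2" by (rule walk_to[OF _ 1(2) F F2 e]) (use 1 in auto)
    show ?thesis using walk_inv[OF w F] 1 bc that[of S2] by auto
  qed
  have e: "\<forall>i. i \<le> j \<or> r \<le> i \<longrightarrow> F' i = F2 i" using flag_top[OF F(1)] flag_top[OF F'(1)] by (auto simp: F2_def)
  obtain S3 where w: "walk j r F2 S2 F' S3" by (rule walk_to[OF j(2) order_refl F2 S2(1) F'(1) e])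
  have S3: "PS F' S3" "(b \<in> S3 \<longleftrightarrow> c \<in> S3) \<longleftrightarrow> (b \<in> S2 \<longleftrightarrow> c \<in> S2)"
    using walk_inv[OF w F2 S2(1) j(2)] walk_parallel[OF w F2 S2(1) j(2)] bc F2j by auto
  \<comment> \<open>\<open>b\<close> and \<open>c\<close> enter \<open>F'\<close> at the same level,
    so \<open>PS_block\<close> can compare \<open>S3\<close> with the arbitrary
    \<open>S'\<close>.\<close>
  have mem: "b \<in> F' i \<longleftrightarrow> c \<in> F' i" for i
  proof (cases "j \<le> i")
    case True
    then have s: "F j \<subseteq> F' i" using flag_mono[OF F'(1) True] j by simp
    have "d \<in> F' i \<Longrightarrow> cl (insert d (F j)) \<subseteq> F' i" for d
      by (rule cl_least) (use s flag_flat[OF F'(1)] in auto)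
    moreover have "b \<in> cl (insert b (F j))" "c \<in> cl (insert c (F j))"
      using subset_cl[of "insert b (F j)"] subset_cl[of "insert c (F j)"] bc flag_sub[OF F(1)] by auto
    ultimately show ?thesis using bc(5) by blast
  next
    case False
    then show ?thesis using flag_mono[OF F'(1), of i j] j bc by auto
  qed
  obtain i where i: "i < r" "b \<in> F' (Suc i) - F' i" by (rule flag_block_index[OF F'(1) bc(3)])
  then have "c \<in> F' (Suc i) - F' i" using mem by auto
  then have "(b \<in> S3 \<longleftrightarrow> c \<in> S3) \<longleftrightarrow> (b \<in> S' \<longleftrightarrow> c \<in> S')" by (rule PS_block[OF F'(1) S3(1) F'(2) i])
  then show ?thesis using S2 S3 by argo
qed


text \<open>By the lemma \<open>agree_iff\<close> below, the choice of \<open>F\<close> and \<open>S\<close> does not matter.\<close>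

definition agree :: "'e set \<Rightarrow> 'e \<Rightarrow> 'e \<Rightarrow> bool" where
  "agree D b c \<longleftrightarrow> (\<exists>F S. flag F \<and> PS F S \<and> F (card D - 2) = cl (D - {b, c}) \<and> (b \<in> S \<longleftrightarrow> c \<in> S))"

text \<open>\<open>D - {b, c}\<close> is independent, so \<open>card D - 2\<close> is the rank of
  its closure and the level at which \<open>agree\<close> inspects the flag. Adding either
  \<open>b\<close> or \<open>c\<close> gives a basis of \<open>cl D\<close>, which makes the two
  parallel over that closure.\<close>

lemma circuit_pair:
  assumes D: "circuit D" "b \<in> D" "c \<in> D" "b \<noteq> c"
  shows "D - {b, c} \<in> Ind" "card (D - {b, c}) = card D - 2" "b \<notin> cl (D - {b, c})" "c \<notin> cl (D - {b, c})"
    "cl (insert b (cl (D - {b, c}))) = cl D" "cl (insert c (cl (D - {b, c}))) = cl D" "card D - 2 < r" "2 \<le> card D"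
proof -
  show I: "D - {b, c} \<in> Ind" by (rule circuit_indep[OF D(1)]) (use D in auto)
  show card: "card (D - {b, c}) = card D - 2" using D by (simp add: card_Diff_subset)
  show b: "b \<notin> cl (D - {b, c})" by (rule circuit_not_mem_cl[OF D(1)]) (use D in auto)
  show "c \<notin> cl (D - {b, c})" by (rule circuit_not_mem_cl[OF D(1)]) (use D in auto)
  have DE: "D \<subseteq> E" by (rule circuit_subset[OF D(1)])
  have "insert b (D - {b, c}) = D - {c}" "insert c (D - {b, c}) = D - {b}" using D by auto
  then show "cl (insert b (cl (D - {b, c}))) = cl D" "cl (insert c (cl (D - {b, c}))) = cl D"
    using cl_insert_cl[of "D - {b, c}" b] cl_insert_cl[of "D - {b, c}" c] circuit_cl_Diff[OF D(1)] D DE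
    by (simp_all add: subset_iff)
  have "card {b, c} \<le> card D" by (rule card_mono) (use D in auto)
  then show "2 \<le> card D" using D by simp
  have "rk (cl (D - {b, c})) < r"
    by (rule rk_flat_less[OF flat_cl_indep[OF I]]) (use b D DE cl_subset_ground in auto)
  then show "card D - 2 < r" using rk_cl_indep[OF I] card by simp
qed

lemma agree_iff:
  assumes D: "circuit D" "b \<in> D" "c \<in> D" "b \<noteq> c"
    and F: "flag F" "PS F S" "F (card D - 2) = cl (D - {b, c})"
  shows "agree D b c \<longleftrightarrow> (b \<in> S \<longleftrightarrow> c \<in> S)"
proof -
  note p = circuit_pair[OF D]
  have "(b \<in> S' \<longleftrightarrow> c \<in> S') \<longleftrightarrow> (b \<in> S \<longleftrightarrow> c \<in> S)"
    if F': "flag F'" "PS F' S'" "F' (card D - 2) = cl (D - {b, c})" for F' S'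
    by (rule parallel_const[OF F(1,2) F'(1,2)]) (use F F' p D circuit_subset[OF D(1)] in auto)
  then show ?thesis unfolding agree_def using F by blast
qed

lemma agree_commute: "agree D b c \<longleftrightarrow> agree D c b"
  by (auto simp: agree_def insert_commute)

lemma flag_through_pair:
  assumes "A \<subseteq> B" "flat A" "flat B"
  obtains F where "flag F" "F (rk A) = A" "F (rk B) = B"
proof -
  obtain F where F: "flag F" "\<And>X. X \<in> {A, B} \<Longrightarrow> F (rk X) = X"
    by (rule flag_extend[of "{A, B}"]) (use assms in auto)
  then show ?thesis using that[OF F(1)] by blast
qed

text \<open>This is \<open>triple\<close> in the interval from \<open>cl (D - {a, b, c})\<close> to
  \<open>cl D\<close>: its three atoms arise by removing two of the three elements, and
  \<open>agree\<close> records the relative sign of the removed pair.\<close>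

lemma agree_triple:
  assumes D: "circuit D" "a \<in> D" "b \<in> D" "c \<in> D" "a \<noteq> b" "a \<noteq> c" "b \<noteq> c"
  shows "agree D b c \<noteq> (agree D a c = agree D a b)"
proof -
  have DE: "D \<subseteq> E" by (rule circuit_subset[OF D(1)])
  let ?I = "D - {a, b, c}"
  have I: "?I \<in> Ind" by (rule circuit_indep[OF D(1)]) (use D in auto)
  have "card {a, b, c} \<le> card D" by (rule card_mono) (use D in auto)
  then have c3: "3 \<le> card D" using D by simp
  define i where "i = card D - 3"
  have i: "card D = i + 3" "card ?I = i" using c3 D by (simp_all add: i_def card_Diff_subset)
  have Da: "D - {a} \<in> Ind" using D by (simp add: circuit_def)
  have "rk (cl D) = card (D - {a})" using rk_cl_indep[OF Da] circuit_cl_Diff[OF D(1,2)] by simp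
  then have rB: "rk (cl D) = Suc (Suc i)" using i D by simp
  have fB: "flat (cl D)" by (rule flat_cl[OF DE])
  have ABsub: "cl ?I \<subseteq> cl D" by (rule cl_mono) auto
  have rA: "rk (cl ?I) = i" using rk_cl_indep[OF I] i by simp
  obtain F where F: "flag F" "F i = cl ?I" "F (Suc (Suc i)) = cl D"
    using flag_through_pair[OF ABsub flat_cl_indep[OF I] fB] rA rB by metis
  have "Suc (Suc i) \<le> r" using rk_mono[OF cl_subset_ground, of D] rB by simp
  then have ir: "Suc i < r" by simp
  have atom: "flag (F(Suc i := cl (D - {y, z})))" "x \<in> cl (D - {y, z}) - F i" "y \<notin> cl (D - {y, z})" "z \<notin> cl (D - {y, z})"
    if xyz: "{a, b, c} = {x, y, z}" "x \<noteq> y" "x \<noteq> z" "y \<noteq> z" "x \<in> D" "y \<in> D" "z \<in> D" for x y z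
  proof -
    note p = circuit_pair[OF D(1) xyz(6,7,4)]
    have Ieq: "?I = D - {x, y, z}" using xyz by simp
    show "flag (F(Suc i := cl (D - {y, z})))"
    proof (rule flag_updI[OF F(1) ir])
      show "flat (cl (D - {y, z}))" by (rule flat_cl_indep[OF p(1)])
      show "rk (cl (D - {y, z})) = Suc i" using rk_cl_indep[OF p(1)] p(2) i by simp
      show "F i \<subseteq> cl (D - {y, z})" unfolding F(2) Ieq by (rule cl_mono) auto
      show "cl (D - {y, z}) \<subseteq> F (Suc (Suc i))" unfolding F(3) by (rule cl_mono) auto
    qed
    have "x \<notin> cl ?I" unfolding Ieq by (rule circuit_not_mem_cl[OF D(1)]) (use xyz in auto)
    moreover have "x \<in> cl (D - {y, z})" using subset_cl[of "D - {y, z}"] DE xyz by auto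
    ultimately show "x \<in> cl (D - {y, z}) - F i" using F by simp
    show "y \<notin> cl (D - {y, z})" "z \<notin> cl (D - {y, z})" by (fact p(3), fact p(4))
  qed
  have "{a, b, c} = {b, a, c}" "{a, b, c} = {c, a, b}" by auto
  note A = atom[OF refl D(5,6,7,2,3,4)]
    and B = atom[OF this(1) D(5)[symmetric] D(7,6,3,2,4)]
    and C = atom[OF this(2) D(6)[symmetric] D(7)[symmetric] D(5,4,2,3)]
  obtain Sa Sb Sc where S: "PS (F(Suc i := cl (D - {b, c}))) Sa" "PS (F(Suc i := cl (D - {a, c}))) Sb"
    "PS (F(Suc i := cl (D - {a, b}))) Sc"
    using PS_ex[OF A(1)] PS_ex[OF B(1)] PS_ex[OF C(1)] by blast
  have ne: "cl (D - {b, c}) \<noteq> cl (D - {a, c})" "cl (D - {b, c}) \<noteq> cl (D - {a, b})" "cl (D - {a, c}) \<noteq> cl (D - {a, b})"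
    using A B C by blast+
  have k: "card D - 2 = Suc i" using i by simp
  have "agree D b c \<longleftrightarrow> (b \<in> Sa \<longleftrightarrow> c \<in> Sa)" by (rule agree_iff[OF D(1,3,4,7) A(1) S(1)]) (simp add: k)
  moreover have "agree D a c \<longleftrightarrow> (a \<in> Sb \<longleftrightarrow> c \<in> Sb)" by (rule agree_iff[OF D(1,2,4,6) B(1) S(2)]) (simp add: k)
  moreover have "agree D a b \<longleftrightarrow> (a \<in> Sc \<longleftrightarrow> b \<in> Sc)" by (rule agree_iff[OF D(1,2,3,5) C(1) S(3)]) (simp add: k)
  ultimately show ?thesis
    using triple[OF ir A(1) B(1) C(1) A(2) B(2) C(2) ne S] by simp
qed

text \<open>When \<open>b\<close> and \<open>c\<close> are the only elements of \<open>D\<close> in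
  the support of a vector, orthogonality forces opposite products with the circuit signs. Hence
  equal circuit signs go with disagreeing phase signs; the pattern on \<open>D\<close> is determined
  up to complement.\<close>

definition circuit_sign :: "'e set \<Rightarrow> 'e set \<Rightarrow> bool" where
  "circuit_sign D s \<longleftrightarrow> (\<forall>b\<in>D. \<forall>c\<in>D. b \<noteq> c \<longrightarrow> (b \<in> s \<longleftrightarrow> c \<in> s) = (\<not> agree D b c))"

text \<open>By \<open>agree_triple\<close>, disagreement means having the same colour in the
  two-colouring by \<open>agree D a\<close>, where the base point \<open>a\<close> shares the colour
  of the elements disagreeing with it.\<close>

lemma circuit_sign_exists:
  assumes D: "circuit D" shows "\<exists>s. circuit_sign D s"
proof -
  have "D \<noteq> {}" using D indep_empty by (auto simp: circuit_def)
  then obtain a where a: "a \<in> D" by auto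
  have "circuit_sign D {b. b \<noteq> a \<and> agree D a b}"
    unfolding circuit_sign_def
  proof (intro ballI impI)
    fix b c assume bc: "b \<in> D" "c \<in> D" "b \<noteq> c"
    show "(b \<in> {b. b \<noteq> a \<and> agree D a b} \<longleftrightarrow> c \<in> {b. b \<noteq> a \<and> agree D a b}) = (\<not> agree D b c)"
    proof (cases "a = b \<or> a = c")
      case True
      then show ?thesis using bc agree_commute[of D a] by auto
    next
      case False
      then show ?thesis using agree_triple[OF D a bc(1,2) _ _ bc(3)] by auto
    qed
  qed
  then show ?thesis by blast
qed

text \<open>Flags with \<open>cl I\<close> at level \<open>card I\<close> stand for the contraction
  of \<open>I\<close>. The generality in \<open>I\<close> is what the induction needs: it shrinks
  \<open>D - I\<close> down to two elements, where the definition of \<open>circuit_sign\<close>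
  decides.\<close>

lemma circuit_sign_avoided:
  assumes D: "circuit D" and s: "circuit_sign D s"
    and "I \<subseteq> D" "card I + 2 \<le> card D" "flag F" "PS F S" "F (card I) = cl I"
  shows "\<exists>d\<in>D - I. (d \<in> S) \<noteq> (d \<in> s)"
  using assms(3-)
proof (induction "card D - card I" arbitrary: I F S rule: less_induct)
  case less
  note I = less.prems(1,2) and F = less.prems(3,4) and FI = less.prems(5)
  have DE: "D \<subseteq> E" by (rule circuit_subset[OF D])
  show ?case
  proof (cases "card I + 2 = card D")
    case True
    have "card (D - I) = 2" using True I by (simp add: card_Diff_subset)
    then obtain b c where bc: "D - I = {b, c}" "b \<noteq> c" by (auto simp: card_2_iff)
    have I': "I = D - {b, c}" using bc I by auto
    have bcD: "b \<in> D" "c \<in> D" using bc by auto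
    have "card D - 2 = card I" using True by simp
    then have "F (card D - 2) = cl (D - {b, c})" using FI I' by simp
    then have "agree D b c \<longleftrightarrow> (b \<in> S \<longleftrightarrow> c \<in> S)" by (rule agree_iff[OF D bcD bc(2) F])
    moreover have "(b \<in> s \<longleftrightarrow> c \<in> s) = (\<not> agree D b c)" using s bcD bc(2) by (simp add: circuit_sign_def)
    ultimately show ?thesis unfolding bc by auto
  next
    case False
    then have c3: "card I + 3 \<le> card D" using I by linarith
    let ?j = "card I"
    show ?thesis
    proof (rule ccontr)
      assume "\<not> ?thesis"
      then have eq: "\<forall>d\<in>D - I. d \<in> S \<longleftrightarrow> d \<in> s" by blast
      \<comment> \<open>By induction the flat at level \<open>Suc ?j\<close> avoids \<open>D - I\<close>, so walks never leave the pattern \<open>s\<close>.\<close>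
      have "D - I \<noteq> {}" using c3 card_mono[of I D] by auto
      then obtain d0 where d0: "d0 \<in> D - I" by auto
      have sub: "insert d I \<subset> D" if "d \<in> D - I" for d
      proof -
        have "card (insert d I) < card D" using c3 that by simp
        then show ?thesis using that I by auto
      qed
      have dcl: "d \<notin> F ?j" if "d \<in> D - I" for d
        unfolding FI by (rule circuit_not_mem_cl[OF D sub[OF that]]) (use that in auto)
      have jr: "?j < r"
      proof -
        have "F ?j \<noteq> E" using dcl[OF d0] d0 DE by auto
        then show ?thesis using flag_top[OF F(1)] by (metis not_le)
      qed
      have IH: "\<exists>d'\<in>D - insert d I. (d' \<in> S') \<noteq> (d' \<in> s)"
        if "d \<in> D - I" "flag F'" "PS F' S'" "F' (Suc ?j) = cl (insert d I)" for d F' S'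
        by (rule less.hyps[of "insert d I" F' S']) (use that c3 I in auto)
      have inv: "\<forall>d\<in>D - I. d \<in> S' \<longleftrightarrow> d \<in> s" if "walk ?j r F S F' S'" for F' S'
        using that
      proof (induction rule: walk.induct)
        case (turn F' S')
        have F': "flag F'" "PS F' S'" "F' ?j = F ?j" using walk_inv[OF turn.hyps F jr] by auto
        have "d \<notin> F' (Suc ?j)" if d: "d \<in> D - I" for d
        proof
          assume m: "d \<in> F' (Suc ?j)"
          have "cl (insert d (F ?j)) = F' (Suc ?j)"
            by (rule cl_insert_eq) (use flag_flat[OF F(1)] flag_flat[OF F'(1)] flag_mono[OF F'(1), of ?j "Suc ?j"]
                F'(3) m dcl[OF d] flag_rk[OF F(1), of ?j] flag_rk[OF F'(1), of "Suc ?j"] jr in auto)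
          moreover have "cl (insert d (cl I)) = cl (insert d I)"
            by (rule cl_insert_cl) (use d DE I in auto)
          ultimately have "F' (Suc ?j) = cl (insert d I)" using FI by simp
          then show False using IH[OF d F'(1,2)] turn.IH by blast
        qed
        then show ?case using turn.IH by auto
      qed (use eq in auto)
      have d0I: "insert d0 I \<in> Ind" by (rule circuit_indep[OF D sub[OF d0]])
      have fl: "flat (cl (insert d0 I))" by (rule flat_cl_indep[OF d0I])
      have rkd: "rk (cl (insert d0 I)) = Suc ?j" using rk_cl_indep[OF d0I] d0 by simp
      have "cl I \<subseteq> cl (insert d0 I)" by (rule cl_mono) auto
      then have sub2: "F i \<subseteq> cl (insert d0 I)" if "i \<le> ?j" for i
        using flag_mono[OF F(1) that] FI by auto
      obtain F' where F': "flag F'" "\<And>i. i \<le> ?j \<or> r \<le> i \<Longrightarrow> F' i = F i" "F' (rk (cl (insert d0 I))) = cl (insert d0 I)"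
        by (rule flag_upto[OF F(1) fl sub2, of ?j r]) (use flag_top[OF F(1)] cl_subset_ground in auto)
      obtain S' where w: "walk ?j r F S F' S'" by (rule walk_to[OF jr order_refl F F'(1)]) (use F'(2) in auto)
      have "PS F' S'" using walk_inv[OF w F jr] by simp
      then show False using IH[OF d0 F'(1) _ ] inv[OF w] F'(3) rkd by auto
    qed
  qed
qed

end

subsection \<open>Covectors of a signed matroid\<close>

definition sg :: "'e set \<Rightarrow> 'e \<Rightarrow> int" where
  "sg s d = (if d \<in> s then -1 else 1)"

definition signvec :: "'e set \<Rightarrow> 'e set \<Rightarrow> int ^ 'e::finite" where
  "signvec G S = (\<chi> i. if i \<in> G then sg S i else 0)"

text \<open>Over \<open>D\<close>, the products of \<open>X\<close> with the circuit signs all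
  vanish or take both signs. Complementing \<open>s\<close> exchanges the two sides, so a pattern
  known up to complement suffices.\<close>

definition orth :: "int ^ 'e::finite \<Rightarrow> 'e set \<Rightarrow> 'e set \<Rightarrow> bool" where
  "orth X D s \<longleftrightarrow> ((\<exists>d\<in>D. X $ d * sg s d > 0) \<longleftrightarrow> (\<exists>d\<in>D. X $ d * sg s d < 0))"

lemma sg_cases: "sg s d = 1 \<or> sg s d = -1"
  by (simp add: sg_def)

lemma orth_uminus: "orth (- X) D s \<longleftrightarrow> orth X D s"
  by (auto simp: orth_def)

lemma orth_zero: "\<forall>d\<in>D. X $ d = 0 \<Longrightarrow> orth X D s"
  by (simp add: orth_def)

text \<open>The factor \<open>k\<close> selects one of the two opposite signings of the circuit, as
  delivered by \<open>painting\<close>.\<close>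

lemma orth_signs:
  assumes "orth X D s" "k = 1 \<or> k = -1" "d \<in> D" "X $ d * (k * sg s d) > 0"
  shows "\<exists>d\<in>D. X $ d * (k * sg s d) < 0"
  using assms by (auto simp: orth_def)

text \<open>If \<open>X\<close> vanishes on \<open>D\<close>, only \<open>Y\<close> counts there;
  otherwise \<open>X\<close> alone already supplies both signs.\<close>

lemma orth_compose:
  assumes "orth X D s" "orth Y D s" shows "orth (compose X Y) D s"
proof (cases "\<forall>d\<in>D. X $ d = 0")
  case True
  then have "compose X Y $ d = Y $ d" if "d \<in> D" for d using that by (simp add: compose_def)
  then show ?thesis using assms(2) by (simp add: orth_def)
next
  case False
  then obtain d where d: "d \<in> D" "X $ d \<noteq> 0" by auto
  then have "X $ d * sg s d \<noteq> 0" using sg_cases[of s d] by auto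
  then have "(\<exists>d\<in>D. X $ d * sg s d > 0) \<and> (\<exists>d\<in>D. X $ d * sg s d < 0)"
    using assms(1) d(1) unfolding orth_def by (meson linorder_neqE_linordered_idom)
  moreover have "X $ d \<noteq> 0 \<Longrightarrow> compose X Y $ d = X $ d" for d by (simp add: compose_def)
  ultimately show ?thesis unfolding orth_def by (metis less_irrefl mult_zero_left)
qed

text \<open>The link between the circuit signs and the matroid is that every flat is the zero set of
  an orthogonal vector. This starts the induction in \<open>painting\<close>.\<close>

locale signed_matroid = loopfree_matroid E Ind for E :: "'e::finite set" and Ind +
  fixes \<sigma> :: "'e set \<Rightarrow> 'e set"
  assumes realizable: "flat F \<Longrightarrow> \<exists>X\<in>sign_vectors E.
    (\<forall>D. circuit D \<longrightarrow> orth X D (\<sigma> D)) \<and> (\<forall>i\<in>E. X $ i = 0 \<longleftrightarrow> i \<in> F)"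
begin

definition covectors :: "(int ^ 'e) set" where
  "covectors = {X \<in> sign_vectors E. \<forall>D. circuit D \<longrightarrow> orth X D (\<sigma> D)}"

lemma covectors_entry: "X \<in> covectors \<Longrightarrow> X $ i = -1 \<or> X $ i = 0 \<or> X $ i = 1"
  by (auto simp: covectors_def sign_vectors_def)

lemma covectors_outside: "X \<in> covectors \<Longrightarrow> i \<notin> E \<Longrightarrow> X $ i = 0"
  by (auto simp: covectors_def sign_vectors_def coord_space_def)

lemma covectorsI:
  assumes "\<And>i. i \<notin> E \<Longrightarrow> X $ i = 0" "\<And>i. X $ i = -1 \<or> X $ i = 0 \<or> X $ i = 1"
    "\<And>D. circuit D \<Longrightarrow> orth X D (\<sigma> D)"
  shows "X \<in> covectors"
  using assms by (auto simp: covectors_def sign_vectors_def coord_space_def)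

lemma covectors_orth: "X \<in> covectors \<Longrightarrow> circuit D \<Longrightarrow> orth X D (\<sigma> D)"
  by (simp add: covectors_def)

lemma covectors_uminus: assumes "X \<in> covectors" shows "- X \<in> covectors"
proof (rule covectorsI)
  show "(- X) $ i = -1 \<or> (- X) $ i = 0 \<or> (- X) $ i = 1" for i
    using covectors_entry[OF assms, of i] by auto
qed (simp_all add: covectors_outside[OF assms] orth_uminus covectors_orth[OF assms])

lemma covectors_compose:
  assumes "X \<in> covectors" "Y \<in> covectors" shows "compose X Y \<in> covectors"
proof (rule covectorsI)
  show "compose X Y $ i = -1 \<or> compose X Y $ i = 0 \<or> compose X Y $ i = 1" for i
    using covectors_entry[OF assms(1), of i] covectors_entry[OF assms(2), of i] by (auto simp: compose_def)
  show "compose X Y $ i = 0" if "i \<notin> E" for i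
    using covectors_outside[OF assms(1) that] covectors_outside[OF assms(2) that] by (simp add: compose_def)
qed (intro orth_compose covectors_orth assms)

lemma covectors_zero: "0 \<in> covectors"
  by (auto simp: covectors_def sign_vectors_def coord_space_def orth_zero)

lemma circuit_in_closure:
  assumes "R \<subseteq> E" "e \<in> cl R" "e \<notin> R"
  shows "\<exists>D. circuit D \<and> e \<in> D \<and> D \<subseteq> insert e R"
proof -
  obtain J where J: "J \<in> Ind" "J \<subseteq> R" "card J = rk R" by (rule obtain_basis)
  have "e \<in> cl J" using assms(2) mem_cl_iff[OF J] mem_cl_indep[OF J(1)] by simp
  then show ?thesis using exists_circuit[OF J(1), of e] J assms(3) by blast
qed

text \<open>An element in the closure of the zero set but outside that set would lie on a circuit
  meeting the support in this element only, and a single nonzero product violates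
  orthogonality.\<close>

lemma flat_zeros: assumes X: "X \<in> covectors" shows "flat (E - supp X)"
proof -
  have "cl (E - supp X) \<subseteq> E - supp X"
  proof
    fix e assume e: "e \<in> cl (E - supp X)"
    show "e \<in> E - supp X"
    proof (rule ccontr)
      assume n: "e \<notin> E - supp X"
      obtain D where D: "circuit D" "e \<in> D" "D \<subseteq> insert e (E - supp X)"
        using circuit_in_closure[OF _ e n] by auto
      have "e \<in> E" using e cl_subset_ground by auto
      then have Xe: "X $ e \<noteq> 0" using n by (simp add: supp_def)
      have "X $ d = 0" if "d \<in> D" "d \<noteq> e" for d using D that by (auto simp: supp_def)
      then show False
        using covectors_orth[OF X D(1)] D(2) Xe sg_cases[of "\<sigma> D" e] unfolding orth_def
        by (metis linorder_neqE_linordered_idom mult_eq_0_iff not_less_iff_gr_or_eq zero_neq_neg_one zero_neq_one)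
    qed
  qed
  then show ?thesis using subset_cl[of "E - supp X"] by (auto simp: flats_def)
qed

lemma zeros_eq_flats: "{E - supp X | X. X \<in> covectors} = flats E Ind"
proof
  show "{E - supp X | X. X \<in> covectors} \<subseteq> flats E Ind" using flat_zeros by auto
  show "flats E Ind \<subseteq> {E - supp X | X. X \<in> covectors}"
  proof
    fix F assume F: "flat F"
    then obtain X where X: "X \<in> covectors" "\<forall>i\<in>E. X $ i = 0 \<longleftrightarrow> i \<in> F"
      using realizable[OF F] by (auto simp: covectors_def)
    then have "F = E - supp X" using flat_subset[OF F] by (auto simp: supp_def)
    then show "F \<in> {E - supp X | X. X \<in> covectors}" using X by auto
  qed
qed

text \<open>
  In the induction step \<open>f\<close> is moved first to \<open>R\<close> and then to the rest of the ground set; if both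
  the circuit and the covector obtained have the wrong sign at \<open>f\<close>, they violate orthogonality.
\<close>

lemma painting:
  assumes w: "\<And>x. w x = 1 \<or> w x = (-1::int)" and "finite B"
    and "e \<in> E" "R \<subseteq> E" "B \<subseteq> E" "e \<notin> B" "e \<notin> R" "B \<inter> R = {}"
  shows "(\<exists>D k. circuit D \<and> e \<in> D \<and> D \<subseteq> insert e B \<union> R \<and> (k = 1 \<or> k = -1) \<and>
      (\<forall>d\<in>D \<inter> insert e B. k * sg (\<sigma> D) d = w d)) \<or>
    (\<exists>Y\<in>covectors. Y $ e = w e \<and> (\<forall>x\<in>R. Y $ x = 0) \<and> (\<forall>x\<in>B. Y $ x = 0 \<or> Y $ x = w x))"
    (is "?C B R \<or> ?Y B R")
  using assms(2-)
proof (induction B arbitrary: R rule: finite_induct)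
  case empty
  show ?case
  proof (cases "e \<in> cl R")
    case True
    then obtain D where D: "circuit D" "e \<in> D" "D \<subseteq> insert e R"
      using circuit_in_closure[of R e] empty by auto
    \<comment> \<open>Of the two signings of the circuit, this one has the sign \<open>w e\<close>
      at \<open>e\<close>.\<close>
    let ?k = "w e * sg (\<sigma> D) e"
    have "?k = 1 \<or> ?k = -1" "?k * sg (\<sigma> D) e = w e" using w[of e] sg_cases[of "\<sigma> D" e] by auto
    then show ?thesis using D by (intro disjI1 exI[of _ D] exI[of _ ?k]) auto
  next
    case False
    have RE: "R \<subseteq> E" by fact
    obtain X where X: "X \<in> covectors" "\<forall>i\<in>E. X $ i = 0 \<longleftrightarrow> i \<in> cl R"
      using realizable[OF flat_cl[OF RE]] by (auto simp: covectors_def)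
    have Xe: "X $ e \<noteq> 0" using X False empty by auto
    have XR: "\<forall>x\<in>R. X $ x = 0" using X(2) subset_cl[OF RE] RE by auto
    define Y where "Y = (if X $ e = w e then X else - X)"
    have "Y \<in> covectors" using X(1) covectors_uminus by (simp add: Y_def)
    moreover have "Y $ e = w e" using Xe w[of e] covectors_entry[OF X(1), of e] by (auto simp: Y_def)
    ultimately show ?thesis using XR by (intro disjI2) (auto simp: Y_def)
  qed
next
  case (insert f B)
  have 1: "?C B (insert f R) \<or> ?Y B (insert f R)"
    by (rule insert.IH) (use insert in auto)
  have 2: "?C B R \<or> ?Y B R"
    by (rule insert.IH) (use insert in auto)
  have fR: "f \<notin> R" and fe: "f \<noteq> e" using insert by auto
  from 1 show ?case
  proof
    assume "?Y B (insert f R)"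
    then show ?case by (intro disjI2) auto
  next
    assume "?C B (insert f R)"
    then obtain D k where D: "circuit D" "e \<in> D" "D \<subseteq> insert e B \<union> insert f R" "k = 1 \<or> k = -1"
      "\<forall>d\<in>D \<inter> insert e B. k * sg (\<sigma> D) d = w d" by auto
    from 2 show ?case
    proof
      assume "?C B R"
      then obtain D' k' where D': "circuit D'" "e \<in> D'" "D' \<subseteq> insert e B \<union> R" "k' = 1 \<or> k' = -1"
        "\<forall>d\<in>D' \<inter> insert e B. k' * sg (\<sigma> D') d = w d" by auto
      have "f \<notin> D'" using D'(3) insert fR fe by auto
      then show ?case using D' by (intro disjI1 exI[of _ D'] exI[of _ k']) auto
    next
      assume "?Y B R"
      then obtain Y where Y: "Y \<in> covectors" "Y $ e = w e" "\<forall>x\<in>R. Y $ x = 0" "\<forall>x\<in>B. Y $ x = 0 \<or> Y $ x = w x"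
        by auto
      show ?case
      proof (cases "Y $ f = 0 \<or> Y $ f = w f")
        case True
        then show ?thesis using Y by (intro disjI2) auto
      next
        case Yf: False
        show ?thesis
        proof (cases "f \<in> D \<longrightarrow> k * sg (\<sigma> D) f = w f")
          case True
          then show ?thesis using D by (intro disjI1 exI[of _ D] exI[of _ k]) auto
        next
          case False
          \<comment> \<open>At \<open>f\<close> both the circuit and the covector are opposite to
            \<open>w f\<close>, so the product is positive there too; elsewhere both follow
            \<open>w\<close> or the covector vanishes.\<close>
          have nonneg: "Y $ d * (k * sg (\<sigma> D) d) \<ge> 0" if d: "d \<in> D" for d
          proof -
            consider "d = e" | "d = f" | "d \<in> B" | "d \<in> R" using D(3) d by auto
            then show ?thesis
            proof cases
              case 1
              then show ?thesis using D Y by simp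
            next
              case 2
              have "k * sg (\<sigma> D) f = - w f" using False D(4) w[of f] sg_cases[of "\<sigma> D" f] by auto
              moreover have "Y $ f = - w f" using Yf w[of f] covectors_entry[OF Y(1), of f] by auto
              ultimately show ?thesis using 2 by simp
            next
              case 3
              then have "k * sg (\<sigma> D) d = w d" using D(5) d by auto
              then show ?thesis using Y(4) 3 by auto
            qed (use Y in auto)
          qed
          have "k * sg (\<sigma> D) e = w e" using D(2,5) by auto
          then have "Y $ e * (k * sg (\<sigma> D) e) > 0" using Y(2) w[of e] by auto
          then have "\<exists>d\<in>D. Y $ d * (k * sg (\<sigma> D) d) < 0"
            using orth_signs[OF covectors_orth[OF Y(1) D(1)] D(4) D(2)] by auto
          then show ?thesis using nonneg by force
        qed
      qed
    qed
  qed
qed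

text \<open>\<open>painting\<close> prescribes the signs of the composition off the separation set
  and zeros at \<open>i\<close> and at its zero entries; the rest of the separation set is free. A
  circuit cannot be the outcome: off \<open>i\<close> its products with \<open>X\<close> and
  \<open>Y\<close> are nonnegative, and one of them is positive at \<open>j\<close>. Orthogonality
  makes that one negative at \<open>i\<close>, hence the other positive at \<open>i\<close>, which
  orthogonality forbids in turn.\<close>

lemma elimination_coordinate:
  assumes X: "X \<in> covectors" and Y: "Y \<in> covectors" and i: "i \<in> separation X Y"
    and j: "j \<notin> separation X Y" "compose X Y $ j \<noteq> 0"
  shows "\<exists>Z\<in>covectors. Z $ i = 0 \<and> Z $ j = compose X Y $ j \<and>
    (\<forall>k. k \<notin> separation X Y \<longrightarrow> Z $ k = 0 \<or> Z $ k = compose X Y $ k)"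
proof -
  let ?W = "compose X Y" and ?S = "separation X Y"
  have W: "?W \<in> covectors" by (rule covectors_compose[OF X Y])
  \<comment> \<open>The value 1 is a filler: \<open>painting\<close> expects a sign everywhere,
    while the zeros of \<open>?W\<close> in the ground set go to \<open>?R\<close>.\<close>
  define w where "w k = (if ?W $ k = 0 then 1 else ?W $ k)" for k
  have w: "w k = 1 \<or> w k = -1" for k using covectors_entry[OF W, of k] by (auto simp: w_def)
  let ?B = "{k \<in> E. k \<notin> ?S \<and> ?W $ k \<noteq> 0} - {j}" and ?R = "insert i {k \<in> E. k \<notin> ?S \<and> ?W $ k = 0}"
  have iE: "i \<in> E" using i covectors_outside[OF X] by (auto simp: separation_def)
  have jE: "j \<in> E" using j covectors_outside[OF W] by auto
  have ins: "insert j ?B = {k \<in> E. k \<notin> ?S \<and> ?W $ k \<noteq> 0}" using j jE by auto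
  have "(\<exists>D k. circuit D \<and> j \<in> D \<and> D \<subseteq> insert j ?B \<union> ?R \<and> (k = 1 \<or> k = -1) \<and>
      (\<forall>d\<in>D \<inter> insert j ?B. k * sg (\<sigma> D) d = w d)) \<or>
    (\<exists>Z\<in>covectors. Z $ j = w j \<and> (\<forall>x\<in>?R. Z $ x = 0) \<and> (\<forall>x\<in>?B. Z $ x = 0 \<or> Z $ x = w x))"
    (is "?C \<or> ?Z")
    by (rule painting[OF w]) (use iE jE i j in auto)
  then show ?thesis
  proof
    assume ?Z
    then obtain Z where Z: "Z \<in> covectors" "Z $ j = w j" "\<forall>x\<in>?R. Z $ x = 0" "\<forall>x\<in>?B. Z $ x = 0 \<or> Z $ x = w x"
      by auto
    have "Z $ k = 0 \<or> Z $ k = ?W $ k" if k: "k \<notin> ?S" for k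
    proof -
      consider "k \<notin> E" | "k = j" | "k \<in> ?B" | "k \<in> ?R" using k by blast
      then show ?thesis using Z j covectors_outside[OF Z(1)] by cases (auto simp: w_def)
    qed
    moreover have "Z $ j = ?W $ j" using Z j by (simp add: w_def)
    ultimately show ?thesis using Z by auto
  next
    assume ?C
    then obtain D k where D: "circuit D" "j \<in> D" "D \<subseteq> insert j ?B \<union> ?R" "k = 1 \<or> k = -1"
      "\<forall>d\<in>D \<inter> insert j ?B. k * sg (\<sigma> D) d = w d" by blast
    define p where "p U d = U $ d * (k * sg (\<sigma> D) d)" for U :: "int ^ 'e" and d
    have XW: "U $ d = 0 \<or> U $ d = ?W $ d" if "U = X \<or> U = Y" "d \<notin> ?S" for U d
      using that covectors_entry[OF X, of d] covectors_entry[OF Y, of d]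
      by (auto simp: compose_def separation_def)
    have nonneg: "p U d \<ge> 0" if Ud: "U = X \<or> U = Y" "d \<in> D" "d \<noteq> i" for U d
    proof -
      consider "d \<in> insert j ?B" | "d \<notin> ?S" "?W $ d = 0" using D(3) Ud by blast
      then show ?thesis
      proof cases
        case 1
        then have "p U d = U $ d * ?W $ d" using D(5) Ud ins by (auto simp: p_def w_def)
        moreover have "d \<notin> ?S" using 1 j(1) by blast
        then have "U $ d = 0 \<or> U $ d = ?W $ d" by (rule XW[OF Ud(1)])
        ultimately show ?thesis by auto
      next
        case 2
        then show ?thesis using XW[of U d] Ud by (auto simp: p_def)
      qed
    qed
    have neg: "p U i < 0 \<and> i \<in> D" if "U = X \<or> U = Y" "d \<in> D" "p U d > 0" for U d
    proof -
      have "U \<in> covectors" using X Y that by auto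
      then have "\<exists>d\<in>D. p U d < 0"
        using orth_signs[OF covectors_orth[of U D] D(4) that(2)] that(3) D(1) unfolding p_def by auto
      then show ?thesis using nonneg[OF that(1)] by (metis not_less)
    qed
    have opp: "p X i = - p Y i" using i by (simp add: p_def separation_def)
    have kj: "k * sg (\<sigma> D) j = ?W $ j" using D(2,5) ins j by (auto simp: w_def)
    have "p X j > 0 \<or> p Y j > 0"
      using kj j covectors_entry[OF W, of j] unfolding p_def kj by (auto simp: compose_def split: if_splits)
    then show ?thesis using neg[of X j] neg[of Y j] neg[of X i] neg[of Y i] D(2) opp by auto
  qed
qed

text \<open>Off the separation set every coordinate solution is zero or right, so composing them one
  by one never spoils a value that is already right.\<close>

lemma elimination:
  assumes X: "X \<in> covectors" and Y: "Y \<in> covectors" and i: "i \<in> separation X Y"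
  shows "\<exists>Z\<in>covectors. Z $ i = 0 \<and> (\<forall>j. j \<notin> separation X Y \<longrightarrow> Z $ j = compose X Y $ j)"
proof -
  let ?W = "compose X Y" and ?S = "separation X Y"
  have "\<exists>Z\<in>covectors. Z $ i = 0 \<and> (\<forall>k. k \<notin> ?S \<longrightarrow> Z $ k = 0 \<or> Z $ k = ?W $ k) \<and> (\<forall>j\<in>J. Z $ j = ?W $ j)"
    if "finite J" "J \<subseteq> {j. j \<notin> ?S \<and> ?W $ j \<noteq> 0}" for J
    using that
  proof (induction J rule: finite_induct)
    case empty
    show ?case by (rule bexI[of _ 0]) (simp_all add: covectors_zero)
  next
    case (insert j J)
    then obtain Z where Z: "Z \<in> covectors" "Z $ i = 0" "\<forall>k. k \<notin> ?S \<longrightarrow> Z $ k = 0 \<or> Z $ k = ?W $ k"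
      "\<forall>j\<in>J. Z $ j = ?W $ j" by auto
    obtain Z' where Z': "Z' \<in> covectors" "Z' $ i = 0" "Z' $ j = ?W $ j" "\<forall>k. k \<notin> ?S \<longrightarrow> Z' $ k = 0 \<or> Z' $ k = ?W $ k"
      using elimination_coordinate[OF X Y i, of j] insert.prems by auto
    have c: "compose Z Z' $ k = (if Z $ k \<noteq> 0 then Z $ k else Z' $ k)" for k by (simp add: compose_def)
    show ?case
    proof (rule bexI[of _ "compose Z Z'"], intro conjI)
      show "compose Z Z' \<in> covectors" using Z Z' covectors_compose by blast
      show "compose Z Z' $ i = 0" using Z Z' c by simp
      show "\<forall>k. k \<notin> ?S \<longrightarrow> compose Z Z' $ k = 0 \<or> compose Z Z' $ k = ?W $ k"
        using Z(3) Z'(4) unfolding c by auto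
      show "\<forall>j\<in>insert j J. compose Z Z' $ j = ?W $ j"
      proof
        fix m assume m: "m \<in> insert j J"
        then have "m \<notin> ?S" "?W $ m \<noteq> 0" using insert.prems by auto
        then show "compose Z Z' $ m = ?W $ m" using m Z(3,4) Z'(3) unfolding c by auto
      qed
    qed
  qed
  from this[of "{j. j \<notin> ?S \<and> ?W $ j \<noteq> 0}"] obtain Z where Z: "Z \<in> covectors" "Z $ i = 0"
    "\<forall>k. k \<notin> ?S \<longrightarrow> Z $ k = 0 \<or> Z $ k = ?W $ k" "\<forall>j\<in>{j. j \<notin> ?S \<and> ?W $ j \<noteq> 0}. Z $ j = ?W $ j" by auto
  have "Z $ k = ?W $ k" if "k \<notin> ?S" for k
    using Z(3,4) that by (cases "?W $ k = 0") auto
  then show ?thesis using Z by auto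
qed

lemma oriented_matroid_covectors: "oriented_matroid E covectors"
proof
  show "covectors \<subseteq> sign_vectors E" by (auto simp: covectors_def)
  show "X \<in> covectors \<longleftrightarrow> - X \<in> covectors" for X
    using covectors_uminus[of X] covectors_uminus[of "- X"] by auto
qed (fact covectors_zero covectors_compose elimination)+

end

section \<open>From a phase to an oriented matroid\<close>

context phase
begin

lemma circuit_card: assumes "circuit D" shows "2 \<le> card D"
proof (rule ccontr)
  assume "\<not> ?thesis"
  then consider "card D = 0" | "card D = 1" by linarith
  then show False
  proof cases
    case 1
    then show ?thesis using assms indep_empty by (simp add: circuit_def)
  next
    case 2
    then obtain d where d: "D = {d}" by (auto simp: card_1_singleton_iff)
    then have "d \<in> cl {}" using mem_cl_indep[OF indep_empty, of d] assms by (auto simp: circuit_def)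
    then show ?thesis using cl_empty by simp
  qed
qed

text \<open>If orthogonality fails, the entries outside \<open>F i\<close> show the pattern
  \<open>s\<close> or its complement. As \<open>D\<close> is not contained in \<open>F i\<close>,
  the part inside is independent, so its signs can be adjusted to the same pattern without
  disturbing those outside. The result contradicts \<open>circuit_sign_avoided\<close> for
  \<open>I = {}\<close>.\<close>

lemma phase_orth:
  assumes F: "flag F" "PS F S" "i \<le> r" and D: "circuit D" and s: "circuit_sign D s"
  shows "orth (zero_on (F i) (signvec E S)) D s"
proof (rule ccontr)
  let ?X = "zero_on (F i) (signvec E S)"
  assume no: "\<not> ?thesis"
  have DE: "D \<subseteq> E" by (rule circuit_subset[OF D])
  have X: "?X $ d * sg s d = (if d \<in> F i then 0 else sg S d * sg s d)" if "d \<in> D" for d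
    using that DE by (auto simp: zero_on_def signvec_def)
  have "\<not> D \<subseteq> F i"
  proof
    assume "D \<subseteq> F i"
    then have "\<forall>d\<in>D. ?X $ d = 0" by (auto simp: zero_on_def)
    then show False using no orth_zero by blast
  qed
  then have I: "D \<inter> F i \<in> Ind" by (intro circuit_indep[OF D]) auto
  have "\<exists>t. circuit_sign D t \<and> (\<forall>d\<in>D - F i. d \<in> S \<longleftrightarrow> d \<in> t)"
  proof (cases "\<exists>d\<in>D. ?X $ d * sg s d > 0")
    case True
    then have "\<not> (\<exists>d\<in>D. ?X $ d * sg s d < 0)" using no by (auto simp: orth_def)
    then have "\<forall>d\<in>D - F i. d \<in> S \<longleftrightarrow> d \<in> s" using X by (auto simp: sg_def split: if_splits)
    then show ?thesis using s by auto
  next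
    case False
    then have "\<forall>d\<in>D - F i. d \<in> S \<longleftrightarrow> d \<in> - s" using X by (auto simp: sg_def split: if_splits)
    moreover have "circuit_sign D (- s)" using s by (auto simp: circuit_sign_def)
    ultimately show ?thesis by blast
  qed
  then obtain t where t: "circuit_sign D t" "\<forall>d\<in>D - F i. d \<in> S \<longleftrightarrow> d \<in> t" by auto
  obtain F' S' where F': "flag F'" "PS F' S'" "\<forall>x. x \<notin> F i \<longrightarrow> (x \<in> S' \<longleftrightarrow> x \<in> S)"
    "\<forall>x\<in>D \<inter> F i. x \<in> S' \<longleftrightarrow> x \<in> t"
    using independent_patterns[OF F I, of t] by auto
  have "\<exists>d\<in>D - {}. (d \<in> S') \<noteq> (d \<in> t)"
    by (rule circuit_sign_avoided[OF D t(1) _ _ F'(1,2)]) (use circuit_card[OF D] flag_0[OF F'(1)] cl_empty in auto)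
  then obtain d where d: "d \<in> D" "(d \<in> S') \<noteq> (d \<in> t)" by auto
  then show False using t(2) F'(3,4) by (cases "d \<in> F i") blast+
qed

lemma phase_oriented:
  "\<exists>\<C>. oriented_matroid E \<C> \<and> {E - supp X | X. X \<in> \<C>} = flats E Ind \<and>
    (\<forall>F S i. flag F \<longrightarrow> PS F S \<longrightarrow> i \<le> r \<longrightarrow> zero_on (F i) (signvec E S) \<in> \<C>)"
proof -
  obtain \<sigma> where \<sigma>: "\<And>D. circuit D \<Longrightarrow> circuit_sign D (\<sigma> D)"
    using circuit_sign_exists by metis
  have sv: "zero_on A (signvec E S) \<in> sign_vectors E" for A S
    by (auto simp: zero_on_def signvec_def sign_vectors_def coord_space_def sg_def)
  interpret sm: signed_matroid E Ind \<sigma>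
  proof
    fix A assume A: "flat A"
    obtain F where F: "flag F" "F (rk A) = A"
      using flag_through_pair[OF order_refl A A] by metis
    obtain S where S: "PS F S" using PS_ex[OF F(1)] by auto
    have Ar: "rk A \<le> r" using A flat_subset by (intro rk_mono)
    show "\<exists>X\<in>sign_vectors E. (\<forall>D. circuit D \<longrightarrow> orth X D (\<sigma> D)) \<and> (\<forall>i\<in>E. X $ i = 0 \<longleftrightarrow> i \<in> A)"
    proof (rule bexI[OF _ sv[of A S]], intro conjI allI impI ballI)
      show "orth (zero_on A (signvec E S)) D (\<sigma> D)" if "circuit D" for D
        using phase_orth[OF F(1) S Ar that \<sigma>[OF that]] F(2) by simp
      show "zero_on A (signvec E S) $ i = 0 \<longleftrightarrow> i \<in> A" if "i \<in> E" for i
        using that by (simp add: zero_on_def signvec_def sg_def)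
    qed
  qed
  have "zero_on (F i) (signvec E S) \<in> sm.covectors" if "flag F" "PS F S" "i \<le> r" for F S i
    unfolding sm.covectors_def using sv phase_orth[OF that] \<sigma> by simp
  then show ?thesis
    by (intro exI[of _ sm.covectors] conjI sm.oriented_matroid_covectors sm.zeros_eq_flats allI impI)
qed

end

subsection \<open>The phase of an oriented matroid\<close>

lemma zero_on_nth: "zero_on F X $ i = (if i \<in> F then 0 else X $ i)"
  by (simp add: zero_on_def)

lemma compose_nth: "compose X Y $ i = (if X $ i \<noteq> 0 then X $ i else Y $ i)"
  by (simp add: compose_def)

lemma signvec_nth: "signvec G S $ i = (if i \<in> G then sg S i else 0)"
  by (simp add: signvec_def)

lemma signvec_nonzero: "i \<in> G \<Longrightarrow> signvec G S $ i \<noteq> 0"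
  by (simp add: signvec_nth sg_def)

locale matroid_orientation = loopfree_matroid E Ind + oriented_matroid E \<C>
  for E :: "'e::finite set" and Ind and \<C> :: "(int ^ 'e) set" +
  assumes zeros: "{E - supp X | X. X \<in> \<C>} = flats E Ind"
begin

abbreviation zs :: "int ^ 'e \<Rightarrow> 'e set" where "zs X \<equiv> E - supp X"

lemma mem_zs: "i \<in> zs X \<longleftrightarrow> i \<in> E \<and> X $ i = 0"
  by (simp add: supp_def)

lemma flat_zs: "X \<in> \<C> \<Longrightarrow> flat (zs X)"
  using zeros by blast

lemma ex_covector: assumes "flat F" obtains X where "X \<in> \<C>" "zs X = F"
  using assms zeros[symmetric] by auto

lemma entry: "X \<in> \<C> \<Longrightarrow> X $ i = -1 \<or> X $ i = 0 \<or> X $ i = 1"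
  using covectors_sign by (auto simp: sign_vectors_def)

lemma outside: "X \<in> \<C> \<Longrightarrow> i \<notin> E \<Longrightarrow> X $ i = 0"
  using covectors_sign by (auto simp: sign_vectors_def coord_space_def)

lemma neg: "X \<in> \<C> \<Longrightarrow> - X \<in> \<C>"
  using covector_neg by blast

lemma mem_separation:
  assumes "X \<in> \<C>" "Y \<in> \<C>"
  shows "i \<in> separation X Y \<longleftrightarrow> X $ i \<noteq> 0 \<and> Y $ i \<noteq> 0 \<and> X $ i \<noteq> Y $ i"
  using entry[OF assms(1), of i] entry[OF assms(2), of i] by (auto simp: separation_def)

text \<open>Eliminating a coordinate \<open>c\<close> of disagreement would give a covector
  vanishing on \<open>A\<close> and at \<open>c\<close>, hence on the cover \<open>B\<close>,
  although it keeps the common nonzero sign at \<open>b\<close>.\<close>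

lemma covering_sign:
  assumes X: "X \<in> \<C>" "zs X = A" and Y: "Y \<in> \<C>" "zs Y = A"
    and AB: "flat A" "flat B" "A \<subseteq> B" "rk B = Suc (rk A)"
    and off: "\<And>i. i \<notin> B \<Longrightarrow> X $ i = Y $ i"
    and b: "b \<in> B - A" "X $ b = Y $ b" and c: "c \<in> B - A"
  shows "X $ c = Y $ c"
proof (rule ccontr)
  assume ne: "X $ c \<noteq> Y $ c"
  have BE: "B \<subseteq> E" using AB flat_subset by auto
  have nz: "X $ i \<noteq> 0 \<longleftrightarrow> i \<notin> A" "Y $ i \<noteq> 0 \<longleftrightarrow> i \<notin> A" if "i \<in> E" for i
    using X(2) Y(2) mem_zs[of i X] mem_zs[of i Y] that by auto
  have "c \<in> separation X Y" using mem_separation[OF X(1) Y(1)] ne c nz BE by auto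
  then obtain Z where Z: "Z \<in> \<C>" "Z $ c = 0" "\<And>j. j \<notin> separation X Y \<Longrightarrow> Z $ j = compose X Y $ j"
    using covector_elim[OF X(1) Y(1)] by blast
  have sep: "separation X Y \<subseteq> B - A"
    using mem_separation[OF X(1) Y(1)] off nz outside[OF X(1)] by blast
  have "Z $ i = X $ i" if "i \<notin> B" for i
  proof -
    have "i \<notin> separation X Y" using sep that by blast
    then show ?thesis using Z(3)[of i] off[OF that] by (simp add: compose_nth)
  qed
  then have ZB: "zs Z \<subseteq> B" using nz AB(3) by (auto simp: mem_zs supp_def)
  have "Z $ i = 0" if "i \<in> A" for i
  proof -
    have "i \<notin> separation X Y" "i \<in> E" using sep that AB(3) BE by blast+
    then show ?thesis using Z(3)[of i] nz[of i] that by (simp add: compose_nth)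
  qed
  then have AZ: "A \<subseteq> zs Z" using AB(3) BE by (auto simp: mem_zs supp_def)
  have "b \<notin> separation X Y" using b mem_separation[OF X(1) Y(1)] by auto
  then have "Z $ b \<noteq> 0" using Z(3) b nz[of b] BE by (auto simp: compose_nth)
  then have bZ: "b \<notin> zs Z" by (simp add: supp_def)
  have cZ: "c \<in> zs Z" using Z(2) c BE by (auto simp: supp_def)
  have "cl (insert c A) = B" by (rule cl_insert_eq) (use AB c in auto)
  moreover have "cl (insert c A) \<subseteq> zs Z" by (rule cl_least[OF _ flat_zs[OF Z(1)]]) (use AZ cZ in auto)
  ultimately show False using b bZ by auto
qed

text \<open>Each elimination of a separating element leaves a covector that agrees with
  \<open>X\<close> off the old separation set and is separated from \<open>X\<close> in fewer
  places; once nothing separates, it is a face of \<open>X\<close>. The location of \<open>H\<close>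
  is recorded in order to keep selected entries of the face nonzero.\<close>

lemma conformal_face:
  assumes "X \<in> \<C>" "Y \<in> \<C>" "zs X \<subseteq> zs Y" "zs X \<noteq> zs Y \<or> separation X Y \<noteq> {}"
  shows "\<exists>H. zero_on H X \<in> \<C> \<and> flat H \<and> zs X \<subset> H \<and> (H \<subseteq> zs Y \<or> H \<subseteq> zs X \<union> separation X Y)"
  using assms
proof (induction "card (separation X Y)" arbitrary: Y rule: less_induct)
  case less
  note X = less.prems(1) and Y = less.prems(2)
  show ?case
  proof (cases "separation X Y = {}")
    case True
    have "zero_on (zs Y) X $ i = Y $ i" for i
    proof -
      have "i \<notin> separation X Y" using True by simp
      then show ?thesis
        using mem_separation[OF X Y, of i] less.prems(3) outside[OF X, of i] outside[OF Y, of i]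
        by (auto simp: zero_on_nth supp_def)
    qed
    then have "zero_on (zs Y) X = Y" by (simp add: vec_eq_iff)
    then show ?thesis using Y flat_zs[OF Y] less.prems True by (intro exI[of _ "zs Y"]) auto
  next
    case False
    then obtain l where l: "l \<in> separation X Y" by auto
    obtain Z where Z: "Z \<in> \<C>" "Z $ l = 0" "\<And>j. j \<notin> separation X Y \<Longrightarrow> Z $ j = compose X Y $ j"
      using covector_elim[OF X Y l] by blast
    have ZX: "Z $ j = X $ j" if "j \<notin> separation X Y" for j
    proof (cases "X $ j = 0")
      case True
      then have "Y $ j = 0" using less.prems(3) outside[OF Y, of j] by (cases "j \<in> E") (auto simp: supp_def)
      then show ?thesis using Z(3)[OF that] True by (simp add: compose_nth)
    qed (use Z(3)[OF that] in \<open>simp add: compose_nth\<close>)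
    have lX: "X $ l \<noteq> 0" "l \<in> E" using l mem_separation[OF X Y] outside[OF X] by auto
    have sepZ: "separation X Z \<subseteq> separation X Y - {l}"
    proof
      fix j assume j: "j \<in> separation X Z"
      then have "X $ j \<noteq> Z $ j" "Z $ j \<noteq> 0" using mem_separation[OF X Z(1)] by auto
      then show "j \<in> separation X Y - {l}" using ZX[of j] Z(2) by auto
    qed
    have zsZ: "zs Z \<subseteq> zs X \<union> separation X Y" using ZX by (auto simp: supp_def)
    have XZ: "zs X \<subseteq> zs Z"
    proof
      fix j assume j: "j \<in> zs X"
      then have "j \<notin> separation X Y" using mem_separation[OF X Y] by (auto simp: supp_def)
      then show "j \<in> zs Z" using ZX[of j] j by (auto simp: supp_def)
    qed
    have ne: "zs X \<noteq> zs Z" using lX Z(2) by (auto simp: supp_def)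
    have "card (separation X Z) < card (separation X Y)"
      by (rule psubset_card_mono) (use sepZ l in auto)
    from less.hyps[OF this X Z(1) XZ] ne
    obtain H where H: "zero_on H X \<in> \<C>" "flat H" "zs X \<subset> H" "H \<subseteq> zs Z \<or> H \<subseteq> zs X \<union> separation X Z" by auto
    then have "H \<subseteq> zs X \<union> separation X Y" using zsZ sepZ by blast
    then show ?thesis using H by auto
  qed
qed

text \<open>Level 0 says that the sign vector itself is a covector; the levels from the rank on give
  the zero vector.\<close>

definition PSC :: "(nat \<Rightarrow> 'e set) \<Rightarrow> 'e set \<Rightarrow> bool" where
  "PSC F S \<longleftrightarrow> S \<subseteq> E \<and> (\<forall>i. zero_on (F i) (signvec E S) \<in> \<C>)"

lemma zs_zero_on_signvec: "A \<subseteq> E \<Longrightarrow> zs (zero_on A (signvec E S)) = A"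
  using signvec_nonzero by (auto simp: supp_def zero_on_nth)

text \<open>Composing \<open>Y\<close> with a covector whose zero set is the next lower flat fills
  one block and keeps the faces already present. At level 0 the support is all of \<open>E\<close>,
  and the negative part can be read off.\<close>

lemma PSC_fill:
  assumes "flag F" "k \<le> r" "Y \<in> \<C>" "zs Y = F k" "\<forall>j\<ge>k. zero_on (F j) Y \<in> \<C>"
  shows "\<exists>S. PSC F S \<and> zero_on (F k) (signvec E S) = Y"
  using assms(2-)
proof (induction k arbitrary: Y)
  case 0
  define S where "S = {i. Y $ i = -1}"
  have "E - supp Y = {}" using 0 flag_0[OF assms(1)] by simp
  then have nz: "Y $ i \<noteq> 0" if "i \<in> E" for i using that by (auto simp: supp_def)
  have "signvec E S $ i = Y $ i" for i
    using entry[OF 0(2), of i] outside[OF 0(2), of i] nz[of i] by (auto simp: signvec_nth sg_def S_def)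
  then have "signvec E S = Y" by (simp add: vec_eq_iff)
  moreover have "S \<subseteq> E" using outside[OF 0(2)] by (force simp: S_def)
  moreover have "zero_on (F 0) Y = Y" using flag_0[OF assms(1)] by (simp add: vec_eq_iff zero_on_nth)
  ultimately show ?case using 0 by (intro exI[of _ S]) (simp add: PSC_def)
next
  case (Suc k)
  obtain X where X: "X \<in> \<C>" "zs X = F k" by (rule ex_covector[OF flag_flat[OF assms(1)]])
  define Y' where "Y' = compose Y X"
  have m: "F k \<subseteq> F (Suc k)" using flag_mono[OF assms(1)] by simp
  have FE: "F i \<subseteq> E" for i by (rule flag_sub[OF assms(1)])
  have Yz: "Y $ i = 0 \<longleftrightarrow> i \<in> F (Suc k)" if "i \<in> E" for i using Suc.prems(3) that by (auto simp: supp_def)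
  have Xz: "X $ i = 0 \<longleftrightarrow> i \<in> F k" if "i \<in> E" for i using X(2) that by (auto simp: supp_def)
  have Y': "Y' \<in> \<C>" using covector_compose[OF Suc.prems(2) X(1)] by (simp add: Y'_def)
  have zY': "zs Y' = F k" using Yz Xz m FE[of k] by (auto simp: supp_def Y'_def compose_nth)
  have restr: "zero_on (F j) Y' = zero_on (F j) Y" if "Suc k \<le> j" for j
  proof -
    have "F (Suc k) \<subseteq> F j" by (rule flag_mono[OF assms(1) that])
    then have "Y' $ i = Y $ i" if "i \<notin> F j" for i
      using Yz[of i] that outside[OF Y', of i] outside[OF Suc.prems(2), of i] by (cases "i \<in> E") (auto simp: Y'_def compose_nth)
    then show ?thesis by (simp add: vec_eq_iff zero_on_nth)
  qed
  have "zero_on (F k) Y' = Y'" using zY' by (auto simp: vec_eq_iff zero_on_nth supp_def)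
  then have "zero_on (F j) Y' \<in> \<C>" if "k \<le> j" for j
    using that Y' restr[of j] Suc.prems(4) by (cases "j = k") auto
  then obtain S where S: "PSC F S" "zero_on (F k) (signvec E S) = Y'"
    using Suc.IH[OF _ Y' zY'] Suc.prems(1) by auto
  have "zero_on (F (Suc k)) (signvec E S) = zero_on (F (Suc k)) Y'"
    unfolding S(2)[symmetric] using m by (auto simp: vec_eq_iff zero_on_nth)
  also have "\<dots> = zero_on (F (Suc k)) Y" by (rule restr) simp
  also have "\<dots> = Y" using Yz FE outside[OF Suc.prems(2)] by (auto simp: vec_eq_iff zero_on_nth)
  finally show ?case using S(1) by auto
qed

lemma zero_on_ground: "X \<in> \<C> \<Longrightarrow> zero_on E X = 0"
  using outside by (auto simp: vec_eq_iff zero_on_nth)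

lemma PSC_ex: assumes "flag F" shows "\<exists>S. PSC F S"
proof -
  have "zs 0 = F r" using flag_top[OF assms, of r] by (auto simp: supp_def)
  moreover have "zero_on A 0 = 0" for A :: "'e set" by (simp add: vec_eq_iff zero_on_nth)
  ultimately show ?thesis using PSC_fill[OF assms order_refl covector_zero] covector_zero by auto
qed

text \<open>Composing the face at \<open>F (Suc i)\<close>, then the negated face at
  \<open>F i\<close>, then the face at \<open>F j\<close> changes the signs of exactly one
  block.\<close>

lemma PSC_flip:
  assumes F: "flag F" and S: "PSC F S" shows "PSC F (flip (F (Suc i) - F i) S)"
  unfolding PSC_def
proof (intro conjI allI)
  let ?S = "flip (F (Suc i) - F i) S" and ?T = "signvec E S"
  show "?S \<subseteq> E" using S flag_sub[OF F, of "Suc i"] by (auto simp: PSC_def)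
  have C: "zero_on (F j) ?T \<in> \<C>" for j using S by (simp add: PSC_def)
  fix j
  show "zero_on (F j) (signvec E ?S) \<in> \<C>"
  proof (cases "Suc i \<le> j")
    case True
    have "F (Suc i) \<subseteq> F j" by (rule flag_mono[OF F True])
    then have "zero_on (F j) (signvec E ?S) = zero_on (F j) ?T"
      by (auto simp: vec_eq_iff zero_on_nth signvec_nth sg_def)
    then show ?thesis using C by simp
  next
    case False
    then have "F j \<subseteq> F i" "F i \<subseteq> F (Suc i)" using flag_mono[OF F] by auto
    then have "zero_on (F j) (signvec E ?S) =
      compose (zero_on (F (Suc i)) ?T) (compose (- zero_on (F i) ?T) (zero_on (F j) ?T))"
      by (auto simp: vec_eq_iff zero_on_nth signvec_nth compose_nth sg_def)
    then show ?thesis using C covector_compose neg by simp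
  qed
qed

text \<open>\<open>covering_sign\<close> compares the face of \<open>S\<close> at \<open>F i\<close>
  with the composite taking its signs outside \<open>F (Suc i)\<close> from \<open>S\<close> and
  inside from \<open>S'\<close>. If \<open>S\<close> and \<open>S'\<close> differ at
  \<open>b\<close>, the block of \<open>S'\<close> is flipped first.\<close>

lemma PSC_block:
  assumes F: "flag F" and S: "PSC F S" and S': "PSC F S'" and i: "i < r"
    and b: "b \<in> F (Suc i) - F i" and c: "c \<in> F (Suc i) - F i"
  shows "(b \<in> S \<longleftrightarrow> c \<in> S) \<longleftrightarrow> (b \<in> S' \<longleftrightarrow> c \<in> S')"
proof -
  have key: "(c \<in> S \<longleftrightarrow> c \<in> S')" if S: "PSC F S" "PSC F S'" "b \<in> S \<longleftrightarrow> b \<in> S'" for S S'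
  proof -
    let ?X = "zero_on (F i) (signvec E S)"
    let ?Y = "compose (zero_on (F (Suc i)) (signvec E S)) (zero_on (F i) (signvec E S'))"
    have m: "F i \<subseteq> F (Suc i)" "F i \<subseteq> E" "F (Suc i) \<subseteq> E" using flag_mono[OF F, of i "Suc i"] flag_sub[OF F] by auto
    have "?X $ c = ?Y $ c"
    proof (rule covering_sign[of ?X "F i" ?Y "F (Suc i)" b])
      show "?X \<in> \<C>" "?Y \<in> \<C>" using S covector_compose by (auto simp: PSC_def)
      show "zs ?X = F i" by (rule zs_zero_on_signvec[OF m(2)])
      show "zs ?Y = F i"
        using m by (auto simp: supp_def compose_nth zero_on_nth signvec_nth sg_def)
      show "?X $ j = ?Y $ j" if "j \<notin> F (Suc i)" for j
        using m that by (auto simp: compose_nth zero_on_nth signvec_nth sg_def)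
      show "?X $ b = ?Y $ b" using b S(3) by (auto simp: compose_nth zero_on_nth signvec_nth sg_def)
      show "rk (F (Suc i)) = Suc (rk (F i))" using flag_rk[OF F] i by simp
    qed (use flag_flat[OF F] m b c in auto)
    then show ?thesis using c m by (auto simp: compose_nth zero_on_nth signvec_nth sg_def split: if_splits)
  qed
  show ?thesis
  proof (cases "b \<in> S \<longleftrightarrow> b \<in> S'")
    case True
    then show ?thesis using key[OF S S'] by auto
  next
    case False
    have "PSC F (flip (F (Suc i) - F i) S')" by (rule PSC_flip[OF F S'])
    then have "c \<in> S \<longleftrightarrow> c \<in> flip (F (Suc i) - F i) S'" using key[OF S] False b by auto
    then show ?thesis using False c by auto
  qed
qed


lemma PSC_upd_iff:
  assumes "PSC (F(Suc i := G)) S"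
  shows "PSC (F(Suc i := H)) S \<longleftrightarrow> zero_on H (signvec E S) \<in> \<C>"
  using assms unfolding PSC_def by (metis fun_upd_apply)

text \<open>A covector of another atom \<open>G0\<close> is normalised at \<open>g\<close> in
  \<open>G - A\<close> and overwritten outside \<open>B\<close> by the signs of \<open>S\<close>; by
  \<open>covering_sign\<close> it then agrees with \<open>S\<close> on all of \<open>G - A\<close>.
  So the zero set supplied by \<open>conformal_face\<close> stays inside \<open>B\<close> and misses
  \<open>g\<close>, which makes it an atom other than \<open>G\<close>.\<close>

lemma second_atom:
  assumes i: "Suc i < r" and G: "flag (F(Suc i := G))" "PSC (F(Suc i := G)) S"
  shows "\<exists>H. H \<noteq> G \<and> flag (F(Suc i := H)) \<and> PSC (F(Suc i := H)) S"
proof -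
  let ?F = "F(Suc i := G)" and ?T = "signvec E S"
  define A where "A = F i"
  define B where "B = F (Suc (Suc i))"
  have FA: "?F i = A" and FB: "?F (Suc (Suc i)) = B" and FG: "?F (Suc i) = G" by (simp_all add: A_def B_def)
  note AGB = flag_updD[OF G(1) i, folded A_def B_def]
  have flats: "flat A" "flat B" "rk A = i" "rk B = Suc (Suc i)"
    using flag_flat[OF G(1), of i] flag_flat[OF G(1), of "Suc (Suc i)"] flag_rk[OF G(1), of i]
      flag_rk[OF G(1), of "Suc (Suc i)"] i unfolding FA FB by auto
  have C: "zero_on A ?T \<in> \<C>" "zero_on B ?T \<in> \<C>" "zero_on G ?T \<in> \<C>"
    using G(2) FA FB FG unfolding PSC_def by metis+
  have sub: "A \<subseteq> E" "B \<subseteq> E" "G \<subseteq> E" using flats AGB flat_subset by auto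
  have "G \<noteq> A" "B \<noteq> G" using AGB(2) flats by auto
  then obtain g x where g: "g \<in> G - A" and x: "x \<in> B - G" using AGB(3,4) by blast
  define G0 where "G0 = cl (insert x A)"
  have xs: "insert x A \<subseteq> E" using x sub by auto
  have xA: "x \<notin> A" using x AGB by auto
  have G0: "flat G0" "rk G0 = Suc i" "A \<subseteq> G0" "x \<in> G0" "G0 \<subseteq> B"
    using flat_cl[OF xs] rk_cl_insert[OF flats(1), of x] xs xA flats(3) subset_cl[OF xs]
      cl_least[of "insert x A" B] flats(2) x AGB by (auto simp: G0_def)
  have flG0: "flag (?F(Suc i := G0))"
    by (rule flag_updI[OF G(1) i G0(1,2)]) (use G0 FA FB in auto)
  have G0G: "G0 \<inter> G = A"
    using flag_upd_Int[of F i G0 G] flG0 G(1) i x G0(4) by (auto simp: A_def)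
  obtain Y0 where Y0: "Y0 \<in> \<C>" "zs Y0 = G0" by (rule ex_covector[OF G0(1)])
  have gE: "g \<in> E" and gG0: "g \<notin> G0" and gB: "g \<in> B" using g sub G0G AGB by auto
  then have Y0g: "Y0 $ g \<noteq> 0" using Y0(2) by (auto simp: supp_def)
  define Y1 where "Y1 = (if Y0 $ g = ?T $ g then Y0 else - Y0)"
  have Y1: "Y1 \<in> \<C>" using Y0 neg by (simp add: Y1_def)
  have Y1z: "Y1 $ j = 0 \<longleftrightarrow> j \<in> G0" if "j \<in> E" for j
    using Y0(2) that by (auto simp: Y1_def supp_def)
  have Y1g: "Y1 $ g = ?T $ g"
    using Y0g entry[OF Y0(1), of g] gE by (auto simp: Y1_def signvec_nth sg_def)
  define Y where "Y = compose (zero_on B ?T) Y1"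
  have Y: "Y \<in> \<C>" using C Y1 covector_compose by (simp add: Y_def)
  have zsY: "zs Y = G0"
    using Y1z signvec_nonzero G0(5) sub by (auto simp: supp_def Y_def compose_nth zero_on_nth)
  let ?X = "zero_on A ?T"
  have zsX: "zs ?X = A" by (rule zs_zero_on_signvec[OF sub(1)])
  have onG: "?X $ j = Y $ j" if j: "j \<in> G - A" for j
  proof -
    let ?Y = "compose (zero_on G ?T) Y"
    have "?X $ j = ?Y $ j"
    proof (rule covering_sign[OF C(1) zsX _ _ flats(1) AGB(1,3)])
      show "?Y \<in> \<C>" using C Y covector_compose by simp
      show "zs ?Y = A"
      proof -
        have "?Y $ k = 0 \<longleftrightarrow> k \<in> G \<and> k \<in> G0" if "k \<in> E" for k
          using that zsY signvec_nonzero[of k E S] by (auto simp: compose_nth zero_on_nth supp_def)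
        then show ?thesis using G0G sub by (auto simp: supp_def)
      qed
      show "rk G = Suc (rk A)" using AGB flats by simp
      show "?X $ k = ?Y $ k" if "k \<notin> G" for k
        using that AGB(3) Y outside[OF Y, of k] by (cases "k \<in> E") (auto simp: compose_nth zero_on_nth signvec_nth sg_def)
      show "g \<in> G - A" by (rule g)
      show "?X $ g = ?Y $ g" using g gB Y1g by (auto simp: compose_nth zero_on_nth Y_def)
    qed (rule j)
    then show ?thesis using j by (auto simp: compose_nth zero_on_nth)
  qed
  have "zs ?X \<subseteq> zs Y" "zs ?X \<noteq> zs Y" using zsX zsY G0 xA by auto
  then obtain H where H: "zero_on H ?X \<in> \<C>" "flat H" "A \<subset> H" "H \<subseteq> G0 \<or> H \<subseteq> A \<union> separation ?X Y"
    using conformal_face[OF C(1) Y] zsX zsY by auto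
  have sep: "separation ?X Y \<subseteq> B - G"
  proof
    fix j assume j: "j \<in> separation ?X Y"
    then have n: "?X $ j \<noteq> 0" "?X $ j \<noteq> Y $ j" using mem_separation[OF C(1) Y] by auto
    then have "j \<notin> A" by (auto simp: zero_on_nth)
    moreover have "j \<in> B"
    proof (rule ccontr)
      assume "j \<notin> B"
      then have "Y $ j = ?X $ j" using \<open>j \<notin> A\<close> n by (auto simp: Y_def compose_nth zero_on_nth)
      then show False using n by simp
    qed
    ultimately show "j \<in> B - G" using n onG by blast
  qed
  have "A \<subseteq> B" using AGB(3,4) by blast
  then have HB: "H \<subseteq> B" and Hg: "g \<notin> H" using H(4) G0(5) sep gG0 g by blast+
  have "rk H < rk B" by (rule rk_flat_less[OF H(2)]) (use HB Hg gB sub in auto)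
  moreover have "rk A < rk H" by (rule rk_flat_less[OF flats(1) H(3) flat_subset[OF H(2)]])
  ultimately have rH: "rk H = Suc i" using flats by simp
  have "flag (?F(Suc i := H))"
    by (rule flag_updI[OF G(1) i H(2) rH]) (use H(3) HB FA FB in auto)
  then have "flag (F(Suc i := H))" by simp
  moreover have "zero_on H ?X = zero_on H ?T" using H(3) by (auto simp: vec_eq_iff zero_on_nth)
  then have "PSC (F(Suc i := H)) S" using PSC_upd_iff[OF G(2)] H(1) by simp
  ultimately show ?thesis using Hg g by blast
qed

text \<open>Eliminate at \<open>l\<close> in \<open>G3 - A\<close> between the face at
  \<open>G1\<close> and the face at \<open>G2\<close> negated inside \<open>B\<close>. The result
  has zero set \<open>G3\<close>, agrees with \<open>S\<close> at \<open>g2\<close> and is opposite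
  at \<open>g1\<close>; \<open>covering_sign\<close> allows no such difference from the face at
  \<open>G3\<close>.\<close>

lemma at_most_two_atoms:
  assumes i: "Suc i < r"
    and G: "flag (F(Suc i := G1))" "flag (F(Suc i := G2))" "flag (F(Suc i := G3))"
    and P: "PSC (F(Suc i := G1)) S" "PSC (F(Suc i := G2)) S" "PSC (F(Suc i := G3)) S"
    and ne: "G1 \<noteq> G2" "G1 \<noteq> G3" "G2 \<noteq> G3"
  shows False
proof -
  let ?T = "signvec E S"
  define A where "A = F i"
  define B where "B = F (Suc (Suc i))"
  note G1 = flag_updD[OF G(1) i, folded A_def B_def] and G2 = flag_updD[OF G(2) i, folded A_def B_def]
    and G3 = flag_updD[OF G(3) i, folded A_def B_def]
  have Int: "G1 \<inter> G2 = A" "G1 \<inter> G3 = A" "G2 \<inter> G3 = A"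
    using flag_upd_Int[OF G(1,2) i ne(1)] flag_upd_Int[OF G(1,3) i ne(2)] flag_upd_Int[OF G(2,3) i ne(3)]
    by (simp_all add: A_def)
  have flats: "flat A" "flat B" "rk A = i" "rk B = Suc (Suc i)"
    using flag_flat[OF G(1), of i] flag_flat[OF G(1), of "Suc (Suc i)"] flag_rk[OF G(1), of i]
      flag_rk[OF G(1), of "Suc (Suc i)"] i by (auto simp: A_def B_def)
  have sub: "A \<subseteq> E" "B \<subseteq> E" using flats flat_subset by auto
  have CG: "zero_on G1 ?T \<in> \<C>" "zero_on G2 ?T \<in> \<C>" "zero_on G3 ?T \<in> \<C>"
    using P unfolding PSC_def by (metis fun_upd_same)+
  have "zero_on ((F(Suc i := G1)) (Suc (Suc i))) ?T \<in> \<C>" using P(1) unfolding PSC_def by blast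
  then have CB: "zero_on B ?T \<in> \<C>" by (simp add: B_def)
  have "G1 \<noteq> A" "G2 \<noteq> A" "G3 \<noteq> A" using G1(2) G2(2) G3(2) flats(3) by auto
  then obtain g1 g2 l where g1: "g1 \<in> G1 - A" and g2: "g2 \<in> G2 - A" and l: "l \<in> G3 - A"
    using G1(3) G2(3) G3(3) by blast
  let ?X = "zero_on G1 ?T" and ?Y = "compose (zero_on B ?T) (- zero_on G2 ?T)"
  have Y: "?Y \<in> \<C>" using CB CG neg covector_compose by simp
  have T: "?T $ j \<noteq> 0 \<longleftrightarrow> j \<in> E" for j by (simp add: signvec_nth sg_def)
  have T2: "?T $ j \<noteq> - ?T $ j" if "j \<in> E" for j using T[of j] that by simp
  have sepeq: "separation ?X ?Y = B - (G1 \<union> G2)"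
  proof (rule set_eqI)
    fix j
    have "?Y $ j = (if j \<in> B then (if j \<in> G2 then 0 else - ?T $ j) else ?T $ j)"
      by (simp add: compose_nth zero_on_nth)
    moreover have "?X $ j = (if j \<in> G1 then 0 else ?T $ j)" by (simp add: zero_on_nth)
    ultimately show "j \<in> separation ?X ?Y \<longleftrightarrow> j \<in> B - (G1 \<union> G2)"
      using mem_separation[OF CG(1) Y, of j] T[of j] T2[of j] sub by (cases "j \<in> E") auto
  qed
  have "l \<in> separation ?X ?Y" unfolding sepeq using l Int G3 by auto
  then obtain Z where Z: "Z \<in> \<C>" "Z $ l = 0" "\<And>j. j \<notin> separation ?X ?Y \<Longrightarrow> Z $ j = compose ?X ?Y $ j"
    using covector_elim[OF CG(1) Y] by blast
  have Zout: "Z $ j = ?T $ j" if "j \<notin> B" for j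
  proof -
    have "j \<notin> G1" using that G1(4) by blast
    then show ?thesis using Z(3)[of j] that unfolding sepeq by (simp add: compose_nth zero_on_nth)
  qed
  have ZA: "Z $ j = 0" if "j \<in> A" for j
  proof -
    have "j \<in> G1" "j \<in> G2" "j \<in> B" using that G1(3,4) G2(3) by blast+
    then show ?thesis using Z(3)[of j] unfolding sepeq by (simp add: compose_nth zero_on_nth)
  qed
  have "g1 \<notin> B - (G1 \<union> G2)" "g1 \<in> G1" "g1 \<notin> G2" "g1 \<in> B" using g1 Int G1(4) by auto
  then have Z1: "Z $ g1 = - ?T $ g1"
    using Z(3)[of g1] unfolding sepeq by (simp add: compose_nth zero_on_nth)
  have "g2 \<notin> B - (G1 \<union> G2)" "g2 \<in> G2" "g2 \<notin> G1" "g2 \<in> B" using g2 Int G2(4) by auto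
  then have Z2: "Z $ g2 = ?T $ g2"
    using Z(3)[of g2] unfolding sepeq by (simp add: compose_nth zero_on_nth)
  have gE: "g1 \<in> E" "g2 \<in> E" "l \<in> E" and gB: "g1 \<in> B" "g2 \<in> B"
    using g1 g2 l G1(4) G2(4) G3(4) sub by auto
  have flZ: "flat (zs Z)" by (rule flat_zs[OF Z(1)])
  have AZ: "insert l A \<subseteq> zs Z" using ZA Z(2) gE sub by (auto simp: supp_def)
  have "Z $ j \<noteq> 0" if "j \<in> E" "j \<notin> B" for j using Zout[OF that(2)] T[of j] that(1) by simp
  then have ZB: "zs Z \<subseteq> B" by (auto simp: supp_def)
  have "cl (insert l A) = G3" by (rule cl_insert_eq) (use flats G3 l in auto)
  then have G3Z: "G3 \<subseteq> zs Z" using cl_least[OF AZ flZ] by simp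
  have "g2 \<notin> zs Z" using Z2 T[of g2] gE by (simp add: supp_def)
  then have "rk (zs Z) < rk B" by (intro rk_flat_less[OF flZ]) (use ZB gB sub in auto)
  then have eq: "G3 = zs Z" using flat_eqI[OF G3(1) G3Z flat_subset[OF flZ]] flats G3(2) by simp
  have gnot: "g1 \<notin> G3" "g2 \<notin> G3" using g1 g2 Int(2,3) by blast+
  have "zero_on G3 ?T $ g1 = Z $ g1"
  proof (rule covering_sign[of _ G3 _ B g2])
    show "zero_on G3 ?T \<in> \<C>" "Z \<in> \<C>" by fact+
    show "zs (zero_on G3 ?T) = G3" by (rule zs_zero_on_signvec[OF flat_subset[OF G3(1)]])
    show "zs Z = G3" using eq by simp
    show "zero_on G3 ?T $ j = Z $ j" if "j \<notin> B" for j
    proof -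
      have "j \<notin> G3" using that G3(4) by blast
      then show ?thesis using Zout[OF that] by (simp add: zero_on_nth)
    qed
    show "zero_on G3 ?T $ g2 = Z $ g2" using Z2 gnot(2) by (simp add: zero_on_nth)
    show "rk B = Suc (rk G3)" using flats G3 by simp
    show "g2 \<in> B - G3" "g1 \<in> B - G3" using gB gnot by blast+
  qed (fact G3 flats)+
  then show False using Z1 gnot(1) T2[OF gE(1)] by (simp add: zero_on_nth)
qed

lemma PSC_even:
  assumes i: "Suc i < r"
  shows "even (card {G. flag (F(Suc i := G)) \<and> PSC (F(Suc i := G)) S})" (is "even (card ?X)")
proof (cases "?X = {}")
  case True
  then have "card ?X = 0" by (simp only: card.empty)
  then show ?thesis by (simp only: even_zero)
next
  case False
  then obtain G where G: "G \<in> ?X" by blast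
  then obtain H where H: "H \<noteq> G" "H \<in> ?X" using second_atom[OF i, of F G S] by blast
  have "K = G \<or> K = H" if "K \<in> ?X" for K
    using at_most_two_atoms[OF i, of F G H K S] G H that by blast
  then have "?X = {G, H}" using G H by blast
  moreover have "card {G, H} = 2" using H(1) by simp
  ultimately have "card ?X = 2" by (simp only:)
  then show ?thesis by (simp only: even_numeral)
qed

text \<open>With this instance the results on phases, \<open>PS_coset\<close> in particular, hold
  for orientations.\<close>

sublocale phase E Ind PSC
proof
  show "flag F \<Longrightarrow> PSC F S \<Longrightarrow> S \<subseteq> E" for F S by (simp add: PSC_def)
qed (rule PSC_ex PSC_flip PSC_block PSC_even; assumption)+

text \<open>A proper face whose zero set has least rank lies just one rank above \<open>X\<close>:
  otherwise a covector built from it, with zero set a flat \<open>G\<close> strictly between, leads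
  \<open>conformal_face\<close> to a face of smaller rank. Going from face to face gives the flag
  above \<open>X\<close>.\<close>

lemma covector_in_flag:
  assumes "X \<in> \<C>"
  shows "\<exists>F. flag F \<and> F (rk (zs X)) = zs X \<and> (\<forall>j\<ge>rk (zs X). zero_on (F j) X \<in> \<C>)"
  using assms
proof (induction "r - rk (zs X)" arbitrary: X rule: less_induct)
  case (less X)
  have fX: "flat (zs X)" by (rule flat_zs[OF less.prems])
  have zX: "zero_on (zs X) X = X" using outside[OF less.prems] by (auto simp: vec_eq_iff zero_on_nth supp_def)
  have m0: "zero_on E X \<in> \<C>" using zero_on_ground[OF less.prems] covector_zero by simp
  show ?case
  proof (cases "zs X = E")
    case True
    obtain F where F: "flag F" "F (rk (zs X)) = zs X" using flag_through_pair[OF order_refl fX fX] by metis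
    have "zero_on (F j) X \<in> \<C>" if "j \<ge> rk (zs X)" for j
      using flag_top[OF F(1)] that True m0 by simp
    then show ?thesis using F by blast
  next
    case False
    let ?P = "\<lambda>H. flat H \<and> zs X \<subset> H \<and> zero_on H X \<in> \<C>"
    have "?P E" using False m0 flat_ground by auto
    then obtain H where H: "?P H" and min: "\<And>H'. ?P H' \<Longrightarrow> rk H \<le> rk H'"
      using ex_has_least_nat[of ?P E rk] by blast
    have HE: "H \<subseteq> E" using H flat_subset by blast
    have lt: "rk (zs X) < rk H" using rk_flat_less[OF fX _ HE] H by blast
    have rH: "rk H = Suc (rk (zs X))"
    proof (rule ccontr)
      assume ne: "rk H \<noteq> Suc (rk (zs X))"
      obtain G where G: "flat G" "zs X \<subseteq> G" "G \<subseteq> H" "rk G = Suc (rk (zs X))"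
        using exists_flat_between[of "zs X" H "Suc (rk (zs X))"] fX H lt by auto
      obtain Y0 where Y0: "Y0 \<in> \<C>" "zs Y0 = G" by (rule ex_covector[OF G(1)])
      let ?Y = "compose (zero_on H X) Y0"
      have Y: "?Y \<in> \<C>" using H Y0 covector_compose by blast
      have Xz: "X $ j = 0 \<longleftrightarrow> j \<in> zs X" "Y0 $ j = 0 \<longleftrightarrow> j \<in> G" if "j \<in> E" for j
        using that Y0(2) by (auto simp: supp_def)
      have "?Y $ j = 0 \<longleftrightarrow> j \<in> G" if "j \<in> E" for j
        using Xz[OF that] G(3) by (auto simp: compose_nth zero_on_nth)
      then have zsY: "zs ?Y = G" using G(3) HE by (auto simp: supp_def)
      have sepH: "separation X ?Y \<subseteq> H - G"
      proof
        fix j assume "j \<in> separation X ?Y"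
        then have j: "X $ j \<noteq> 0" "?Y $ j \<noteq> 0" "X $ j \<noteq> ?Y $ j" using mem_separation[OF less.prems Y] by auto
        then have "j \<in> H" by (auto simp: compose_nth zero_on_nth split: if_splits)
        moreover have "j \<notin> G" using j(2) zsY by (auto simp: supp_def)
        ultimately show "j \<in> H - G" by simp
      qed
      have "zs X \<noteq> G" using G(4) by auto
      then obtain K where K: "zero_on K X \<in> \<C>" "flat K" "zs X \<subset> K" "K \<subseteq> G \<or> K \<subseteq> zs X \<union> separation X ?Y"
        using conformal_face[OF less.prems Y] zsY G(2) by auto
      \<comment> \<open>Either \<open>K\<close> lies in \<open>G\<close>, or it misses the elements
        of \<open>G\<close> outside the zero set of \<open>X\<close>; in both cases it is a proper
        subset of \<open>H\<close>.\<close>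
      have "\<exists>x. x \<in> G \<and> x \<notin> zs X" using \<open>zs X \<noteq> G\<close> G(2) by blast
      moreover have "G \<noteq> H" using G(4) ne by auto
      ultimately have "K \<subset> H" using K(4) sepH G(2,3) H by blast
      then have "rk K < rk H" by (rule rk_flat_less[OF K(2) _ HE])
      then show False using min[of K] K by auto
    qed
    have zsH: "zs (zero_on H X) = H" using H HE by (auto simp: supp_def zero_on_nth)
    have "r - rk (zs (zero_on H X)) < r - rk (zs X)"
      using lt rk_mono[OF HE] zsH by simp
    then obtain F where F: "flag F" "F (rk H) = H" "\<forall>j\<ge>rk H. zero_on (F j) (zero_on H X) \<in> \<C>"
      using less.hyps[of "zero_on H X"] H zsH by auto
    obtain F' where F': "flag F'" "\<And>j. j \<le> 0 \<or> rk H \<le> j \<Longrightarrow> F' j = F j" "F' (rk (zs X)) = zs X"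
    proof (rule flag_upto[OF F(1) fX, of 0 "rk H"])
      show "F j \<subseteq> zs X" if "j \<le> 0" for j using flag_0[OF F(1)] that by simp
      show "zs X \<subseteq> F j" if "rk H \<le> j" for j using flag_mono[OF F(1) that] F(2) H by auto
      show "rk H \<le> r" by (rule rk_mono[OF HE])
    qed auto
    have "zero_on (F' j) X \<in> \<C>" if "rk (zs X) \<le> j" for j
    proof (cases "j = rk (zs X)")
      case True
      then show ?thesis using F'(3) zX less.prems by simp
    next
      case False
      then have j: "rk H \<le> j" using that rH by simp
      have "H \<subseteq> F j" using flag_mono[OF F(1) j] F(2) by simp
      then have "zero_on (F j) (zero_on H X) = zero_on (F j) X" by (auto simp: vec_eq_iff zero_on_nth)
      then show ?thesis using F(3)[rule_format, OF j] j F'(2)[of j] by simp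
    qed
    then show ?thesis using F' by blast
  qed
qed

text \<open>Used for injectivity: \<open>PSC\<close> alone determines every covector.\<close>

lemma covectors_from_flags:
  "\<C> = {zero_on (F i) (signvec E S) | F i S. flag F \<and> i \<le> r \<and> PSC F S}"
proof
  show "\<C> \<subseteq> {zero_on (F i) (signvec E S) | F i S. flag F \<and> i \<le> r \<and> PSC F S}"
  proof
    fix X assume X: "X \<in> \<C>"
    obtain F where F: "flag F" "F (rk (zs X)) = zs X" "\<forall>j\<ge>rk (zs X). zero_on (F j) X \<in> \<C>"
      using covector_in_flag[OF X] by auto
    have le: "rk (zs X) \<le> r" by (rule rk_mono) auto
    obtain S where "PSC F S" "zero_on (F (rk (zs X))) (signvec E S) = X"
      using PSC_fill[OF F(1) le X F(2)[symmetric] F(3)] by auto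
    then show "X \<in> {zero_on (F i) (signvec E S) | F i S. flag F \<and> i \<le> r \<and> PSC F S}"
      using F(1) le unfolding mem_Collect_eq by (intro exI[of _ F] exI[of _ "rk (zs X)"] exI[of _ S]) simp
  qed
qed (auto simp: PSC_def)

end

subsection \<open>Cones of flags\<close>

definition ind :: "'e set \<Rightarrow> 'a::zero_neq_one ^ 'e::finite" where
  "ind A = (\<chi> i. if i \<in> A then 1 else 0)"

lemma ind_nth: "ind A $ i = (if i \<in> A then 1 else 0)"
  by (simp add: ind_def)

text \<open>The vectors constant on the blocks into which the chain cuts \<open>G\<close>. The
  definition is polymorphic because it describes the span of a cone over the reals and its tangent
  space over \<open>bit\<close>.\<close>

definition block_space :: "'e set \<Rightarrow> 'e set set \<Rightarrow> ('a::zero ^ 'e::finite) set" where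
  "block_space G \<F> = {x \<in> coord_space G. \<forall>i\<in>G. \<forall>j\<in>G. (\<forall>A\<in>\<F>. i \<in> A \<longleftrightarrow> j \<in> A) \<longrightarrow> x $ i = x $ j}"

lemma block_spaceD:
  assumes "x \<in> block_space G \<F>" "i \<in> G" "j \<in> G" "\<And>A. A \<in> \<F> \<Longrightarrow> i \<in> A \<longleftrightarrow> j \<in> A"
  shows "x $ i = x $ j"
proof -
  have "\<forall>i\<in>G. \<forall>j\<in>G. (\<forall>A\<in>\<F>. i \<in> A \<longleftrightarrow> j \<in> A) \<longrightarrow> x $ i = x $ j"
    using assms(1) unfolding block_space_def by (elim CollectE conjE)
  from this[rule_format, OF assms(2,3)] assms(4) show ?thesis .
qed

lemma block_space_outside: "x \<in> block_space G \<F> \<Longrightarrow> i \<notin> G \<Longrightarrow> x $ i = 0"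
  by (simp only: block_space_def coord_space_def mem_Collect_eq simp_thms)

lemma block_spaceI:
  assumes "\<And>i. i \<notin> G \<Longrightarrow> x $ i = 0"
    and "\<And>i j. i \<in> G \<Longrightarrow> j \<in> G \<Longrightarrow> (\<And>A. A \<in> \<F> \<Longrightarrow> i \<in> A \<longleftrightarrow> j \<in> A) \<Longrightarrow> x $ i = x $ j"
  shows "x \<in> block_space G \<F>"
proof -
  have h: "\<forall>i\<in>G. \<forall>j\<in>G. (\<forall>A\<in>\<F>. i \<in> A \<longleftrightarrow> j \<in> A) \<longrightarrow> x $ i = x $ j"
    by (intro ballI impI, rule assms(2), assumption, assumption, drule (1) bspec)
  show ?thesis
    unfolding block_space_def coord_space_def mem_Collect_eq
    by (rule conjI[OF _ h], intro allI impI, rule assms(1), assumption)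
qed

lemma subspace_block_space: "vec.subspace (block_space G \<F> :: ('a::field ^ 'e::finite) set)"
proof (rule vec.subspaceI)
  show "0 \<in> (block_space G \<F> :: ('a ^ 'e) set)" by (rule block_spaceI) simp_all
next
  fix x y :: "'a ^ 'e" assume x: "x \<in> block_space G \<F>" and y: "y \<in> block_space G \<F>"
  show "x + y \<in> block_space G \<F>"
  proof (rule block_spaceI)
    fix i j assume "i \<in> G" "j \<in> G" "\<And>A. A \<in> \<F> \<Longrightarrow> i \<in> A \<longleftrightarrow> j \<in> A"
    then have "x $ i = x $ j" "y $ i = y $ j" using block_spaceD[OF x] block_spaceD[OF y] by blast+
    then show "(x + y) $ i = (x + y) $ j" by simp
  qed (simp add: block_space_outside[OF x] block_space_outside[OF y])
next
  fix c and x :: "'a ^ 'e" assume x: "x \<in> block_space G \<F>"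
  show "c *s x \<in> block_space G \<F>"
  proof (rule block_spaceI)
    fix i j assume "i \<in> G" "j \<in> G" "\<And>A. A \<in> \<F> \<Longrightarrow> i \<in> A \<longleftrightarrow> j \<in> A"
    then have "x $ i = x $ j" using block_spaceD[OF x] by blast
    then show "(c *s x) $ i = (c *s x) $ j" by simp
  qed (simp add: block_space_outside[OF x])
qed

text \<open>Peel off the largest member \<open>H\<close>: \<open>x\<close> has one value
  \<open>c\<close> on \<open>G - H\<close>, and subtracting \<open>c *s ind G\<close> leaves a block
  vector of \<open>H\<close> for the remaining chain.\<close>

lemma span_ind_superset:
  fixes x :: "'a::field ^ 'e::finite"
  assumes "finite \<F>" "\<forall>A\<in>\<F>. \<forall>B\<in>\<F>. A \<subseteq> B \<or> B \<subseteq> A" "\<forall>A\<in>\<F>. A \<subseteq> G" "x \<in> block_space G \<F>"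
  shows "x \<in> vec.span (ind ` insert G \<F>)"
  using assms
proof (induction "card \<F>" arbitrary: \<F> G x)
  case 0
  then have F: "\<F> = {}" by simp
  have x: "x $ i = 0" if "i \<notin> G" for i using block_space_outside[OF 0(5)] that .
  have "\<exists>c. x = c *s ind G"
  proof (cases "G = {}")
    case True
    then show ?thesis using x by (intro exI[of _ 0]) (simp add: vec_eq_iff)
  next
    case False
    then obtain g where "g \<in> G" by auto
    then have "x $ i = x $ g" if "i \<in> G" for i using block_spaceD[OF 0(5)] F that by blast
    then obtain c where "x $ i = c" if "i \<in> G" for i by blast
    then show ?thesis using x by (intro exI[of _ c]) (simp add: vec_eq_iff ind_nth)
  qed
  then show ?case using F by (auto intro: vec.span_scale vec.span_base)
next
  case (Suc n)
  have ne: "\<F> \<noteq> {}" using Suc.hyps(2) by auto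
  define H where "H = \<Union>\<F>"
  have HF: "H \<in> \<F>"
    unfolding H_def by (rule Union_in_chain[OF Suc.prems(1) ne]) (use Suc.prems(2) in \<open>auto simp: subset_chain_def\<close>)
  have HG: "H \<subseteq> G" using HF Suc.prems(3) by auto
  obtain c where c: "\<And>i. i \<in> G - H \<Longrightarrow> x $ i = c"
  proof (cases "G - H = {}")
    case False
    then obtain g where g: "g \<in> G - H" by auto
    show ?thesis
    proof (rule that[of "x $ g"])
      fix i assume i: "i \<in> G - H"
      show "x $ i = x $ g" by (rule block_spaceD[OF Suc.prems(4)]) (use i g in \<open>auto simp: H_def\<close>)
    qed
  qed auto
  define y where "y = x - c *s ind G"
  have y: "y $ i = x $ i - (if i \<in> G then c else 0)" for i by (simp add: y_def ind_nth)
  have x0: "x $ i = 0" if "i \<notin> G" for i using block_space_outside[OF Suc.prems(4)] that .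
  have "y \<in> block_space H (\<F> - {H})"
  proof (rule block_spaceI)
    show "y $ i = 0" if "i \<notin> H" for i using c[of i] x0[of i] that by (auto simp: y)
    fix i j assume ij: "i \<in> H" "j \<in> H" "\<And>A. A \<in> \<F> - {H} \<Longrightarrow> i \<in> A \<longleftrightarrow> j \<in> A"
    have "x $ i = x $ j" by (rule block_spaceD[OF Suc.prems(4)]) (use ij HG in blast)+
    moreover have "i \<in> G" "j \<in> G" using ij HG by blast+
    ultimately show "y $ i = y $ j" by (simp add: y)
  qed
  moreover have "n = card (\<F> - {H})" using Suc.hyps(2) HF Suc.prems(1) by simp
  moreover have "\<forall>A\<in>\<F> - {H}. A \<subseteq> H" by (auto simp: H_def)
  ultimately have "y \<in> vec.span (ind ` insert H (\<F> - {H}))"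
    using Suc.hyps(1)[of "\<F> - {H}" H y] Suc.prems(1,2) by auto
  then have "y \<in> vec.span (ind ` insert G \<F>)"
    by (rule set_mp[OF vec.span_mono, rotated]) (use HF in auto)
  moreover have "c *s ind G \<in> vec.span (ind ` insert G \<F>)" by (auto intro: vec.span_scale vec.span_base)
  ultimately have "y + c *s ind G \<in> vec.span (ind ` insert G \<F>)" by (rule vec.span_add)
  then show ?case by (simp add: y_def)
qed

lemma span_ind:
  assumes "\<forall>A\<in>\<F>. \<forall>B\<in>\<F>. A \<subseteq> B \<or> B \<subseteq> A" "\<forall>A\<in>\<F>. A \<subseteq> G"
  shows "vec.span (ind ` insert G \<F>) = (block_space G \<F> :: ('a::field ^ 'e::finite) set)"
proof
  show "vec.span (ind ` insert G \<F>) \<subseteq> (block_space G \<F> :: ('a ^ 'e) set)"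
  proof (rule vec.span_minimal[OF _ subspace_block_space], clarify)
    fix A assume A: "A \<in> insert G \<F>"
    show "ind A \<in> (block_space G \<F> :: ('a ^ 'e) set)"
    proof (rule block_spaceI)
      show "(ind A :: 'a ^ 'e) $ i = 0" if "i \<notin> G" for i using A that assms(2) by (auto simp: ind_nth)
    qed (use A in \<open>auto simp: ind_nth\<close>)
  qed
  show "(block_space G \<F> :: ('a ^ 'e) set) \<subseteq> vec.span (ind ` insert G \<F>)"
    using span_ind_superset[of \<F> G] assms by auto
qed

lemma inj_ind: "inj (ind :: 'e set \<Rightarrow> 'a::zero_neq_one ^ 'e::finite)"
proof (rule injI, rule set_eqI)
  fix A B :: "'e set" and i assume "(ind A :: 'a ^ 'e) = ind B"
  then have "(ind A :: 'a ^ 'e) $ i = ind B $ i" by simp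
  then show "i \<in> A \<longleftrightarrow> i \<in> B" by (simp add: ind_nth split: if_splits)
qed

text \<open>The largest member has a coordinate outside the union of the others, at which the whole
  span of those vanishes.\<close>

lemma independent_ind:
  fixes \<F> :: "'e::finite set set"
  assumes "\<forall>A\<in>\<F>. \<forall>B\<in>\<F>. A \<subseteq> B \<or> B \<subseteq> A" "{} \<notin> \<F>"
  shows "vec.independent (ind ` \<F> :: ('a::field ^ 'e) set)"
  using assms
proof (induction "card \<F>" arbitrary: \<F>)
  case 0
  then have "\<F> = {}" by simp
  then show ?case by (simp add: vec.independent_empty)
next
  case (Suc n)
  have ne: "\<F> \<noteq> {}" using Suc.hyps(2) by auto
  define H where "H = \<Union>\<F>"
  have HF: "H \<in> \<F>"
    unfolding H_def by (rule Union_in_chain[OF _ ne]) (use Suc.prems(1) in \<open>auto simp: subset_chain_def\<close>)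
  let ?R = "\<F> - {H}"
  have "\<Union>?R \<subset> H"
  proof (cases "?R = {}")
    case True
    have "H \<noteq> {}" using HF Suc.prems(2) by metis
    then show ?thesis unfolding True by blast
  next
    case False
    have "\<Union>?R \<in> ?R"
      by (rule Union_in_chain[OF _ False]) (use Suc.prems(1) in \<open>auto simp: subset_chain_def\<close>)
    then have "\<Union>?R \<noteq> H" by blast
    moreover have "\<Union>?R \<subseteq> H" unfolding H_def by blast
    ultimately show ?thesis by (rule psubsetI[rotated])
  qed
  then obtain h where h: "h \<in> H" "h \<notin> \<Union>?R" by auto
  have "vec.span (ind ` ?R :: ('a ^ 'e) set) \<subseteq> {x. x $ h = 0}"
    by (rule vec.span_minimal) (use h in \<open>auto simp: ind_nth intro!: vec.subspaceI\<close>)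
  then have "(ind H :: 'a ^ 'e) \<notin> vec.span (ind ` ?R)" using h(1) by (auto simp: ind_nth)
  moreover have "vec.independent (ind ` ?R :: ('a ^ 'e) set)"
    using Suc.hyps(1)[of ?R] Suc.hyps(2) Suc.prems HF by simp
  ultimately have "vec.independent (insert (ind H) (ind ` ?R) :: ('a ^ 'e) set)"
    by (rule vec.independent_insertI)
  moreover have "insert (ind H) (ind ` ?R) = (ind ` \<F> :: ('a ^ 'e) set)" using HF by auto
  ultimately show ?case by (simp only: not_False_eq_True)
qed

text \<open>The extra dimension comes from \<open>ind G\<close>, which is the zero vector when
  \<open>G = {}\<close>.\<close>

lemma dim_block_space:
  fixes \<F> :: "'e::finite set set"
  assumes "\<forall>A\<in>\<F>. \<forall>B\<in>\<F>. A \<subseteq> B \<or> B \<subseteq> A" "\<forall>A\<in>\<F>. A \<subset> G" "{} \<notin> \<F>"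
  shows "vec.dim (block_space G \<F> :: ('a::field ^ 'e) set) = (if G = {} then 0 else Suc (card \<F>))"
proof (cases "G = {}")
  case True
  then have "block_space G \<F> = ({0} :: ('a ^ 'e) set)"
    by (auto simp: vec_eq_iff block_space_outside intro!: block_spaceI)
  then show ?thesis using True by simp
next
  case False
  have sub: "\<forall>A\<in>\<F>. A \<subseteq> G" using assms(2) by auto
  have "vec.independent (ind ` insert G \<F> :: ('a ^ 'e) set)"
  proof (rule independent_ind)
    show "\<forall>A\<in>insert G \<F>. \<forall>B\<in>insert G \<F>. A \<subseteq> B \<or> B \<subseteq> A" using assms(1) sub by blast
    show "{} \<notin> insert G \<F>" using assms(3) False by blast
  qed
  then have "vec.dim (vec.span (ind ` insert G \<F>) :: ('a ^ 'e) set) = card (ind ` insert G \<F> :: ('a ^ 'e) set)"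
    by (rule vec.dim_span_eq_card_independent)
  also have "\<dots> = card (insert G \<F>)" by (rule card_image) (rule inj_on_subset[OF inj_ind], simp)
  also have "\<dots> = Suc (card \<F>)" using assms(2) by (subst card_insert_disjoint) auto
  finally show ?thesis using False unfolding span_ind[OF assms(1) sub] by simp
qed

lemma fan_vec_nth: "fan_vec A $ i = (if i \<in> A then -1 else 0)"
  by (simp add: fan_vec_def axis_def sum_negf)

lemma fan_vec_eq: "fan_vec A = - ind A"
  by (simp add: vec_eq_iff fan_vec_nth ind_nth)

lemma span_flag_cone:
  fixes \<F> :: "'e::finite set set"
  assumes "\<forall>A\<in>\<F>. \<forall>B\<in>\<F>. A \<subseteq> B \<or> B \<subseteq> A" "\<forall>A\<in>\<F>. A \<subseteq> G"
  shows "span (flag_cone G \<F>) = block_space G \<F>"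
proof -
  let ?X = "fan_vec ` \<F> \<union> {fan_vec G, - fan_vec G}"
  have "flag_cone G \<F> \<subseteq> span ?X"
    unfolding flag_cone_def
  proof (rule hull_minimal)
    show "?X \<subseteq> span ?X" by (rule span_superset)
    show "convex_cone (span ?X)" by (rule convex_cone_span)
  qed
  then have "span (flag_cone G \<F>) \<subseteq> span ?X" by (rule span_minimal) (rule subspace_span)
  moreover have "?X \<subseteq> flag_cone G \<F>" unfolding flag_cone_def by (rule hull_subset)
  then have "span ?X \<subseteq> span (flag_cone G \<F>)" by (rule span_mono)
  moreover have "span ?X = span (ind ` insert G \<F>)"
  proof
    have "fan_vec A \<in> span (ind ` insert G \<F>)" if "A \<in> insert G \<F>" for A
      unfolding fan_vec_eq using that by (intro span_neg span_base imageI)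
    then show "span ?X \<subseteq> span (ind ` insert G \<F>)"
      by (intro span_minimal subspace_span) (auto intro: span_neg)
    have "ind A \<in> span ?X" if "A \<in> insert G \<F>" for A
    proof -
      have "- fan_vec A \<in> span ?X" using that by (intro span_neg span_base) auto
      then show ?thesis by (simp add: fan_vec_eq)
    qed
    then show "span (ind ` insert G \<F>) \<subseteq> span ?X" by (intro span_minimal subspace_span) blast
  qed
  ultimately show ?thesis
    using span_ind[OF assms, where 'a = real] by (simp add: span_vec_eq)
qed

lemma dim_flag_cone:
  fixes \<F> :: "'e::finite set set"
  assumes "\<forall>A\<in>\<F>. \<forall>B\<in>\<F>. A \<subseteq> B \<or> B \<subseteq> A" "\<forall>A\<in>\<F>. A \<subset> G" "{} \<notin> \<F>"
  shows "dim (flag_cone G \<F>) = (if G = {} then 0 else Suc (card \<F>))"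
proof -
  have "dim (flag_cone G \<F>) = dim (block_space G \<F> :: (real ^ 'e) set)"
    using span_flag_cone[OF assms(1)] assms(2) by (metis dim_span psubset_imp_subset)
  then show ?thesis using dim_block_space[OF assms, where 'a = real] by (simp add: dim_vec_eq)
qed

lemma flag_cone_mono: "\<F> \<subseteq> \<G> \<Longrightarrow> flag_cone G \<F> \<subseteq> flag_cone G \<G>"
  unfolding flag_cone_def by (intro hull_mono) auto

lemma flag_cone_coefficients:
  fixes \<F> :: "'e::finite set set"
  assumes "x \<in> flag_cone G \<F>"
  shows "\<exists>a b. (\<forall>A\<in>\<F>. a A \<ge> 0) \<and> x = (\<Sum>A\<in>\<F>. a A *\<^sub>R fan_vec A) + b *\<^sub>R fan_vec G"
proof -
  let ?K = "{x. \<exists>a b. (\<forall>A\<in>\<F>. a A \<ge> (0::real)) \<and> x = (\<Sum>A\<in>\<F>. a A *\<^sub>R fan_vec A) + b *\<^sub>R fan_vec G}"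
  have "flag_cone G \<F> \<subseteq> ?K"
    unfolding flag_cone_def
  proof (rule hull_minimal)
    have "fan_vec B \<in> ?K" if "B \<in> \<F>" for B
    proof -
      have "(\<Sum>A\<in>\<F>. of_bool (A = B) *\<^sub>R fan_vec A) = fan_vec B"
        using that by (simp add: of_bool_def if_distrib[of "\<lambda>c. c *\<^sub>R _"] sum.delta cong: if_cong)
      then show ?thesis by (intro CollectI exI[of _ "\<lambda>A. of_bool (A = B)"] exI[of _ 0]) auto
    qed
    moreover have "c *\<^sub>R fan_vec G \<in> ?K" for c
      by (intro CollectI exI[of _ "\<lambda>A. 0"] exI[of _ c]) auto
    from this[of 1] this[of "-1"] have "fan_vec G \<in> ?K" "- fan_vec G \<in> ?K" by auto
    ultimately show "fan_vec ` \<F> \<union> {fan_vec G, - fan_vec G} \<subseteq> ?K" by blast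
    show "convex_cone ?K"
      unfolding convex_cone_iff
    proof (intro conjI ballI allI impI)
      show "0 \<in> ?K" by (intro CollectI exI[of _ "\<lambda>A. 0"] exI[of _ 0]) auto
    next
      fix x y assume "x \<in> ?K" "y \<in> ?K"
      then obtain a b a' b' where "\<forall>A\<in>\<F>. a A \<ge> 0" "x = (\<Sum>A\<in>\<F>. a A *\<^sub>R fan_vec A) + b *\<^sub>R fan_vec G"
        "\<forall>A\<in>\<F>. a' A \<ge> 0" "y = (\<Sum>A\<in>\<F>. a' A *\<^sub>R fan_vec A) + b' *\<^sub>R fan_vec G" by auto
      then show "x + y \<in> ?K"
        by (intro CollectI exI[of _ "\<lambda>A. a A + a' A"] exI[of _ "b + b'"])
          (auto simp: sum.distrib scaleR_add_left)
    next
      fix x and c :: real assume "x \<in> ?K" and c: "0 \<le> c"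
      then obtain a b where "\<forall>A\<in>\<F>. a A \<ge> 0" "x = (\<Sum>A\<in>\<F>. a A *\<^sub>R fan_vec A) + b *\<^sub>R fan_vec G" by auto
      then show "c *\<^sub>R x \<in> ?K" using c
        by (intro CollectI exI[of _ "\<lambda>A. c * a A"] exI[of _ "c * b"])
          (auto simp: scaleR_add_right scaleR_sum_right)
    qed
  qed
  then show ?thesis using assms by blast
qed

text \<open>On \<open>G\<close> the function \<open>f + b\<close> takes only the values 0 and 1. A
  member \<open>C\<close> with positive coefficient makes \<open>f\<close> drop strictly from each
  point of \<open>C\<close> to each point of \<open>G - C\<close>, so \<open>C\<close> is where the
  value is 1, which is \<open>B\<close>.\<close>

lemma mem_of_fan_vec_mem:
  fixes \<F> :: "'e::finite set set"
  assumes ch: "\<forall>A\<in>\<F>. \<forall>B\<in>\<F>. A \<subseteq> B \<or> B \<subseteq> A" and sub: "\<forall>A\<in>\<F>. A \<subset> G" and ne: "{} \<notin> \<F>"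
    and B: "B \<noteq> {}" "B \<subset> G" and x: "fan_vec B \<in> flag_cone G \<F>"
  shows "B \<in> \<F>"
proof -
  obtain a b where a: "\<forall>A\<in>\<F>. a A \<ge> 0" "fan_vec B = (\<Sum>A\<in>\<F>. a A *\<^sub>R fan_vec A) + b *\<^sub>R fan_vec G"
    using flag_cone_coefficients[OF x] by auto
  define f where "f i = (\<Sum>A\<in>\<F>. if i \<in> A then a A else 0)" for i
  have f: "(if i \<in> B then 1 else 0) = f i + b" if "i \<in> G" for i
  proof -
    have "fan_vec B $ i = (\<Sum>A\<in>\<F>. a A * fan_vec A $ i) + b * fan_vec G $ i"
      unfolding a(2) by simp
    also have "(\<Sum>A\<in>\<F>. a A * fan_vec A $ i) = - f i"
      by (simp add: f_def fan_vec_nth sum_negf[symmetric] if_distrib cong: if_cong)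
    finally show ?thesis using that by (simp add: fan_vec_nth split: if_splits)
  qed
  have mono: "f j \<le> f i" if "\<forall>A\<in>\<F>. j \<in> A \<longrightarrow> i \<in> A" for i j
    unfolding f_def by (rule sum_mono) (use that a(1) in auto)
  have gap: "f j + a C \<le> f i" if "\<forall>A\<in>\<F>. j \<in> A \<longrightarrow> i \<in> A" "C \<in> \<F>" "i \<in> C" "j \<notin> C" for i j C
  proof -
    have "f j + a C = (\<Sum>A\<in>\<F>. (if j \<in> A then a A else 0) + (if A = C then a A else 0))"
      using that(2) by (simp add: f_def sum.distrib sum.delta)
    also have "\<dots> \<le> f i" unfolding f_def by (rule sum_mono) (use that a(1) in auto)
    finally show ?thesis .
  qed
  obtain p q where p: "p \<in> B" "p \<in> G" and q: "q \<in> G" "q \<notin> B" using B by auto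
  have "f q < f p" using f[OF p(2)] f[OF q(1)] p(1) q(2) by simp
  \<comment> \<open>If all coefficients vanished, \<open>f\<close> would be constant and could not
    differ at \<open>p\<close> and \<open>q\<close>.\<close>
  then obtain C where C: "C \<in> \<F>" "a C > 0"
    using mono[of p q] a(1) by (smt (verit) f_def sum_mono)
  have sep: "i \<in> B \<and> j \<notin> B" if "i \<in> C" "j \<in> G - C" for i j
  proof -
    have "\<forall>A\<in>\<F>. j \<in> A \<longrightarrow> i \<in> A" using ch C(1) that by blast
    then have "f j + a C \<le> f i" using gap[of j i C] C(1) that by auto
    moreover have "i \<in> G" using that(1) C(1) sub by auto
    ultimately show ?thesis using f[of i] f[of j] that C(2) by (auto split: if_splits)
  qed
  have "C \<noteq> {}" "G - C \<noteq> {}" using C(1) ne sub by auto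
  then have "C \<subseteq> B" "\<forall>j\<in>G - C. j \<notin> B" using sep by blast+
  then have "B = C" using B(2) by auto
  then show ?thesis using C by simp
qed

text \<open>A block vector over \<open>bit\<close> lifts to the integer vector with entries 0 and 1
  at the same places, which is constant on the same blocks.\<close>

lemma T_Z2_flag_cone:
  fixes \<F> :: "'e::finite set set"
  assumes "\<forall>A\<in>\<F>. \<forall>B\<in>\<F>. A \<subseteq> B \<or> B \<subseteq> A" "\<forall>A\<in>\<F>. A \<subseteq> G"
  shows "T_Z2 (flag_cone G \<F>) = block_space G \<F>"
  unfolding T_Z2_def span_flag_cone[OF assms]
proof (intro set_eqI iffI)
  fix x :: "bit ^ 'e"
  assume "x \<in> {(\<chi> i. of_int (z $ i)) | z :: int ^ 'e. (\<chi> i. of_int (z $ i)) \<in> (block_space G \<F> :: (real ^ 'e) set)}"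
  then obtain z :: "int ^ 'e" where z: "x = (\<chi> i. of_int (z $ i))" "(\<chi> i. of_int (z $ i)) \<in> (block_space G \<F> :: (real ^ 'e) set)"
    by blast
  show "x \<in> block_space G \<F>"
  proof (rule block_spaceI)
    show "x $ i = 0" if "i \<notin> G" for i using block_space_outside[OF z(2) that] by (simp add: z(1))
    fix i j assume "i \<in> G" "j \<in> G" "\<And>A. A \<in> \<F> \<Longrightarrow> i \<in> A \<longleftrightarrow> j \<in> A"
    then have "z $ i = z $ j" using block_spaceD[OF z(2), of i j] by simp
    then show "x $ i = x $ j" by (simp add: z(1))
  qed
next
  fix x :: "bit ^ 'e"
  assume x: "x \<in> block_space G \<F>"
  let ?z = "(\<chi> i. if x $ i = 0 then 0 else 1) :: int ^ 'e"
  have "x = (\<chi> i. of_int (?z $ i))" by (simp add: vec_eq_iff)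
  moreover have "(\<chi> i. of_int (?z $ i)) \<in> (block_space G \<F> :: (real ^ 'e) set)"
  proof (rule block_spaceI)
    fix i j assume "i \<in> G" "j \<in> G" "\<And>A. A \<in> \<F> \<Longrightarrow> i \<in> A \<longleftrightarrow> j \<in> A"
    then have "x $ i = x $ j" using block_spaceD[OF x] by blast
    then show "((\<chi> i. of_int (?z $ i)) :: real ^ 'e) $ i = (\<chi> i. of_int (?z $ i)) $ j" by simp
  qed (simp add: block_space_outside[OF x])
  ultimately show "x \<in> {(\<chi> i. of_int (z $ i)) | z :: int ^ 'e. (\<chi> i. of_int (z $ i)) \<in> (block_space G \<F> :: (real ^ 'e) set)}"
    by blast
qed

subsection \<open>The matroid fan\<close>

text \<open>Level 0 and the levels from \<open>n\<close> on are left out, with \<open>n\<close> the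
  rank, because \<open>flat_chains\<close> admits neither the empty flat nor the ground set.\<close>

definition flag_set :: "nat \<Rightarrow> (nat \<Rightarrow> 'e set) \<Rightarrow> 'e set set" where
  "flag_set n F = F ` {1..<n}"

lemma flag_setI: "0 < i \<Longrightarrow> i < n \<Longrightarrow> F i \<in> flag_set n F"
  by (simp add: flag_set_def)

context loopfree_matroid
begin

lemma flat_empty: "flat {}"
  using cl_empty by (simp add: flats_def)

lemma flat_chains_iff:
  "\<F> \<in> flat_chains E Ind \<longleftrightarrow> (\<forall>A\<in>\<F>. flat A \<and> A \<noteq> {} \<and> A \<noteq> E) \<and> (\<forall>A\<in>\<F>. \<forall>B\<in>\<F>. A \<subseteq> B \<or> B \<subseteq> A)"
  unfolding flat_chains_def subset_chain_def mem_Collect_eq subset_iff by blast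

lemma flat_chains_subset: "\<F> \<in> flat_chains E Ind \<Longrightarrow> \<G> \<subseteq> \<F> \<Longrightarrow> \<G> \<in> flat_chains E Ind"
  unfolding flat_chains_iff by (meson subsetD)

lemma flat_chainsD:
  assumes "\<F> \<in> flat_chains E Ind"
  shows "\<forall>A\<in>\<F>. \<forall>B\<in>\<F>. A \<subseteq> B \<or> B \<subseteq> A" "\<forall>A\<in>\<F>. A \<subset> E" "{} \<notin> \<F>" "\<forall>A\<in>\<F>. A \<subseteq> E"
proof -
  note a = assms[unfolded flat_chains_iff]
  show "\<forall>A\<in>\<F>. \<forall>B\<in>\<F>. A \<subseteq> B \<or> B \<subseteq> A" by (rule a[THEN conjunct2])
  have b: "flat A" "A \<noteq> {}" "A \<noteq> E" if "A \<in> \<F>" for A using a[THEN conjunct1] that by simp_all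
  show "{} \<notin> \<F>" using b(2) by metis
  show "\<forall>A\<in>\<F>. A \<subseteq> E" using flat_subset[OF b(1)] by simp
  show "\<forall>A\<in>\<F>. A \<subset> E" using b(3) flat_subset[OF b(1)] by (simp add: psubset_eq)
qed

lemma rk_proper: assumes "flat A" "A \<noteq> {}" "A \<noteq> E" shows "rk A \<in> {1..<r}"
proof -
  have AE: "A \<subseteq> E" by (rule flat_subset[OF assms(1)])
  have "rk {} < rk A" by (rule rk_flat_less[OF flat_empty _ AE]) (use assms(2) in blast)
  moreover have "rk A < r" by (rule rk_flat_less[OF assms(1)]) (use AE assms(3) in auto)
  ultimately show ?thesis by simp
qed

lemma flag_set_chain: assumes F: "flag F" shows "flag_set r F \<in> flat_chains E Ind"
  unfolding flat_chains_iff flag_set_def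
proof (intro conjI ballI)
  fix A assume "A \<in> F ` {1..<r}"
  then obtain i where i: "A = F i" "1 \<le> i" "i < r" by auto
  show "flat A" using i flag_flat[OF F] by simp
  have "rk A = i" using i flag_rk[OF F, of i] by simp
  then show "A \<noteq> {}" "A \<noteq> E" using i rk_empty by auto
next
  fix A B assume "A \<in> F ` {1..<r}" "B \<in> F ` {1..<r}"
  then obtain i j where "A = F i" "B = F j" by auto
  then show "A \<subseteq> B \<or> B \<subseteq> A" using flag_mono[OF F, of i j] flag_mono[OF F, of j i] by (cases "i \<le> j") auto
qed

lemma mem_flag_set: assumes "flag F" shows "A \<in> flag_set r F \<longleftrightarrow> rk A \<in> {1..<r} \<and> F (rk A) = A"
proof
  assume "A \<in> flag_set r F"
  then obtain i where "A = F i" "i \<in> {1..<r}" unfolding flag_set_def by blast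
  then show "rk A \<in> {1..<r} \<and> F (rk A) = A" using flag_rk[OF assms, of i] by simp
next
  assume a: "rk A \<in> {1..<r} \<and> F (rk A) = A"
  then have "F (rk A) \<in> flag_set r F" unfolding flag_set_def by blast
  then show "A \<in> flag_set r F" using a by simp
qed

lemma chain_in_flag: assumes "\<F> \<in> flat_chains E Ind" obtains F where "flag F" "\<F> \<subseteq> flag_set r F"
proof -
  obtain F where F: "flag F" "\<And>A. A \<in> \<F> \<Longrightarrow> F (rk A) = A"
    by (rule flag_extend[of \<F>]) (use assms in \<open>auto simp: flat_chains_iff\<close>)
  have "A \<in> flag_set r F" if "A \<in> \<F>" for A
    using F(2)[OF that] rk_proper[of A] assms that unfolding mem_flag_set[OF F(1)] flat_chains_iff by blast
  then show ?thesis using that F(1) by blast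
qed

lemma flag_set_maximal:
  assumes F: "flag F" and "\<F> \<in> flat_chains E Ind" "flag_set r F \<subseteq> \<F>" shows "\<F> = flag_set r F"
proof (rule antisym[OF _ assms(3)], rule subsetI)
  obtain F' where F': "flag F'" "\<F> \<subseteq> flag_set r F'" by (rule chain_in_flag[OF assms(2)])
  fix A assume "A \<in> \<F>"
  then have A: "rk A \<in> {1..<r}" "F' (rk A) = A" using F' mem_flag_set by auto
  then have "F (rk A) \<in> flag_set r F" unfolding flag_set_def by blast
  then have "F (rk A) \<in> flag_set r F'" using assms(3) F'(2) by blast
  then have "F' (rk (F (rk A))) = F (rk A)" using mem_flag_set[OF F'(1)] by blast
  then have "F (rk A) = A" using A flag_rk[OF F, of "rk A"] by simp
  then show "A \<in> flag_set r F" using A(1) mem_flag_set[OF F] by simp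
qed

lemma flag_set_inj: assumes "flag F" "flag F'" "flag_set r F = flag_set r F'" shows "F = F'"
proof (rule flag_eqI[OF assms(1,2)])
  fix i assume i: "i < r"
  show "F i = F' i"
  proof (cases "i = 0")
    case True
    then show ?thesis using flag_0[OF assms(1)] flag_0[OF assms(2)] by simp
  next
    case False
    then have "F i \<in> flag_set r F'" using flag_setI[of i r F] i assms(3) by simp
    then show ?thesis using mem_flag_set[OF assms(2)] flag_rk[OF assms(1), of i] i by auto
  qed
qed

lemma inj_on_flag: assumes "flag F" shows "inj_on F {1..<r}"
  using flag_rk[OF assms] by (intro inj_onI) (metis atLeastLessThan_iff less_imp_le)

lemma card_flag_set: assumes "flag F" shows "card (flag_set r F) = r - 1"
  by (simp only: flag_set_def card_image[OF inj_on_flag[OF assms]] card_atLeastLessThan)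

lemma flag_cone_subset_iff:
  assumes "\<F> \<in> flat_chains E Ind" "\<G> \<in> flat_chains E Ind"
  shows "flag_cone E \<F> \<subseteq> flag_cone E \<G> \<longleftrightarrow> \<F> \<subseteq> \<G>"
proof
  assume sub: "flag_cone E \<F> \<subseteq> flag_cone E \<G>"
  show "\<F> \<subseteq> \<G>"
  proof
    fix A assume A: "A \<in> \<F>"
    have "fan_vec ` \<F> \<union> {fan_vec E, - fan_vec E} \<subseteq> flag_cone E \<F>"
      unfolding flag_cone_def by (rule hull_subset)
    then have "fan_vec A \<in> flag_cone E \<G>" using A sub by blast
    moreover have "A \<noteq> {}" "A \<subset> E" using flat_chainsD[OF assms(1)] A by blast+
    ultimately show "A \<in> \<G>" using mem_of_fan_vec_mem[OF flat_chainsD(1-3)[OF assms(2)]] by blast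
  qed
qed (rule flag_cone_mono)

lemma inj_on_flag_cone: "inj_on (flag_cone E) (flat_chains E Ind)"
  by (rule inj_onI) (metis flag_cone_subset_iff order_refl subset_antisym)

abbreviation fan where "fan \<equiv> loopfree_matroid_fan E Ind"
abbreviation phases where "phases \<equiv> loopfree_phase_structure E Ind"

definition facet :: "(nat \<Rightarrow> 'e set) \<Rightarrow> (real ^ 'e) set" where
  "facet F = flag_cone E (flag_set r F)"

lemma facet_inj: "flag F \<Longrightarrow> flag F' \<Longrightarrow> facet F = facet F' \<longleftrightarrow> F = F'"
  unfolding facet_def using inj_on_flag_cone flag_set_chain flag_set_inj by (metis inj_onD)

text \<open>Every chain extends to a complete flag, and inclusion of cones is inclusion of chains;
  so the maximal cones are those of complete flags.\<close>

lemma facets_fan: "facets fan = facet ` Collect flag"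
proof
  show "facets fan \<subseteq> facet ` Collect flag"
  proof
    fix \<sigma> assume \<sigma>: "\<sigma> \<in> facets fan"
    then obtain \<F> where F: "\<F> \<in> flat_chains E Ind" "\<sigma> = flag_cone E \<F>"
      by (auto simp: facets_def loopfree_matroid_fan_def)
    obtain F where F': "flag F" "\<F> \<subseteq> flag_set r F" by (rule chain_in_flag[OF F(1)])
    have "\<sigma> \<subseteq> facet F" unfolding F(2) facet_def by (rule flag_cone_mono[OF F'(2)])
    moreover have "facet F \<in> fan" using flag_set_chain[OF F'(1)] by (simp add: facet_def loopfree_matroid_fan_def)
    ultimately have "\<sigma> = facet F" using \<sigma> by (auto simp: facets_def)
    then show "\<sigma> \<in> facet ` Collect flag" using F'(1) by blast
  qed
  show "facet ` Collect flag \<subseteq> facets fan"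
  proof clarify
    fix F assume F: "flag F"
    note c = flag_set_chain[OF F]
    show "facet F \<in> facets fan"
      unfolding facets_def
    proof (intro CollectI conjI ballI impI)
      show "facet F \<in> fan" using c by (simp add: facet_def loopfree_matroid_fan_def)
      fix \<sigma> assume \<sigma>: "\<sigma> \<in> fan" "facet F \<subseteq> \<sigma>"
      then obtain \<F> where G: "\<F> \<in> flat_chains E Ind" "\<sigma> = flag_cone E \<F>" by (auto simp: loopfree_matroid_fan_def)
      then have "flag_set r F \<subseteq> \<F>" using \<sigma>(2) flag_cone_subset_iff[OF c G(1)] by (simp add: facet_def)
      then show "\<sigma> = facet F" using flag_set_maximal[OF F G(1)] G(2) by (simp add: facet_def)
    qed
  qed
qed

text \<open>The empty ground set is the case in which the line through \<open>fan_vec E\<close>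
  collapses, so the dimension formulas split on it.\<close>

lemma ground_empty_iff: "E = {} \<longleftrightarrow> r = 0"
proof
  assume "r = 0"
  then have "\<not> rk {} < r" by simp
  then show "E = {}" using rk_flat_less[OF flat_empty _ order_refl] by blast
qed (simp add: rk_empty)

lemma dim_cone:
  assumes "\<F> \<in> flat_chains E Ind"
  shows "dim (flag_cone E \<F>) = (if E = {} then 0 else Suc (card \<F>))"
  by (rule dim_flag_cone[OF flat_chainsD(1-3)[OF assms]])

lemma dim_facet: "flag F \<Longrightarrow> dim (facet F) = r"
  unfolding facet_def using dim_cone[OF flag_set_chain] card_flag_set ground_empty_iff by auto

lemma fan_dim_fan: "fan_dim fan = r"
  unfolding fan_dim_def
proof (rule Max_eqI)
  show "finite (dim ` fan)" by (simp add: loopfree_matroid_fan_def)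
  obtain F where F: "flag F" by (rule flag_extend[of "{}"]) auto
  have "facet F \<in> fan" using flag_set_chain[OF F] by (simp add: facet_def loopfree_matroid_fan_def)
  then show "r \<in> dim ` fan" using dim_facet[OF F] by (metis image_eqI)
  fix d assume "d \<in> dim ` fan"
  then obtain \<F> where \<F>: "\<F> \<in> flat_chains E Ind" "d = dim (flag_cone E \<F>)" by (auto simp: loopfree_matroid_fan_def)
  obtain F where F: "flag F" "\<F> \<subseteq> flag_set r F" by (rule chain_in_flag[OF \<F>(1)])
  have "dim (flag_cone E \<F>) \<le> dim (facet F)"
    unfolding facet_def by (rule dim_subset[OF flag_cone_mono[OF F(2)]])
  then show "d \<le> r" using \<F>(2) dim_facet[OF F(1)] by simp
qed

abbreviation blocks :: "(nat \<Rightarrow> 'e set) \<Rightarrow> (bit ^ 'e) set" where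
  "blocks F \<equiv> block_space E (flag_set r F)"

lemma T_Z2_facet: "flag F \<Longrightarrow> T_Z2 (facet F) = blocks F"
  unfolding facet_def by (rule T_Z2_flag_cone) (use flat_chainsD[OF flag_set_chain] in blast)+

lemma dim_blocks: "flag F \<Longrightarrow> vec.dim (blocks F) = r"
  using dim_block_space[OF flat_chainsD(1-3)[OF flag_set_chain], of F, where 'a = bit] card_flag_set ground_empty_iff by auto

lemma flag_set_upd:
  assumes "flag F" "flag F'" "Suc i < r" and sub: "F ` ({1..<r} - {Suc i}) \<subseteq> flag_set r F'"
  shows "F' = F(Suc i := F' (Suc i))"
proof -
  have eq: "F' j = F j" if "j \<in> {1..<r} - {Suc i}" for j
  proof -
    have "F j \<in> flag_set r F'" using sub that by blast
    then show ?thesis using mem_flag_set[OF assms(2)] flag_rk[OF assms(1), of j] that by auto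
  qed
  have "F' j = (F(Suc i := F' (Suc i))) j" for j
  proof -
    consider "j = Suc i" | "j = 0" | "j \<in> {1..<r} - {Suc i}" | "j \<ge> r" by fastforce
    then show ?thesis
    proof cases
      case 2
      then show ?thesis using flag_0[OF assms(1)] flag_0[OF assms(2)] by simp
    next
      case 3
      then show ?thesis using eq[OF 3] by simp
    next
      case 4
      then show ?thesis using flag_top[OF assms(1) 4] flag_top[OF assms(2) 4] assms(3) by simp
    qed simp
  qed
  then show ?thesis by blast
qed

text \<open>A facet contains the cone exactly if its flag has the same flats at all levels other
  than \<open>Suc i\<close>. The adjacent facets thus correspond to the atoms of a rank-two
  interval, which is the form of \<open>PS_even\<close>.\<close>

lemma adjacent_facets_fan:
  assumes F: "flag F" and i: "Suc i < r"
  shows "adjacent_facets fan (flag_cone E (F ` ({1..<r} - {Suc i}))) =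
    (\<lambda>G. facet (F(Suc i := G))) ` {G. flag (F(Suc i := G))}"
    (is "adjacent_facets fan (flag_cone E ?\<G>) = ?R")
proof -
  have sub: "?\<G> \<subseteq> flag_set r F" unfolding flag_set_def by blast
  have G: "?\<G> \<in> flat_chains E Ind" by (rule flat_chains_subset[OF flag_set_chain[OF F] sub])
  have iff: "flag_cone E ?\<G> \<subseteq> facet F' \<longleftrightarrow> ?\<G> \<subseteq> flag_set r F'" if "flag F'" for F'
    unfolding facet_def by (rule flag_cone_subset_iff[OF G flag_set_chain[OF that]])
  show ?thesis
  proof
    show "adjacent_facets fan (flag_cone E ?\<G>) \<subseteq> ?R"
    proof
      fix \<sigma> assume "\<sigma> \<in> adjacent_facets fan (flag_cone E ?\<G>)"
      then obtain F' where F': "flag F'" "\<sigma> = facet F'" "?\<G> \<subseteq> flag_set r F'"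
        unfolding adjacent_facets_def facets_fan using iff by blast
      have "F' = F(Suc i := F' (Suc i))" by (rule flag_set_upd[OF F F'(1) i F'(3)])
      then show "\<sigma> \<in> ?R"
        unfolding F'(2) using F'(1) by (intro image_eqI[of _ _ "F' (Suc i)"] CollectI) simp_all
    qed
    show "?R \<subseteq> adjacent_facets fan (flag_cone E ?\<G>)"
    proof clarify
      fix G assume G': "flag (F(Suc i := G))"
      have "?\<G> \<subseteq> flag_set r (F(Suc i := G))"
      proof
        fix A assume "A \<in> ?\<G>"
        then obtain j where "A = F j" "j \<in> {1..<r} - {Suc i}" by blast
        then show "A \<in> flag_set r (F(Suc i := G))" using flag_setI[of j r "F(Suc i := G)"] by simp
      qed
      then have "flag_cone E ?\<G> \<subseteq> facet (F(Suc i := G))" using iff[OF G'] by simp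
      moreover have "facet (F(Suc i := G)) \<in> facets fan" unfolding facets_fan using G' by blast
      ultimately show "facet (F(Suc i := G)) \<in> adjacent_facets fan (flag_cone E ?\<G>)"
        unfolding adjacent_facets_def by blast
    qed
  qed
qed

lemma codim1_faces_fan:
  "codim1_faces fan = {flag_cone E (F ` ({1..<r} - {Suc i})) | F i. flag F \<and> Suc i < r}"
proof (intro subset_antisym subsetI)
  fix \<tau> assume "\<tau> \<in> codim1_faces fan"
  then obtain \<G> where G: "\<G> \<in> flat_chains E Ind" "\<tau> = flag_cone E \<G>" "dim \<tau> + 1 = r"
    unfolding codim1_faces_def fan_dim_fan by (auto simp: loopfree_matroid_fan_def)
  \<comment> \<open>The line through \<open>fan_vec E\<close> adds one dimension to the number of
    flats, so exactly one flat of a complete flag is missing.\<close>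
  have card: "card \<G> + 2 = r" using G(3) dim_cone[OF G(1)] G(2) ground_empty_iff by (auto split: if_splits)
  obtain F where F: "flag F" "\<G> \<subseteq> flag_set r F" by (rule chain_in_flag[OF G(1)])
  have "card (flag_set r F - \<G>) = 1"
    using card_flag_set[OF F(1)] card_Diff_subset[OF _ F(2)] card by simp
  then obtain A where A: "flag_set r F - \<G> = {A}" by (auto simp: card_1_singleton_iff)
  then have A': "rk A \<in> {1..<r}" "F (rk A) = A" using mem_flag_set[OF F(1), of A] by auto
  then obtain i where i: "rk A = Suc i" by (cases "rk A") auto
  have "\<G> = flag_set r F - {A}" using A F(2) by blast
  also have "\<dots> = F ` {1..<r} - F ` {Suc i}" using A'(2) i by (simp add: flag_set_def)
  also have "\<dots> = F ` ({1..<r} - {Suc i})"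
    by (rule inj_on_image_set_diff[OF inj_on_flag[OF F(1)], symmetric]) (use A'(1) i in auto)
  finally show "\<tau> \<in> {flag_cone E (F ` ({1..<r} - {Suc i})) | F i. flag F \<and> Suc i < r}"
    using G(2) F(1) A' i by auto
next
  fix \<tau> assume "\<tau> \<in> {flag_cone E (F ` ({1..<r} - {Suc i})) | F i. flag F \<and> Suc i < r}"
  then obtain F i where F: "flag F" "Suc i < r" "\<tau> = flag_cone E (F ` ({1..<r} - {Suc i}))" by auto
  let ?\<G> = "F ` ({1..<r} - {Suc i})"
  have sub: "?\<G> \<subseteq> flag_set r F" unfolding flag_set_def by blast
  have G: "?\<G> \<in> flat_chains E Ind" by (rule flat_chains_subset[OF flag_set_chain[OF F(1)] sub])
  have "inj_on F ({1..<r} - {Suc i})" by (rule inj_on_subset[OF inj_on_flag[OF F(1)]]) blast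
  then have "card ?\<G> = r - 2" using F(2) by (simp add: card_image card_Diff_singleton)
  then show "\<tau> \<in> codim1_faces fan"
    unfolding codim1_faces_def fan_dim_fan using F(2,3) G dim_cone[OF G] ground_empty_iff
    by (auto simp: loopfree_matroid_fan_def)
qed

end

subsection \<open>Real phase structures and phases\<close>

lemma ind_flip: "(ind (flip A S) :: bit ^ 'e::finite) = ind A + ind S"
  by (simp add: vec_eq_iff ind_nth)

lemma ind_support: "ind {i. x $ i = 1} = (x :: bit ^ 'e::finite)"
  by (simp add: vec_eq_iff ind_nth)

lemma ind_eq_iff: "(ind S :: bit ^ 'e::finite) = ind S' \<longleftrightarrow> S = S'"
  using inj_ind by (rule inj_eq)

lemma ind_coord_space: "(ind S :: bit ^ 'e::finite) \<in> coord_space G \<longleftrightarrow> S \<subseteq> G"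
  by (auto simp: coord_space_def ind_nth split: if_splits)

lemma sign_power_ind: "sign_power G (ind S) = signvec G S"
  by (simp add: vec_eq_iff sign_power_def signvec_def sg_def ind_nth)

lemma even_covering_iff: "even_covering I A \<longleftrightarrow> (\<forall>x. even (card {i \<in> I. x \<in> A i}))"
proof -
  have "even (card {i \<in> I. x \<in> A i})" if "x \<notin> (\<Union>i\<in>I. A i)" for x
  proof -
    have "{i \<in> I. x \<in> A i} = {}" using that by blast
    then show ?thesis by (simp only: card.empty even_zero)
  qed
  then show ?thesis unfolding even_covering_def by blast
qed

lemma direction_coset:
  fixes V :: "(bit ^ 'e::finite) set"
  assumes "vec.subspace V" shows "direction ((+) a ` V) = V"
proof
  show "direction ((+) a ` V) \<subseteq> V"
    using vec.subspace_diff[OF assms] by (auto simp only: direction_def image_iff add_diff_cancel_left)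
  show "V \<subseteq> direction ((+) a ` V)"
  proof
    fix v assume v: "v \<in> V"
    have "v = (a + v) - (a + 0)" by (simp only: add_diff_cancel_left diff_zero)
    then show "v \<in> direction ((+) a ` V)"
      unfolding direction_def using v vec.subspace_0[OF assms] by blast
  qed
qed

context loopfree_matroid
begin

lemma same_block:
  assumes F: "flag F" and jk: "j \<in> E" "k \<in> E" and same: "\<And>A. A \<in> flag_set r F \<Longrightarrow> j \<in> A \<longleftrightarrow> k \<in> A"
  shows "j \<in> F m \<longleftrightarrow> k \<in> F m"
proof -
  consider "m = 0" | "0 < m" "m < r" | "r \<le> m" by linarith
  then show ?thesis
  proof cases
    case 1
    then show ?thesis using flag_0[OF F] by simp
  next
    case 2
    show ?thesis by (rule same[OF flag_setI[OF 2]])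
  next
    case 3
    then show ?thesis using flag_top[OF F 3] jk by simp
  qed
qed

lemma blocks_const:
  assumes F: "flag F" and x: "x \<in> blocks F" and i: "j \<in> F (Suc i) - F i" "k \<in> F (Suc i) - F i"
  shows "x $ j = x $ k"
proof (rule block_spaceD[OF x])
  show "j \<in> E" "k \<in> E" using i flag_sub[OF F] by blast+
  fix A assume "A \<in> flag_set r F"
  then obtain m where m: "A = F m" unfolding flag_set_def by blast
  show "j \<in> A \<longleftrightarrow> k \<in> A"
  proof (cases "m \<le> i")
    case True
    then show ?thesis using flag_mono[OF F True] i m by blast
  next
    case False
    then have "F (Suc i) \<subseteq> F m" by (intro flag_mono[OF F]) simp
    then show ?thesis using i m by blast
  qed
qed

lemma blocksI:
  fixes x :: "bit ^ 'e"
  assumes F: "flag F" and "\<And>i. i \<notin> E \<Longrightarrow> x $ i = 0"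
    and "\<And>i j k. i < r \<Longrightarrow> j \<in> F (Suc i) - F i \<Longrightarrow> k \<in> F (Suc i) - F i \<Longrightarrow> x $ j = x $ k"
  shows "x \<in> blocks F"
proof (rule block_spaceI)
  fix j k assume jk: "j \<in> E" "k \<in> E" "\<And>A. A \<in> flag_set r F \<Longrightarrow> j \<in> A \<longleftrightarrow> k \<in> A"
  obtain i where i: "i < r" "j \<in> F (Suc i) - F i" by (rule flag_block_index[OF F jk(1)])
  have "k \<in> F (Suc i) - F i" using i(2) same_block[OF F jk] by blast
  then show "x $ j = x $ k" by (rule assms(3)[OF i])
qed (rule assms(2))

lemma ind_block: assumes F: "flag F" shows "(ind (F (Suc i) - F i) :: bit ^ 'e) \<in> blocks F"
proof (rule blocksI[OF F])
  show "(ind (F (Suc i) - F i) :: bit ^ 'e) $ j = 0" if "j \<notin> E" for j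
    using flag_sub[OF F] that by (auto simp: ind_nth)
  fix m j k assume m: "j \<in> F (Suc m) - F m" "k \<in> F (Suc m) - F m"
  have *: "l \<in> F (Suc i) - F i \<longleftrightarrow> i = m" if l: "l \<in> F (Suc m) - F m" for l
  proof
    assume "l \<in> F (Suc i) - F i"
    then have "\<not> Suc i \<le> m" "\<not> Suc m \<le> i" using flag_mono[OF F, of "Suc i" m] flag_mono[OF F, of "Suc m" i] l by blast+
    then show "i = m" by simp
  qed (use l in simp)
  show "(ind (F (Suc i) - F i) :: bit ^ 'e) $ j = ind (F (Suc i) - F i) $ k"
    using *[OF m(1)] *[OF m(2)] by (simp add: ind_nth)
qed

lemma blocks_coord_space: "blocks F \<subseteq> coord_space E"
  by (auto simp: block_space_def)

text \<open>An affine subspace whose direction is the tangent space of a facet is a coset of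
  \<open>blocks F\<close>, and that space has dimension \<open>r\<close>. Distinct exchanged flats
  give distinct facets by \<open>facet_inj\<close>, so the covering condition turns into counting
  flats.\<close>

lemma real_phase_structure_iff:
  "real_phase_structure E fan \<E> \<longleftrightarrow> \<E> \<in> extensional (facets fan) \<and>
    (\<forall>F. flag F \<longrightarrow> (\<exists>a\<in>coord_space E. \<E> (facet F) = (+) a ` blocks F)) \<and>
    (\<forall>F i x. flag F \<longrightarrow> Suc i < r \<longrightarrow> even (card {G. flag (F(Suc i := G)) \<and> x \<in> \<E> (facet (F(Suc i := G)))}))"
proof -
  have cosets: "\<E> (facet F) \<in> affine_subspaces_Z2 E r \<and> direction (\<E> (facet F)) = T_Z2 (facet F) \<longleftrightarrow>
    (\<exists>a\<in>coord_space E. \<E> (facet F) = (+) a ` blocks F)" if F: "flag F" for F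
  proof
    assume l: "\<E> (facet F) \<in> affine_subspaces_Z2 E r \<and> direction (\<E> (facet F)) = T_Z2 (facet F)"
    then obtain a V where V: "\<E> (facet F) = (+) a ` V" "a \<in> coord_space E" "vec.subspace V"
      unfolding affine_subspaces_Z2_def by blast
    have "V = blocks F" using l direction_coset[OF V(3)] V(1) T_Z2_facet[OF F] by simp
    then show "\<exists>a\<in>coord_space E. \<E> (facet F) = (+) a ` blocks F" using V by blast
  next
    assume "\<exists>a\<in>coord_space E. \<E> (facet F) = (+) a ` blocks F"
    then obtain a where a: "a \<in> coord_space E" "\<E> (facet F) = (+) a ` blocks F" by blast
    have "\<E> (facet F) \<in> affine_subspaces_Z2 E r"
      unfolding affine_subspaces_Z2_def
      using a subspace_block_space[of E "flag_set r F"] blocks_coord_space[of F] dim_blocks[OF F] by blast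
    then show "\<E> (facet F) \<in> affine_subspaces_Z2 E r \<and> direction (\<E> (facet F)) = T_Z2 (facet F)"
      using a(2) direction_coset[OF subspace_block_space] T_Z2_facet[OF F] by simp
  qed
  have even: "even_covering (adjacent_facets fan (flag_cone E (F ` ({1..<r} - {Suc i})))) \<E> \<longleftrightarrow>
    (\<forall>x. even (card {G. flag (F(Suc i := G)) \<and> x \<in> \<E> (facet (F(Suc i := G)))}))"
    if F: "flag F" "Suc i < r" for F i
  proof -
    have "card {\<sigma> \<in> (\<lambda>G. facet (F(Suc i := G))) ` {G. flag (F(Suc i := G))}. x \<in> \<E> \<sigma>} =
      card {G. flag (F(Suc i := G)) \<and> x \<in> \<E> (facet (F(Suc i := G)))}" for x
    proof -
      let ?f = "\<lambda>G. facet (F(Suc i := G))"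
      have "inj_on ?f {G. flag (F(Suc i := G)) \<and> x \<in> \<E> (?f G)}"
      proof (rule inj_onI)
        fix G G' assume "G \<in> {G. flag (F(Suc i := G)) \<and> x \<in> \<E> (?f G)}" "G' \<in> {G. flag (F(Suc i := G)) \<and> x \<in> \<E> (?f G)}"
          and "?f G = ?f G'"
        then have "F(Suc i := G) = F(Suc i := G')" using facet_inj by blast
        then show "G = G'" by (metis fun_upd_same)
      qed
      then have "card (?f ` {G. flag (F(Suc i := G)) \<and> x \<in> \<E> (?f G)}) = card {G. flag (F(Suc i := G)) \<and> x \<in> \<E> (?f G)}"
        by (rule card_image)
      moreover have "?f ` {G. flag (F(Suc i := G)) \<and> x \<in> \<E> (?f G)} = {\<sigma> \<in> ?f ` {G. flag (F(Suc i := G))}. x \<in> \<E> \<sigma>}"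
        by blast
      ultimately show ?thesis by simp
    qed
    then show ?thesis unfolding even_covering_iff adjacent_facets_fan[OF F] by simp
  qed
  have "(\<forall>\<sigma>\<in>facets fan. \<E> \<sigma> \<in> affine_subspaces_Z2 E r) \<and> (\<forall>\<sigma>\<in>facets fan. direction (\<E> \<sigma>) = T_Z2 \<sigma>) \<longleftrightarrow>
    (\<forall>F. flag F \<longrightarrow> (\<exists>a\<in>coord_space E. \<E> (facet F) = (+) a ` blocks F))"
    unfolding facets_fan using cosets by blast
  moreover have "(\<forall>\<tau>\<in>codim1_faces fan. even_covering (adjacent_facets fan \<tau>) \<E>) \<longleftrightarrow>
    (\<forall>F i x. flag F \<longrightarrow> Suc i < r \<longrightarrow> even (card {G. flag (F(Suc i := G)) \<and> x \<in> \<E> (facet (F(Suc i := G)))}))"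
    unfolding codim1_faces_fan using even by blast
  ultimately show ?thesis unfolding real_phase_structure_def fan_dim_fan by argo
qed

lemma phase_of_real_phase_structure:
  assumes "real_phase_structure E fan \<E>"
  shows "phase E Ind (\<lambda>F S. S \<subseteq> E \<and> ind S \<in> \<E> (facet F))"
proof
  have coset: "\<exists>a\<in>coord_space E. \<E> (facet F) = (+) a ` blocks F" if "flag F" for F
    using assms that unfolding real_phase_structure_iff by blast
  fix F assume F: "flag F"
  obtain a where a: "a \<in> coord_space E" "\<E> (facet F) = (+) a ` blocks F" using coset[OF F] by blast
  have sub: "vec.subspace (blocks F)" by (rule subspace_block_space)
  show "\<exists>S. S \<subseteq> E \<and> ind S \<in> \<E> (facet F)"
  proof (intro exI conjI)
    show "ind {i. a $ i = 1} \<in> \<E> (facet F)"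
      unfolding ind_support a(2) using vec.subspace_0[OF sub] by (metis add.right_neutral image_eqI)
    show "{i. a $ i = 1} \<subseteq> E" using a(1) ind_coord_space[of "{i. a $ i = 1}" E] unfolding ind_support by blast
  qed
  fix S assume S: "S \<subseteq> E \<and> ind S \<in> \<E> (facet F)"
  then show "S \<subseteq> E" by simp
  obtain v where v: "v \<in> blocks F" "ind S = a + v" using S a(2) by blast
  show "flip (F (Suc i) - F i) S \<subseteq> E \<and> ind (flip (F (Suc i) - F i) S) \<in> \<E> (facet F)" for i
  proof
    show "flip (F (Suc i) - F i) S \<subseteq> E" using S flag_sub[OF F, of "Suc i"] by (auto simp: flip_def)
    have "ind (flip (F (Suc i) - F i) S) = a + (ind (F (Suc i) - F i) + v)"
      unfolding ind_flip v(2) by (rule add.left_commute)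
    moreover have "ind (F (Suc i) - F i) + v \<in> blocks F" by (rule vec.subspace_add[OF sub ind_block[OF F] v(1)])
    ultimately show "ind (flip (F (Suc i) - F i) S) \<in> \<E> (facet F)" unfolding a(2) by blast
  qed
  fix S' i b c assume S': "S' \<subseteq> E \<and> ind S' \<in> \<E> (facet F)"
    and bc: "b \<in> F (Suc i) - F i" "c \<in> F (Suc i) - F i"
  \<comment> \<open>The relative sign of two elements of a block is that of the coset representative
    \<open>a\<close>, hence common to all members.\<close>
  have *: "(b \<in> S \<longleftrightarrow> c \<in> S) \<longleftrightarrow> a $ b = a $ c" if S: "ind S \<in> \<E> (facet F)" for S
  proof -
    obtain v where v: "v \<in> blocks F" "ind S = a + v" using S a(2) by blast
    have "v $ b = v $ c" by (rule blocks_const[OF F v(1) bc])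
    moreover have "ind S $ b = a $ b + v $ b" "ind S $ c = a $ c + v $ c" unfolding v(2) by (rule vector_add_component)+
    ultimately have "(ind S :: bit ^ 'e) $ b = ind S $ c \<longleftrightarrow> a $ b = a $ c"
      by (simp only: add_right_cancel)
    then show ?thesis by (simp add: ind_nth split: if_splits)
  qed
  show "(b \<in> S \<longleftrightarrow> c \<in> S) \<longleftrightarrow> (b \<in> S' \<longleftrightarrow> c \<in> S')" using * S S' by blast
next
  fix F i S assume F: "flag F" "Suc i < r"
  show "even (card {G. flag (F(Suc i := G)) \<and> S \<subseteq> E \<and> ind S \<in> \<E> (facet (F(Suc i := G)))})"
  proof (cases "S \<subseteq> E")
    case True
    have "even (card {G. flag (F(Suc i := G)) \<and> ind S \<in> \<E> (facet (F(Suc i := G)))})"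
      using assms F unfolding real_phase_structure_iff by blast
    then show ?thesis using True by simp
  qed simp
qed

end

context phase
begin

text \<open>\<open>U\<close> is a union of blocks, so flipping it amounts to successive single-block
  flips from the bottom up.\<close>

lemma PS_flip_blocks:
  assumes F: "flag F" "PS F S" and U: "ind U \<in> blocks F"
  shows "PS F (flip U S)"
proof -
  have UE: "U \<subseteq> E" using U blocks_coord_space ind_coord_space by blast
  have "PS F (flip (U \<inter> F k) S)" if "k \<le> r" for k
    using that
  proof (induction k)
    case 0
    have "flip (U \<inter> F 0) S = S" using flag_0[OF F(1)] by (simp add: flip_def)
    then show ?case using F(2) by simp
  next
    case (Suc k)
    have const: "j \<in> U \<longleftrightarrow> l \<in> U" if "j \<in> F (Suc k) - F k" "l \<in> F (Suc k) - F k" for j l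
      using blocks_const[OF F(1) U that] by (simp add: ind_nth split: if_splits)
    have m: "F k \<subseteq> F (Suc k)" using flag_mono[OF F(1)] by simp
    have IH: "PS F (flip (U \<inter> F k) S)" using Suc by simp
    show ?case
    proof (cases "U \<inter> (F (Suc k) - F k) = {}")
      case True
      then have "U \<inter> F (Suc k) = U \<inter> F k" using m by blast
      then show ?thesis using IH by simp
    next
      case False
      then have "F (Suc k) - F k \<subseteq> U" using const by blast
      then have "flip (U \<inter> F (Suc k)) S = flip (F (Suc k) - F k) (flip (U \<inter> F k) S)"
        using m unfolding flip_def by blast
      then show ?thesis using PS_flip[OF F(1) IH, of k] Suc.prems by simp
    qed
  qed
  from this[OF order_refl] show ?thesis using flag_top[OF F(1) order_refl] UE by (simp add: Int_absorb2)
qed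

text \<open>The space depends on the flag alone; two phases with a common member on a facet
  therefore coincide there.\<close>

lemma PS_coset:
  assumes F: "flag F" "PS F S"
  shows "{ind S' | S'. PS F S'} = (+) (ind S) ` blocks F"
proof (intro subset_antisym subsetI)
  fix x :: "bit ^ 'e" assume "x \<in> {ind S' | S'. PS F S'}"
  then obtain S' where S': "x = ind S'" "PS F S'" by blast
  have "(ind (flip S S') :: bit ^ 'e) \<in> blocks F"
  proof (rule blocksI[OF F(1)])
    show "(ind (flip S S') :: bit ^ 'e) $ i = 0" if "i \<notin> E" for i
      using PS_sub[OF F] PS_sub[OF F(1) S'(2)] that by (auto simp: ind_nth)
    show "(ind (flip S S') :: bit ^ 'e) $ j = ind (flip S S') $ k"
      if i: "i < r" "j \<in> F (Suc i) - F i" "k \<in> F (Suc i) - F i" for i j k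
      using PS_block[OF F S'(2) i] by (auto simp: ind_nth)
  qed
  moreover have "x = ind S + ind (flip S S')" unfolding S'(1) ind_flip[symmetric] flip_flip by (rule refl)
  ultimately show "x \<in> (+) (ind S) ` blocks F" by blast
next
  fix x :: "bit ^ 'e" assume "x \<in> (+) (ind S) ` blocks F"
  then obtain u where u: "u \<in> blocks F" "x = ind S + u" by blast
  define U where "U = {i. u $ i = 1}"
  have U: "ind U = u" unfolding U_def by (rule ind_support)
  have "PS F (flip U S)" by (rule PS_flip_blocks[OF F]) (simp only: U u)
  moreover have "x = ind (flip U S)" unfolding ind_flip U u(2) by (rule add.commute)
  ultimately show "x \<in> {ind S' | S'. PS F S'}" by blast
qed

end

subsection \<open>The bijection\<close>

context matroid_orientation
begin

lemma signvec_tope: assumes "signvec E S \<in> \<C>" shows "signvec E S \<in> topes \<C>"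
  unfolding topes_def
proof (intro CollectI conjI ballI impI assms)
  fix X assume X: "X \<in> \<C>" "sign_le (signvec E S) X"
  have "X $ i = signvec E S $ i" for i
  proof (cases "i \<in> E")
    case True
    have "signvec E S $ i = 0 \<or> signvec E S $ i = X $ i" using X(2) unfolding sign_le_def by (rule spec)
    then show ?thesis using signvec_nonzero[OF True, of S] by simp
  next
    case False
    then show ?thesis using outside[OF X(1)] by (simp add: signvec_nth)
  qed
  then show "X = signvec E S" by (simp add: vec_eq_iff)
qed

text \<open>\<open>flag_set\<close> records the levels strictly between 0 and \<open>r\<close>.
  Level 0 returns the vector itself, which is a tope by its full support, and the levels from
  \<open>r\<close> on return the zero covector.\<close>

lemma flag_topes_iff:
  assumes F: "flag F"
  shows "signvec E S \<in> flag_topes \<C> (flag_set r F) \<longleftrightarrow> (\<forall>i. zero_on (F i) (signvec E S) \<in> \<C>)"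
proof
  assume l: "signvec E S \<in> flag_topes \<C> (flag_set r F)"
  then have T: "signvec E S \<in> \<C>" by (simp add: flag_topes_def topes_def)
  show "\<forall>i. zero_on (F i) (signvec E S) \<in> \<C>"
  proof
    fix i
    consider "i = 0" | "0 < i" "i < r" | "r \<le> i" by linarith
    then show "zero_on (F i) (signvec E S) \<in> \<C>"
    proof cases
      case 1
      have "zero_on {} (signvec E S) = signvec E S" by (simp add: vec_eq_iff zero_on_nth)
      then show ?thesis using 1 T flag_0[OF F] by simp
    next
      case 2
      then show ?thesis using l flag_setI[OF 2, of F] by (simp add: flag_topes_def)
    next
      case 3
      then show ?thesis using flag_top[OF F 3] zero_on_ground[OF T] covector_zero by simp
    qed
  qed
next
  assume a: "\<forall>i. zero_on (F i) (signvec E S) \<in> \<C>"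
  have "zero_on {} (signvec E S) = signvec E S" by (simp add: vec_eq_iff zero_on_nth)
  then have "signvec E S \<in> \<C>" using a[rule_format, of 0] flag_0[OF F] by simp
  then show "signvec E S \<in> flag_topes \<C> (flag_set r F)"
    using a signvec_tope unfolding flag_topes_def flag_set_def by blast
qed

lemma phases_facet:
  assumes F: "flag F"
  shows "phases \<C> (facet F) = {ind S | S. PSC F S}"
proof -
  have "the_inv_into (flat_chains E Ind) (flag_cone E) (facet F) = flag_set r F"
    unfolding facet_def by (rule the_inv_into_f_f[OF inj_on_flag_cone flag_set_chain[OF F]])
  moreover have "facet F \<in> facets fan" unfolding facets_fan using F by blast
  ultimately have eq: "phases \<C> (facet F) =
      {\<epsilon> \<in> coord_space E. sign_power E \<epsilon> \<in> flag_topes \<C> (flag_set r F)}"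
    by (simp add: loopfree_phase_structure_def)
  have iff: "ind S \<in> phases \<C> (facet F) \<longleftrightarrow> PSC F S" for S
    unfolding eq mem_Collect_eq ind_coord_space sign_power_ind flag_topes_iff[OF F] PSC_def ..
  show ?thesis
  proof (intro subset_antisym subsetI)
    fix x :: "bit ^ 'e" assume "x \<in> phases \<C> (facet F)"
    then have "ind {i. x $ i = 1} \<in> phases \<C> (facet F)" unfolding ind_support .
    then have "PSC F {i. x $ i = 1}" unfolding iff .
    then show "x \<in> {ind S | S. PSC F S}"
      unfolding mem_Collect_eq by (intro exI[of _ "{i. x $ i = 1}"] conjI ind_support[symmetric])
  next
    fix x :: "bit ^ 'e" assume "x \<in> {ind S | S. PSC F S}"
    then obtain S where "x = ind S" "PSC F S" by blast
    then show "x \<in> phases \<C> (facet F)" unfolding iff[symmetric] by simp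
  qed
qed

lemma PSC_iff_phase:
  assumes "flag F" shows "PSC F S \<longleftrightarrow> ind S \<in> phases \<C> (facet F)"
  unfolding phases_facet[OF assms] mem_Collect_eq ind_eq_iff by blast

lemma real_phase_structure_orientation:
  "real_phase_structure E fan (phases \<C>)"
  unfolding real_phase_structure_iff
proof (intro conjI allI impI)
  show "phases \<C> \<in> extensional (facets fan)"
    unfolding loopfree_phase_structure_def by (rule restrict_extensional)
next
  fix F assume F: "flag F"
  obtain S where S: "PSC F S" using PSC_ex[OF F] by blast
  have "S \<subseteq> E" using S by (simp add: PSC_def)
  then show "\<exists>a\<in>coord_space E. phases \<C> (facet F) = (+) a ` blocks F"
    unfolding phases_facet[OF F] PS_coset[OF F S] using ind_coord_space by blast
next
  fix F i and x :: "bit ^ 'e" assume F: "flag F" "Suc i < r"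
  define S where "S = {i. x $ i = 1}"
  have x: "x = ind S" unfolding S_def by (rule ind_support[symmetric])
  have "x \<in> phases \<C> (facet (F(Suc i := G))) \<longleftrightarrow> PSC (F(Suc i := G)) S"
    if "flag (F(Suc i := G))" for G
    unfolding PSC_iff_phase[OF that] x ..
  then have "{G. flag (F(Suc i := G)) \<and> x \<in> phases \<C> (facet (F(Suc i := G)))} =
    {G. flag (F(Suc i := G)) \<and> PSC (F(Suc i := G)) S}" by (intro Collect_cong conj_cong refl)
  then show "even (card {G. flag (F(Suc i := G)) \<and> x \<in> phases \<C> (facet (F(Suc i := G)))})"
    using PSC_even[OF F(2)] by (simp only:)
qed

end

context loopfree_matroid
begin

lemma orientation_iff: "\<C> \<in> orientations E Ind \<longleftrightarrow> matroid_orientation E Ind \<C>"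
  unfolding orientations_def matroid_orientation_def matroid_orientation_axioms_def
  using loopfree_matroid_axioms by blast

lemma loopfree_bij_betw:
  "bij_betw phases (orientations E Ind) {\<E>. real_phase_structure E fan \<E>}"
  unfolding bij_betw_def
proof
  show "inj_on phases (orientations E Ind)"
  proof (rule inj_onI)
    fix \<C> \<C>' assume o: "\<C> \<in> orientations E Ind" "\<C>' \<in> orientations E Ind"
      and eq: "phases \<C> = phases \<C>'"
    interpret C: matroid_orientation E Ind \<C> using o(1) orientation_iff by simp
    interpret C': matroid_orientation E Ind \<C>' using o(2) orientation_iff by simp
    have "C.PSC F S \<longleftrightarrow> C'.PSC F S" if "flag F" for F S
      unfolding C.PSC_iff_phase[OF that] C'.PSC_iff_phase[OF that] eq ..
    then show "\<C> = \<C>'" using C.covectors_from_flags C'.covectors_from_flags by blast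
  qed
next
  show "phases ` orientations E Ind = {\<E>. real_phase_structure E fan \<E>}"
  proof (intro subset_antisym subsetI)
    fix \<E> assume "\<E> \<in> phases ` orientations E Ind"
    then obtain \<C> where \<C>: "\<C> \<in> orientations E Ind" "\<E> = phases \<C>" by blast
    interpret C: matroid_orientation E Ind \<C> using \<C>(1) orientation_iff by simp
    show "\<E> \<in> {\<E>. real_phase_structure E fan \<E>}"
      using C.real_phase_structure_orientation \<C>(2) by simp
  next
    fix \<E> assume "\<E> \<in> {\<E>. real_phase_structure E fan \<E>}"
    then have \<E>: "real_phase_structure E fan \<E>" by simp
    interpret P: phase E Ind "\<lambda>F S. S \<subseteq> E \<and> ind S \<in> \<E> (facet F)"
      by (rule phase_of_real_phase_structure[OF \<E>])
    obtain \<C> where \<C>: "oriented_matroid E \<C>" "{E - supp X | X. X \<in> \<C>} = flats E Ind"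
      "\<forall>F S i. flag F \<longrightarrow> S \<subseteq> E \<and> ind S \<in> \<E> (facet F) \<longrightarrow> i \<le> r \<longrightarrow> zero_on (F i) (signvec E S) \<in> \<C>"
      using P.phase_oriented by (elim exE conjE)
    have o: "\<C> \<in> orientations E Ind" unfolding orientations_def using \<C>(1,2) by blast
    interpret C: matroid_orientation E Ind \<C> using o orientation_iff by simp
    have PSC: "C.PSC F S" if "flag F" "S \<subseteq> E \<and> ind S \<in> \<E> (facet F)" for F S
      unfolding C.PSC_def
    proof (intro conjI allI)
      fix i
      show "zero_on (F i) (signvec E S) \<in> \<C>"
      \<comment> \<open>\<open>PSC\<close> asks for all levels; beyond \<open>r\<close> the padding
        repeats \<open>F r\<close>.\<close>
      proof (cases "i \<le> r")
        case False
        then have "F i = F r" using flag_top[OF that(1)] by simp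
        then show ?thesis using \<C>(3)[rule_format, OF that order_refl] by simp
      qed (rule \<C>(3)[rule_format, OF that])
    qed (use that in blast)
    have "\<E> \<sigma> = phases \<C> \<sigma>" if \<sigma>: "\<sigma> \<in> facets fan" for \<sigma>
    proof -
      obtain F where F: "flag F" "\<sigma> = facet F" using \<sigma> unfolding facets_fan by blast
      obtain S where S: "S \<subseteq> E \<and> ind S \<in> \<E> (facet F)" using P.PS_ex[OF F(1)] by blast
      obtain a where a: "a \<in> coord_space E" "\<E> (facet F) = (+) a ` blocks F"
        using \<E> F(1) unfolding real_phase_structure_iff by blast
      have "x \<in> {ind S' | S'. S' \<subseteq> E \<and> ind S' \<in> \<E> (facet F)}" if x: "x \<in> \<E> (facet F)" for x
      proof -
        obtain v where v: "v \<in> blocks F" "x = a + v" using x a(2) by blast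
        have "v \<in> coord_space E" using v(1) blocks_coord_space by blast
        then have "x \<in> coord_space E" using a(1) unfolding v(2) coord_space_def by (simp del: add_bit_eq_xor)
        then have "{i. x $ i = 1} \<subseteq> E" using ind_coord_space[of "{i. x $ i = 1}" E] unfolding ind_support by blast
        moreover have "ind {i. x $ i = 1} \<in> \<E> (facet F)" unfolding ind_support by (rule x)
        ultimately show ?thesis
          unfolding mem_Collect_eq by (intro exI[of _ "{i. x $ i = 1}"] conjI ind_support[symmetric])
      qed
      then have "\<E> (facet F) = {ind S' | S'. S' \<subseteq> E \<and> ind S' \<in> \<E> (facet F)}"
        by (intro subset_antisym subsetI) blast+
      \<comment> \<open>Both phases contain \<open>S\<close> on this facet, so both are the coset of
        \<open>blocks F\<close> through \<open>ind S\<close>.\<close>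
      also have "\<dots> = (+) (ind S) ` blocks F" by (rule P.PS_coset[OF F(1) S])
      also have "\<dots> = {ind S' | S'. C.PSC F S'}" by (rule C.PS_coset[OF F(1) PSC[OF F(1) S], symmetric])
      also have "\<dots> = phases \<C> (facet F)"
        by (rule C.phases_facet[OF F(1), symmetric])
      finally show ?thesis unfolding F(2) .
    qed
    moreover have "\<E> \<in> extensional (facets fan)" using \<E> unfolding real_phase_structure_iff by blast
    moreover have "phases \<C> \<in> extensional (facets fan)"
      unfolding loopfree_phase_structure_def by (rule restrict_extensional)
    ultimately have "\<E> = phases \<C>" by (intro extensionalityI)
    then show "\<E> \<in> phases ` orientations E Ind" using o by blast
  qed
qed

end

section \<open>Removal of loops\<close>

context matroid
begin

lemma loops_disjoint: assumes "I \<in> Ind" shows "I \<inter> loops E Ind = {}"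
proof -
  have "x \<notin> loops E Ind" if x: "x \<in> I" for x
  proof -
    have "{x} \<in> Ind" by (rule indep_down[OF assms]) (use x in simp)
    then have "rk {x} = 1" using rk_indep by simp
    then show ?thesis by (simp add: loops_def mat_closure_def rk_empty)
  qed
  then show ?thesis by blast
qed

text \<open>Independent sets contain no loops, so the empty set is the only basis of the set of
  loops; contracting it shrinks the ground set but keeps the independent sets.\<close>

lemma contract_loops: "contract Ind (loops E Ind) = Ind"
proof -
  have "basis_of Ind (loops E Ind) B \<longleftrightarrow> B = {}" for B
  proof
    assume "basis_of Ind (loops E Ind) B"
    then show "B = {}" using loops_disjoint[of B] by (auto simp: basis_of_def)
  next
    assume "B = {}"
    then show "basis_of Ind (loops E Ind) B"
      using loops_disjoint indep_empty by (auto simp: basis_of_def)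
  qed
  then show ?thesis using loops_disjoint by (auto simp: contract_def)
qed

lemma matroid_delete_loops: "matroid (E - loops E Ind) Ind" "loops (E - loops E Ind) Ind = {}"
proof -
  show "matroid (E - loops E Ind) Ind"
  proof
    show "finite (E - loops E Ind)" using finite_ground by simp
    show "I \<in> Ind \<Longrightarrow> I \<subseteq> E - loops E Ind" for I using indep_subset[of I] loops_disjoint[of I] by auto
  qed (fact indep_empty, fact indep_down, fact indep_augment)
  show "loops (E - loops E Ind) Ind = {}" by (auto simp: loops_def mat_closure_def)
qed

lemma flats_delete_loops:
  "flats (E - loops E Ind) Ind = (\<lambda>F. F - loops E Ind) ` flats E Ind"
proof -
  define L where "L = loops E Ind"
  have LE: "L \<subseteq> E" and Lcl: "L = cl {}" using cl_subset_ground by (auto simp: L_def loops_def)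
  have cl': "mat_closure (E - L) Ind A = cl A - L" for A by (auto simp: mat_closure_def)
  show ?thesis
    unfolding L_def[symmetric]
  proof (intro subset_antisym subsetI)
    fix F assume "F \<in> flats (E - L) Ind"
    then have F: "F \<subseteq> E - L" "cl F - L = F" by (auto simp: flats_def cl')
    have "L \<subseteq> cl F" unfolding Lcl by (rule cl_mono) simp
    moreover have "cl F \<in> flats E Ind" by (rule flat_cl) (use F(1) in blast)
    ultimately show "F \<in> (\<lambda>F. F - L) ` flats E Ind" using F(2) by blast
  next
    fix F assume "F \<in> (\<lambda>F. F - L) ` flats E Ind"
    then obtain F' where F': "F' \<in> flats E Ind" "F = F' - L" by blast
    have FE: "F \<subseteq> E - L" using F' flat_subset by blast
    have "cl F \<subseteq> F'" by (rule cl_least[OF _ F'(1)]) (use F'(2) in blast)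
    moreover have "F \<subseteq> cl F" by (rule subset_cl) (use FE in blast)
    ultimately have "cl F - L = F" using F'(2) by blast
    then show "F \<in> flats (E - L) Ind" using FE by (simp add: flats_def cl')
  qed
qed

end

lemma orientations_vanish_on_loops:
  fixes E :: "'e::finite set"
  assumes "matroid E Ind" "\<C> \<in> orientations E Ind" "X \<in> \<C>" "i \<in> loops E Ind"
  shows "X $ i = 0"
proof -
  interpret matroid E Ind by fact
  have "E - supp X \<in> flats E Ind" using assms(2,3) by (auto simp: orientations_def)
  then have "cl {} \<subseteq> E - supp X" by (intro cl_least) simp_all
  then show ?thesis using assms(4) by (auto simp: loops_def supp_def)
qed

text \<open>Every flat contains all loops, so covectors of an orientation vanish there. Passing to
  the smaller ground set therefore keeps the sign vectors and only removes the loops from the zero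
  sets.\<close>

lemma orientations_delete_loops:
  fixes E :: "'e::finite set"
  assumes "matroid E Ind"
  shows "orientations (E - loops E Ind) Ind = orientations E Ind"
proof -
  interpret matroid E Ind by fact
  define L where "L = loops E Ind"
  have LE: "L \<subseteq> E" using cl_subset_ground by (simp add: L_def loops_def)
  have Lflat: "L \<subseteq> F" if "flat F" for F unfolding L_def loops_def by (rule cl_least[OF _ that]) simp
  have om: "oriented_matroid (E - L) \<C> \<longleftrightarrow> oriented_matroid E \<C>" if van: "\<And>X i. X \<in> \<C> \<Longrightarrow> i \<in> L \<Longrightarrow> X $ i = 0" for \<C> :: "(int ^ 'e) set"
  proof -
    have "\<C> \<subseteq> sign_vectors (E - L) \<longleftrightarrow> \<C> \<subseteq> sign_vectors E"
      using van by (auto simp: sign_vectors_def coord_space_def subset_iff)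
    then show ?thesis unfolding oriented_matroid_def by simp
  qed
  have zeros: "{(E - L) - supp X | X. X \<in> \<C>} = (\<lambda>F. F - L) ` {E - supp X | X. X \<in> \<C>}" for \<C> :: "(int ^ 'e) set"
  proof -
    have "(E - L) - supp X = (E - supp X) - L" for X :: "int ^ 'e" by blast
    then show ?thesis unfolding Setcompr_eq_image image_image by simp
  qed
  \<comment> \<open>On sets containing \<open>L\<close>, removing \<open>L\<close> is injective, so
    equality of the reduced families gives equality of the original ones.\<close>
  have restore: "(\<lambda>F. F \<union> L) ` (\<lambda>F. F - L) ` \<S> = \<S>" if "\<And>F. F \<in> \<S> \<Longrightarrow> L \<subseteq> F" for \<S>
  proof -
    have "(\<lambda>F. (F - L) \<union> L) ` \<S> = (\<lambda>F. F) ` \<S>" by (rule image_cong[OF refl]) (use that in blast)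
    then show ?thesis unfolding image_image by simp
  qed
  show ?thesis
    unfolding L_def[symmetric]
  proof (intro subset_antisym subsetI)
    fix \<C> assume a: "\<C> \<in> orientations (E - L) Ind"
    then have sv: "\<C> \<subseteq> sign_vectors (E - L)" by (simp add: orientations_def oriented_matroid_def)
    then have van: "X $ i = 0" if "X \<in> \<C>" "i \<in> L" for X i
      using that by (auto simp: sign_vectors_def coord_space_def subset_iff)
    have "{(E - L) - supp X | X. X \<in> \<C>} = flats (E - L) Ind" using a by (simp add: orientations_def)
    then have sub: "(\<lambda>F. F - L) ` {E - supp X | X. X \<in> \<C>} = (\<lambda>F. F - L) ` flats E Ind"
      unfolding zeros flats_delete_loops[folded L_def] .
    have L1: "L \<subseteq> E - supp X" if "X \<in> \<C>" for X using van[OF that] LE by (auto simp: supp_def)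
    have "{E - supp X | X. X \<in> \<C>} = (\<lambda>F. F \<union> L) ` (\<lambda>F. F - L) ` {E - supp X | X. X \<in> \<C>}"
      by (rule restore[symmetric]) (use L1 in blast)
    also have "\<dots> = (\<lambda>F. F \<union> L) ` (\<lambda>F. F - L) ` flats E Ind" unfolding sub ..
    also have "\<dots> = flats E Ind" by (rule restore) (rule Lflat)
    finally have "{E - supp X | X. X \<in> \<C>} = flats E Ind" .
    moreover have "oriented_matroid E \<C>" using a om[OF van] by (simp add: orientations_def)
    ultimately show "\<C> \<in> orientations E Ind" unfolding orientations_def by blast
  next
    fix \<C> assume a: "\<C> \<in> orientations E Ind"
    then have van: "X $ i = 0" if "X \<in> \<C>" "i \<in> L" for X i
      using orientations_vanish_on_loops[OF assms a] that by (simp add: L_def)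
    have "{E - supp X | X. X \<in> \<C>} = flats E Ind" using a by (simp add: orientations_def)
    then have "{(E - L) - supp X | X. X \<in> \<C>} = flats (E - L) Ind"
      unfolding zeros flats_delete_loops[folded L_def] by (simp only:)
    moreover have "oriented_matroid (E - L) \<C>" using a om[OF van] by (simp add: orientations_def)
    ultimately show "\<C> \<in> orientations (E - L) Ind" unfolding orientations_def by blast
  qed
qed

lemma delete_loops:
  fixes E :: "'e::finite set"
  assumes "matroid E Ind" "\<C> \<in> orientations E Ind"
  shows "delete \<C> (loops E Ind) = \<C>"
proof -
  have "zero_on (loops E Ind) X = X" if "X \<in> \<C>" for X
    using orientations_vanish_on_loops[OF assms that] by (simp add: vec_eq_iff zero_on_nth)
  then show ?thesis by (simp add: delete_def)
qed

theorem theorem1p1: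
  fixes E :: "'e::finite set" and Ind :: "'e set set"
  assumes "matroid E Ind"
  shows "bij_betw (phase_structure E Ind) (orientations E Ind)
           {\<E>. real_phase_structure (E - loops E Ind) (matroid_fan E Ind) \<E>}"
proof -
  interpret matroid E Ind by fact
  interpret L: loopfree_matroid "E - loops E Ind" Ind
    unfolding loopfree_matroid_def loopfree_matroid_axioms_def
    using matroid_delete_loops by simp
  have "phase_structure E Ind \<C> = loopfree_phase_structure (E - loops E Ind) Ind \<C>"
    if "\<C> \<in> orientations E Ind" for \<C>
    using delete_loops[OF assms that] by (simp add: phase_structure_def contract_loops)
  moreover have "bij_betw (loopfree_phase_structure (E - loops E Ind) Ind) (orientations E Ind)
      {\<E>. real_phase_structure (E - loops E Ind) (matroid_fan E Ind) \<E>}"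
    using L.loopfree_bij_betw unfolding orientations_delete_loops[OF assms] matroid_fan_def contract_loops .
  ultimately show ?thesis by (simp cong: bij_betw_cong)
qed

end
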